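(* Let $\rho_A$ be a state of $A$ and $\sigma_B$ a state of $B$. Let $\mathcal{D}$ be a subset of the state space of $R$ such that the maximally mixed state $\mathbb{1}/d$ ($d=d_R$) lies in its interior (relative to the $(d^2-1)$-dimensional real affine space of unit-trace Hermitian operators on $\mathcal{H}_R$), and let $\partial\mathcal{D}$ be its boundary, a closed $(d^2-2)$-dimensional surface in the state space of $R$ enclosing $\mathbb{1}/d$. Then there exists a $G$-covariant quantum channel $\mathcal{E}:\mathcal{B}(\mathcal{H}_A)\to\mathcal{B}(\mathcal{H}_B)$ with $\mathcal{E}(\rho)=\sigma$ if and only if $\Delta H_\eta\ge 0$ for all reference states $\eta\in\partial\mathcal{D}$.
   Context: $G$ is a compact group with normalized Haar measure $dg$. Finite-dimensional systems $A,B$ carry continuous unitary representations $U_A(g),U_B(g)$. The reference system $R$ has $\mathcal{H}_R$ with $d_R=d_B$ and carries the dual representation $U_R(g)=\overline{U_B(g)}$ (complex conjugate in a fixed orthonormal basis). A channel (CPTP map) $\mathcal{E}$ from $A$ to $B$ is $G$-covariant if $\mathcal{E}(U_A(g)XU_A(g)^\dagger)=U_B(g)\mathcal{E}(X)U_B(g)^\dagger$ for all $g$ and all $X$. The $G$-twirl on $RX$ ($X=A$ or $B$) is $\mathcal{G}(M)=\int dg\,(U_R(g)\otimes U_X(g))M(U_R(g)\otimes U_X(g))^\dagger$. The conditional min-entropy of a positive operator $\Omega_{RX}$ is $H_{\min}(R|X)_\Omega=-\log_2\inf_{Y\ge0}\{\mathrm{tr}[Y]:\mathbb{1}_R\otimes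 Y\ge\Omega_{RX}\}$. For a state $\eta$ on $R$ and a state $\tau$ on $X$, $H_\eta(\tau):=H_{\min}(R|X)_{\mathcal{G}(\eta\otimes\tau)}$, and $\Delta H_\eta:=H_\eta(\sigma)-H_\eta(\rho)$. *)

theory Defs
  imports "HOL-Probability.Probability" "HOL-Algebra.Group" "Jordan_Normal_Form.Matrix"
begin

definition adj :: "complex mat \<Rightarrow> complex mat" where
  "adj A = mat (dim_col A) (dim_row A) (\<lambda>(i,j). cnj (A $$ (j,i)))"

definition conjm :: "complex mat \<Rightarrow> complex mat" where
  "conjm A = map_mat cnj A"

definition mtrace :: "complex mat \<Rightarrow> complex" where
  "mtrace A = (\<Sum>i<dim_row A. A $$ (i,i))"

definition kron :: "complex mat \<Rightarrow> complex mat \<Rightarrow> complex mat" where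
  "kron A B = mat (dim_row A * dim_row B) (dim_col A * dim_col B)
     (\<lambda>(i,j). A $$ (i div dim_row B, j div dim_col B) * B $$ (i mod dim_row B, j mod dim_col B))"

definition unitary_mat :: "nat \<Rightarrow> complex mat \<Rightarrow> bool" where
  "unitary_mat n U \<longleftrightarrow> U \<in> carrier_mat n n \<and> adj U * U = 1\<^sub>m n \<and> U * adj U = 1\<^sub>m n"

definition psd :: "complex mat \<Rightarrow> bool" where
  "psd A \<longleftrightarrow> A \<in> carrier_mat (dim_row A) (dim_row A) \<and> adj A = A \<and>
     (\<forall>v. dim_vec v = dim_row A \<longrightarrow>
        0 \<le> Re (\<Sum>i<dim_row A. cnj (v $ i) * (A *\<^sub>v v) $ i))"

definition is_state :: "nat \<Rightarrow> complex mat \<Rightarrow> bool" where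
  "is_state n \<rho> \<longleftrightarrow> \<rho> \<in> carrier_mat n n \<and> psd \<rho> \<and> mtrace \<rho> = 1"

definition max_mixed :: "nat \<Rightarrow> complex mat" where
  "max_mixed n = (1 / of_nat n) \<cdot>\<^sub>m 1\<^sub>m n"

text \<open>(id_k \<otimes> E)(M) for M a (k*dA)x(k*dA) matrix; reference index is the outer one.\<close>
definition ampl :: "nat \<Rightarrow> nat \<Rightarrow> nat \<Rightarrow> (complex mat \<Rightarrow> complex mat) \<Rightarrow> complex mat \<Rightarrow> complex mat" where
  "ampl k dA dB E M = mat (k * dB) (k * dB) (\<lambda>(p,q).
      E (mat dA dA (\<lambda>(a,b). M $$ ((p div dB) * dA + a, (q div dB) * dA + b))) $$ (p mod dB, q mod dB))"

definition channel :: "nat \<Rightarrow> nat \<Rightarrow> (complex mat \<Rightarrow> complex mat) \<Rightarrow> bool" where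
  "channel dA dB E \<longleftrightarrow>
     (\<forall>X \<in> carrier_mat dA dA. E X \<in> carrier_mat dB dB) \<and>
     (\<forall>X \<in> carrier_mat dA dA. \<forall>Y \<in> carrier_mat dA dA. E (X + Y) = E X + E Y) \<and>
     (\<forall>X \<in> carrier_mat dA dA. \<forall>c. E (c \<cdot>\<^sub>m X) = c \<cdot>\<^sub>m E X) \<and>
     (\<forall>X \<in> carrier_mat dA dA. mtrace (E X) = mtrace X) \<and>
     (\<forall>k. \<forall>M \<in> carrier_mat (k * dA) (k * dA). psd M \<longrightarrow> psd (ampl k dA dB E M))"

definition borel_sets_of :: "'g topology \<Rightarrow> 'g set set" where
  "borel_sets_of T = sigma_sets (topspace T) {S. openin T S}"

definition compact_group :: "('g, 'b) monoid_scheme \<Rightarrow> 'g topology \<Rightarrow> bool" where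
  "compact_group G T \<longleftrightarrow> group G \<and> topspace T = carrier G \<and> compact_space T \<and> Hausdorff_space T \<and>
     continuous_map (prod_topology T T) T (\<lambda>(x,y). x \<otimes>\<^bsub>G\<^esub> y) \<and>
     continuous_map T T (\<lambda>x. inv\<^bsub>G\<^esub> x)"

definition haar_prob :: "('g, 'b) monoid_scheme \<Rightarrow> 'g topology \<Rightarrow> 'g measure \<Rightarrow> bool" where
  "haar_prob G T \<mu> \<longleftrightarrow> prob_space \<mu> \<and> space \<mu> = carrier G \<and> sets \<mu> = borel_sets_of T \<and>
     (\<forall>g \<in> carrier G. \<forall>A \<in> sets \<mu>.
        measure \<mu> ((\<lambda>h. g \<otimes>\<^bsub>G\<^esub> h) ` A) = measure \<mu> A \<and>
        measure \<mu> ((\<lambda>h. h \<otimes>\<^bsub>G\<^esub> g) ` A) = measure \<mu> A)"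

definition unitary_rep :: "('g, 'b) monoid_scheme \<Rightarrow> 'g topology \<Rightarrow> nat \<Rightarrow> ('g \<Rightarrow> complex mat) \<Rightarrow> bool" where
  "unitary_rep G T n U \<longleftrightarrow>
     (\<forall>g \<in> carrier G. unitary_mat n (U g)) \<and>
     (\<forall>g \<in> carrier G. \<forall>h \<in> carrier G. U (g \<otimes>\<^bsub>G\<^esub> h) = U g * U h) \<and>
     U \<one>\<^bsub>G\<^esub> = 1\<^sub>m n \<and>
     (\<forall>i<n. \<forall>j<n. continuous_map T euclidean (\<lambda>g. U g $$ (i,j)))"

definition covariant :: "('g, 'b) monoid_scheme \<Rightarrow> nat \<Rightarrow> ('g \<Rightarrow> complex mat) \<Rightarrow> ('g \<Rightarrow> complex mat)
    \<Rightarrow> (complex mat \<Rightarrow> complex mat) \<Rightarrow> bool" where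
  "covariant G dA UA UB E \<longleftrightarrow>
     (\<forall>g \<in> carrier G. \<forall>X \<in> carrier_mat dA dA. E (UA g * X * adj (UA g)) = UB g * E X * adj (UB g))"

definition twirl :: "'g measure \<Rightarrow> ('g \<Rightarrow> complex mat) \<Rightarrow> complex mat \<Rightarrow> complex mat" where
  "twirl \<mu> V M = mat (dim_row M) (dim_col M) (\<lambda>(i,j). LINT g|\<mu>. (V g * M * adj (V g)) $$ (i,j))"

definition Hmin :: "nat \<Rightarrow> nat \<Rightarrow> complex mat \<Rightarrow> real" where
  "Hmin dR dX \<Omega> = - log 2 (Inf {Re (mtrace Y) | Y. Y \<in> carrier_mat dX dX \<and> psd Y \<and>
                                    psd (kron (1\<^sub>m dR) Y - \<Omega>)})"

text \<open>H_eta(tau) = H_min(R|X) of the twirl of eta \<otimes> tau, with U_R = conj U_B.\<close>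
definition H_eta :: "'g measure \<Rightarrow> nat \<Rightarrow> ('g \<Rightarrow> complex mat) \<Rightarrow> nat \<Rightarrow> ('g \<Rightarrow> complex mat)
    \<Rightarrow> complex mat \<Rightarrow> complex mat \<Rightarrow> real" where
  "H_eta \<mu> dB UB dX UX \<eta> \<tau> = Hmin dB dX (twirl \<mu> (\<lambda>g. kron (conjm (UB g)) (UX g)) (kron \<eta> \<tau>))"

definition Delta_H :: "'g measure \<Rightarrow> nat \<Rightarrow> ('g \<Rightarrow> complex mat) \<Rightarrow> nat \<Rightarrow> ('g \<Rightarrow> complex mat)
    \<Rightarrow> complex mat \<Rightarrow> complex mat \<Rightarrow> complex mat \<Rightarrow> real" where
  "Delta_H \<mu> dA UA dB UB \<eta> \<rho> \<sigma> = H_eta \<mu> dB UB dB UB \<eta> \<sigma> - H_eta \<mu> dB UB dA UA \<eta> \<rho>"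

definition herm1 :: "nat \<Rightarrow> complex mat set" where
  "herm1 n = {X \<in> carrier_mat n n. adj X = X \<and> mtrace X = 1}"

definition hs_dist :: "complex mat \<Rightarrow> complex mat \<Rightarrow> real" where
  "hs_dist X Y = sqrt (\<Sum>i<dim_row X. \<Sum>j<dim_col X. (cmod (X $$ (i,j) - Y $$ (i,j)))\<^sup>2)"

definition rel_int :: "nat \<Rightarrow> complex mat set \<Rightarrow> complex mat set" where
  "rel_int n D = {X \<in> herm1 n. \<exists>e>0. \<forall>Y \<in> herm1 n. hs_dist X Y < e \<longrightarrow> Y \<in> D}"

definition rel_bdry :: "nat \<Rightarrow> complex mat set \<Rightarrow> complex mat set" where
  "rel_bdry n D = {X \<in> herm1 n. \<forall>e>0.
      (\<exists>Y \<in> herm1 n \<inter> D. hs_dist X Y < e) \<and> (\<exists>Y \<in> herm1 n - D. hs_dist X Y < e)}"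

end

theory Submission
  imports Defs
begin

text \<open>For a channel \<open>E\<close> that is covariant and maps \<open>\<rho>\<close> to \<open>\<sigma>\<close>, the map \<open>id \<otimes> E\<close> sends the twirl of
  \<open>\<eta> \<otimes> \<rho>\<close> to the twirl of \<open>\<eta> \<otimes> \<sigma>\<close>, and it carries a dominating operator \<open>1 \<otimes> Y\<close> to one with the same
  trace. Conversely, covariant channels correspond to positive \<open>Z\<close> on \<open>R \<otimes> A\<close> that are invariant under the
  group and have \<open>tr\<^sub>R Z = 1\<close>. Minimise \<open>|tr\<^sub>R Z - 1|\<^sup>2 + |E\<^sub>Z \<rho> - \<sigma>|\<^sup>2\<close> over the closed convex cone of invariant
  positive \<open>Z\<close>. If the minimum is positive, the residual is a pair of Hermitian operators \<open>(y, - \<eta>)\<close> with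
  \<open>tr ((1 \<otimes> y - \<eta> \<otimes> \<rho>) Z) \<ge> 0\<close> on the cone. Taking for \<open>Z\<close> the averages of rank one projections gives
  \<open>1 \<otimes> y' \<ge> \<G>(\<eta> \<otimes> \<rho>)\<close>, where \<open>tr y' = tr y\<close> is strictly less than the overlap of \<open>\<G>(\<eta> \<otimes> \<sigma>)\<close> with the
  invariant maximally entangled vector, hence strictly less than the trace of every operator dominating
  \<open>\<G>(\<eta> \<otimes> \<sigma>)\<close>. An affine change of \<open>\<eta>\<close> puts it on the boundary of \<open>D\<close> without affecting this.\<close>

section \<open>Positive semidefinite kernels\<close>

text \<open>In the converse direction no exact value of the min-entropy enters. An explicit
  dominating operator bounds the infimum for \<rho> from above, one test vector bounds the infimum
  for \<sigma> from below, and the gap between them is strict because it is the squared norm of the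
  residual.

  Minimising a square avoids asking whether the image of the cone under the constraints is closed:
  the condition on tr_R Z bounds the trace of Z, so a minimiser exists, and the first-order
  conditions there already form a separating functional.

  The \<eta> so obtained is only Hermitian; its trace and its sign are not under control. Adding a
  multiple of the identity repairs this: 1 \<otimes> \<rho> twirls to 1 tensored with an operator of
  trace one, and tr \<sigma> = 1, so both sides of the inequality gain the same constant, while
  positive scaling multiplies both. Hence only the direction of the traceless part of \<eta>
  matters, and every direction from the maximally mixed state meets the boundary of D since states
  are bounded. A vanishing traceless part leaves no direction and has to be excluded
  separately.\<close>

definition psd_on :: "'i set \<Rightarrow> ('i \<Rightarrow> 'i \<Rightarrow> complex) \<Rightarrow> bool" where
  "psd_on I A \<longleftrightarrow> (\<forall>i\<in>I. \<forall>j\<in>I. A j i = cnj (A i j)) \<and>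
     (\<forall>v. 0 \<le> Re (\<Sum>i\<in>I. \<Sum>j\<in>I. cnj (v i) * A i j * v j))"

lemma psd_onI:
  assumes "\<And>i j. i \<in> I \<Longrightarrow> j \<in> I \<Longrightarrow> A j i = cnj (A i j)"
    and "\<And>v. 0 \<le> Re (\<Sum>i\<in>I. \<Sum>j\<in>I. cnj (v i) * A i j * v j)"
  shows "psd_on I A"
  using assms unfolding psd_on_def by blast

lemma psd_on_herm: "psd_on I A \<Longrightarrow> i \<in> I \<Longrightarrow> j \<in> I \<Longrightarrow> A j i = cnj (A i j)"
  unfolding psd_on_def by blast

lemma psd_on_quad: "psd_on I A \<Longrightarrow> 0 \<le> Re (\<Sum>i\<in>I. \<Sum>j\<in>I. cnj (v i) * A i j * v j)"
  unfolding psd_on_def by blast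

lemma psd_on_cong:
  assumes "\<And>i j. i \<in> I \<Longrightarrow> j \<in> I \<Longrightarrow> A i j = B i j"
  shows "psd_on I A \<longleftrightarrow> psd_on I B"
proof -
  have "(\<Sum>i\<in>I. \<Sum>j\<in>I. cnj (v i) * A i j * v j) = (\<Sum>i\<in>I. \<Sum>j\<in>I. cnj (v i) * B i j * v j)" for v
    by (intro sum.cong refl) (simp add: assms)
  thus ?thesis unfolding psd_on_def using assms by auto
qed

lemma psd_on_reindex:
  assumes "bij_betw f I J"
  shows "psd_on J A \<longleftrightarrow> psd_on I (\<lambda>i j. A (f i) (f j))"
proof
  assume A: "psd_on J A"
  show "psd_on I (\<lambda>i j. A (f i) (f j))"
  proof (rule psd_onI)
    fix i j assume "i \<in> I" "j \<in> I"
    then show "A (f j) (f i) = cnj (A (f i) (f j))"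
      by (intro psd_on_herm[OF A]) (use bij_betwE[OF assms] in auto)
  next
    fix v :: "'a \<Rightarrow> complex"
    define w where "w = (\<lambda>x. v (inv_into I f x))"
    have w: "w (f i) = v i" if "i \<in> I" for i
      using that assms by (simp add: w_def bij_betw_inv_into_left)
    have "(\<Sum>i\<in>I. \<Sum>j\<in>I. cnj (v i) * A (f i) (f j) * v j)
      = (\<Sum>i\<in>I. \<Sum>j\<in>I. cnj (w (f i)) * A (f i) (f j) * w (f j))"
      by (intro sum.cong refl) (simp add: w)
    also have "\<dots> = (\<Sum>i\<in>J. \<Sum>j\<in>J. cnj (w i) * A i j * w j)"
      by (subst sum.reindex_bij_betw[OF assms, symmetric], rule sum.cong[OF refl])
         (rule sum.reindex_bij_betw[OF assms])
    finally show "0 \<le> Re (\<Sum>i\<in>I. \<Sum>j\<in>I. cnj (v i) * A (f i) (f j) * v j)"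
      using psd_on_quad[OF A] by simp
  qed
next
  assume A: "psd_on I (\<lambda>i j. A (f i) (f j))"
  show "psd_on J A"
  proof (rule psd_onI)
    fix i j assume "i \<in> J" "j \<in> J"
    then obtain a b where "a \<in> I" "b \<in> I" "f a = i" "f b = j"
      using assms by (metis bij_betw_iff_bijections)
    then show "A j i = cnj (A i j)" using psd_on_herm[OF A] by metis
  next
    fix v
    have "(\<Sum>i\<in>J. \<Sum>j\<in>J. cnj (v i) * A i j * v j)
       = (\<Sum>i\<in>I. \<Sum>j\<in>I. cnj (v (f i)) * A (f i) (f j) * v (f j))"
      by (subst sum.reindex_bij_betw[OF assms, symmetric], rule sum.cong[OF refl])
         (rule sum.reindex_bij_betw[OF assms, symmetric])
    then show "0 \<le> Re (\<Sum>i\<in>J. \<Sum>j\<in>J. cnj (v i) * A i j * v j)"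
      using psd_on_quad[OF A, of "\<lambda>i. v (f i)"] by simp
  qed
qed

lemma psd_on_subset:
  assumes "psd_on I A" "J \<subseteq> I" "finite I"
  shows "psd_on J A"
proof (rule psd_onI)
  fix i j assume "i \<in> J" "j \<in> J"
  then show "A j i = cnj (A i j)" using assms(2) by (intro psd_on_herm[OF assms(1)]) auto
next
  fix v :: "'a \<Rightarrow> complex"
  let ?w = "\<lambda>i. if i \<in> J then v i else 0"
  have "(\<Sum>i\<in>J. \<Sum>j\<in>J. cnj (v i) * A i j * v j) = (\<Sum>i\<in>I. \<Sum>j\<in>I. cnj (?w i) * A i j * ?w j)"
    by (rule sum.mono_neutral_cong_left[OF assms(3,2)], simp, rule sum.mono_neutral_cong_left[OF assms(3,2)]) auto
  then show "0 \<le> Re (\<Sum>i\<in>J. \<Sum>j\<in>J. cnj (v i) * A i j * v j)"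
    using psd_on_quad[OF assms(1), of ?w] by simp
qed

lemma psd_on_add_scaled:
  assumes "psd_on I A" "psd_on I B" "0 \<le> s" "0 \<le> t"
  shows "psd_on I (\<lambda>i j. of_real s * A i j + of_real t * B i j)"
proof (rule psd_onI)
  fix i j assume "i \<in> I" "j \<in> I"
  then show "of_real s * A j i + of_real t * B j i = cnj (of_real s * A i j + of_real t * B i j)"
    by (simp add: psd_on_herm[OF assms(1), of i j] psd_on_herm[OF assms(2), of i j])
next
  fix v :: "'a \<Rightarrow> complex"
  have "(\<Sum>i\<in>I. \<Sum>j\<in>I. cnj (v i) * (of_real s * A i j + of_real t * B i j) * v j)
    = of_real s * (\<Sum>i\<in>I. \<Sum>j\<in>I. cnj (v i) * A i j * v j)
      + of_real t * (\<Sum>i\<in>I. \<Sum>j\<in>I. cnj (v i) * B i j * v j)"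
    by (simp add: sum_distrib_left sum.distrib distrib_left distrib_right mult_ac)
  then show "0 \<le> Re (\<Sum>i\<in>I. \<Sum>j\<in>I. cnj (v i) * (of_real s * A i j + of_real t * B i j) * v j)"
    using psd_on_quad[OF assms(1), of v] psd_on_quad[OF assms(2), of v] assms(3,4) by simp
qed

lemma psd_on_add: "psd_on I A \<Longrightarrow> psd_on I B \<Longrightarrow> psd_on I (\<lambda>i j. A i j + B i j)"
  using psd_on_add_scaled[of I A B 1 1] by simp

lemma quad_single:
  assumes "finite I" "i \<in> I"
  shows "(\<Sum>p\<in>I. \<Sum>q\<in>I. cnj (if p = i then x else 0) * A p q * (if q = i then y else 0)) = cnj x * A i i * y"
proof -
  have "(\<Sum>p\<in>I. \<Sum>q\<in>I. cnj (if p = i then x else 0) * A p q * (if q = i then y else 0))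
    = (\<Sum>p\<in>I. if p = i then cnj x * A p i * y else 0)"
  proof (rule sum.cong[OF refl])
    fix p
    have "(\<Sum>q\<in>I. cnj (if p = i then x else 0) * A p q * (if q = i then y else 0))
      = (\<Sum>q\<in>I. if q = i then cnj (if p = i then x else 0) * A p q * y else 0)"
      by (rule sum.cong) auto
    then show "(\<Sum>q\<in>I. cnj (if p = i then x else 0) * A p q * (if q = i then y else 0))
      = (if p = i then cnj x * A p i * y else 0)" using assms by (simp add: sum.delta')
  qed
  then show ?thesis using assms by (simp add: sum.delta')
qed

lemma psd_on_diag:
  assumes "psd_on I A" "finite I" "i \<in> I"
  shows "0 \<le> Re (A i i)" "A i i = of_real (Re (A i i))"
proof -
  show "0 \<le> Re (A i i)"
    using psd_on_quad[OF assms(1), of "\<lambda>p. if p = i then 1 else 0"] quad_single[OF assms(2,3), where x=1 and y=1 and A=A]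
    by simp
  show "A i i = of_real (Re (A i i))" using psd_on_herm[OF assms(1,3,3)]
    by (metis complex_cnj_cancel_iff Reals_cnj_iff of_real_Re)
qed

lemma psd_on_pair:
  assumes "psd_on I A" "finite I" "i \<in> I" "j \<in> I" "i \<noteq> j"
  shows "0 \<le> (cmod x)\<^sup>2 * Re (A i i) + (cmod y)\<^sup>2 * Re (A j j) + 2 * Re (cnj x * A i j * y)"
proof -
  let ?v = "\<lambda>p. if p = i then x else if p = j then y else 0"
  have psdij: "psd_on {i,j} A" using assms by (intro psd_on_subset[OF assms(1)]) auto
  have "(\<Sum>p\<in>{i,j}. \<Sum>q\<in>{i,j}. cnj (?v p) * A p q * ?v q)
     = cnj x * A i i * x + cnj x * A i j * y + cnj y * A j i * x + cnj y * A j j * y"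
    using assms(5) by simp
  then have "0 \<le> Re (cnj x * A i i * x + cnj x * A i j * y + cnj y * A j i * x + cnj y * A j j * y)"
    using psd_on_quad[OF psdij, of ?v] by simp
  moreover have "Re (cnj y * A j i * x) = Re (cnj x * A i j * y)"
    using psd_on_herm[OF assms(1,3,4)] by (simp add: algebra_simps)
  moreover have "Re (cnj x * A i i * x) = (cmod x)\<^sup>2 * Re (A i i)"
    by (subst psd_on_diag(2)[OF assms(1-3)]) (simp add: cmod_power2, simp add: algebra_simps power2_eq_square)
  moreover have "Re (cnj y * A j j * y) = (cmod y)\<^sup>2 * Re (A j j)"
    by (subst psd_on_diag(2)[OF assms(1,2,4)]) (simp add: cmod_power2, simp add: algebra_simps power2_eq_square)
  ultimately show ?thesis unfolding plus_complex.sel by linarith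
qed

text \<open>The form is tested on e_i + u e_j, with the phase u turning the entry into minus its
  modulus; this gives 2 |A i j| \<le> A i i + A j j. Thus the trace controls every entry, which
  later supplies both compactness for the least squares problem and a scalar dominating
  operator.\<close>

lemma psd_on_entry_bound:
  assumes "psd_on I A" "finite I" "i \<in> I" "j \<in> I"
  shows "cmod (A i j) \<le> (\<Sum>p\<in>I. Re (A p p))"
proof (cases "i = j")
  case True
  have "cmod (A i i) = Re (A i i)"
    using psd_on_diag[OF assms(1-3)] by (metis abs_of_nonneg norm_of_real)
  also have "\<dots> \<le> (\<Sum>p\<in>I. Re (A p p))"
    using psd_on_diag(1)[OF assms(1,2)] assms by (intro member_le_sum) auto
  finally show ?thesis using True by simp
next
  case False
  define a where "a = A i j"
  obtain u where u: "cmod u = 1" "Re (a * u) = - cmod a"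
  proof (cases "a = 0")
    case True then show ?thesis using that[of 1] by simp
  next
    case nz: False
    have "a * (- cnj a / of_real (cmod a)) = - (a * cnj a) / of_real (cmod a)" by simp
    also have "a * cnj a = of_real (cmod a) * of_real (cmod a)"
      by (metis complex_norm_square power2_eq_square of_real_mult)
    finally have "a * (- cnj a / of_real (cmod a)) = - of_real (cmod a)" using nz by simp
    then show ?thesis using that[of "- cnj a / of_real (cmod a)"] nz by (simp add: norm_divide)
  qed
  have "2 * cmod a \<le> Re (A i i) + Re (A j j)"
    using psd_on_pair[OF assms False, of 1 u] u by (simp add: a_def)
  also have "\<dots> = (\<Sum>p\<in>{i,j}. Re (A p p))" using False by simp
  also have "\<dots> \<le> (\<Sum>p\<in>I. Re (A p p))"
    using psd_on_diag(1)[OF assms(1,2)] assms by (intro sum_mono2) auto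
  finally show ?thesis using norm_ge_zero[of a] unfolding a_def by linarith
qed

text \<open>By |v i| |v j| \<le> (|v i|^2 + |v j|^2) / 2. The factor \<open>card I\<close> is a
  generous price, but only the existence of some scalar bound matters below.\<close>

lemma quad_le_entry_bound:
  assumes "finite I" "\<And>i j. i \<in> I \<Longrightarrow> j \<in> I \<Longrightarrow> cmod (A i j) \<le> M"
  shows "Re (\<Sum>i\<in>I. \<Sum>j\<in>I. cnj (v i) * A i j * v j) \<le> M * real (card I) * (\<Sum>i\<in>I. (cmod (v i))\<^sup>2)"
proof -
  have "Re (\<Sum>i\<in>I. \<Sum>j\<in>I. cnj (v i) * A i j * v j) \<le> cmod (\<Sum>i\<in>I. \<Sum>j\<in>I. cnj (v i) * A i j * v j)"
    by (rule complex_Re_le_cmod)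
  also have "\<dots> \<le> (\<Sum>i\<in>I. \<Sum>j\<in>I. M * (((cmod (v i))\<^sup>2 + (cmod (v j))\<^sup>2) / 2))"
  proof (intro sum_norm_le)
    fix i j assume ij: "i \<in> I" "j \<in> I"
    have "cmod (v i) * cmod (v j) \<le> ((cmod (v i))\<^sup>2 + (cmod (v j))\<^sup>2) / 2"
      using sum_squares_bound[of "cmod (v i)" "cmod (v j)"] by simp
    moreover have "0 \<le> M" using assms(2)[OF ij] norm_ge_zero order_trans by blast
    ultimately have "cmod (A i j) * (cmod (v i) * cmod (v j)) \<le> M * (((cmod (v i))\<^sup>2 + (cmod (v j))\<^sup>2) / 2)"
      using assms(2)[OF ij] by (intro mult_mono) auto
    then show "cmod (cnj (v i) * A i j * v j) \<le> M * (((cmod (v i))\<^sup>2 + (cmod (v j))\<^sup>2) / 2)"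
      by (simp add: norm_mult algebra_simps)
  qed
  also have "\<dots> = M * real (card I) * (\<Sum>i\<in>I. (cmod (v i))\<^sup>2)"
    by (simp add: sum_distrib_left[symmetric] sum_divide_distrib[symmetric] sum.distrib add_divide_distrib algebra_simps)
  finally show ?thesis .
qed

text \<open>Cholesky: splitting off the rank-one part through a diagonal entry leaves a form that no longer
  involves that index.\<close>

lemma psd_on_gram:
  assumes "finite I" "psd_on I A"
  shows "\<exists>u. \<forall>i\<in>I. \<forall>j\<in>I. A i j = (\<Sum>k\<in>I. u k i * cnj (u k j))"
  using assms
proof (induction I arbitrary: A rule: finite_induct)
  case empty
  then show ?case by auto
next
  case (insert x I)
  note fin = insert.hyps(1) and P = insert.prems
  define a where "a = Re (A x x)"
  have a: "0 \<le> a" "A x x = of_real a"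
    using psd_on_diag[OF P, of x] fin by (auto simp: a_def)
  have herm: "A j i = cnj (A i j)" if "i \<in> insert x I" "j \<in> insert x I" for i j
    using psd_on_herm[OF P that] .
  show ?case
  proof (cases "a = 0")
    case True
    have z: "A x j = 0" if j: "j \<in> I" for j
    proof (rule ccontr)
      assume nz: "A x j \<noteq> 0"
      \<comment> \<open>With a vanishing diagonal entry at x, the form at the vector with entries -s
        A x j at x and 1 at j equals A j j - 2 s |A x j|^2. This s makes it -A j j - 2, which is
        negative.\<close>
      define s where "s = (Re (A j j) + 1) / (cmod (A x j))\<^sup>2"
      have "x \<noteq> j" using insert.hyps(2) j by auto
      then have "0 \<le> Re (A j j) + 2 * Re (cnj (- of_real s * A x j) * A x j * 1)"
        using psd_on_pair[OF P, of x j "- of_real s * A x j" 1] fin j a(2) True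
        by (simp add: norm_mult)
      also have "cnj (- of_real s * A x j) * A x j * 1 = - of_real (s * (cmod (A x j))\<^sup>2)"
        using complex_norm_square[of "A x j"] by (simp add: mult_ac)
      also have "s * (cmod (A x j))\<^sup>2 = Re (A j j) + 1" using nz by (simp add: s_def)
      finally have "0 \<le> Re (A j j) - 2 * (Re (A j j) + 1)" by simp
      then show False using psd_on_diag(1)[OF P, of j] fin j by simp
    qed
    have z': "A j x = 0" if j: "j \<in> I" for j
      using z[OF j] herm[of x j] j by simp
    have "psd_on I A" using P fin by (intro psd_on_subset[OF P]) auto
    from insert.IH[OF this] obtain u where
      u: "\<forall>i\<in>I. \<forall>j\<in>I. A i j = (\<Sum>k\<in>I. u k i * cnj (u k j))" by blast
    define u' where "u' = (\<lambda>k i. if i = x \<or> k = x then 0 else u k i)"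
    have "A i j = (\<Sum>k\<in>insert x I. u' k i * cnj (u' k j))"
      if ij: "i \<in> insert x I" "j \<in> insert x I" for i j
    proof (cases "i = x \<or> j = x")
      case True
      then have "A i j = 0" using z z' a(2) \<open>a = 0\<close> ij by auto
      then show ?thesis using True by (auto simp: u'_def)
    next
      case False
      then have "A i j = (\<Sum>k\<in>I. u k i * cnj (u k j))" using u ij by auto
      also have "\<dots> = (\<Sum>k\<in>I. u' k i * cnj (u' k j))"
        using False insert.hyps(2) by (intro sum.cong) (auto simp: u'_def)
      finally show ?thesis using fin insert.hyps(2) by (simp add: u'_def)
    qed
    then show ?thesis by blast
  next
    case False
    then have apos: "0 < a" using a by simp
    define c where "c = (\<lambda>i. A i x / of_real (sqrt a))"
    have cc: "c i * cnj (c j) = A i x * cnj (A j x) / of_real a" for i j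
      using apos by (simp add: c_def) (metis abs_of_pos of_real_mult real_sqrt_mult_self)
    define B where "B = (\<lambda>i j. A i j - c i * cnj (c j))"
    have "psd_on I B"
    proof (rule psd_onI)
      fix i j assume "i \<in> I" "j \<in> I"
      then show "B j i = cnj (B i j)" using herm[of i j] by (simp add: B_def mult.commute)
    next
      fix v
      define S where "S = (\<Sum>j\<in>I. A x j * v j)"
      \<comment> \<open>t minimises the form over the coordinate at x while v stays fixed on I. The
        minimum is the form of the Schur complement \<open>B\<close>, so positivity passes from
        \<open>A\<close> to \<open>B\<close>.\<close>
      define t where "t = - S / of_real a"
      define w where "w = (\<lambda>i. if i = x then t else v i)"
      have wI: "w i = v i" if "i \<in> I" for i using that insert.hyps(2) by (auto simp: w_def)
      have wx: "w x = t" by (simp add: w_def)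
      have S': "(\<Sum>i\<in>I. cnj (v i) * A i x) = cnj S"
        unfolding S_def cnj_sum by (rule sum.cong[OF refl]) (simp add: herm[of x])
      have "(\<Sum>i\<in>insert x I. \<Sum>j\<in>insert x I. cnj (w i) * A i j * w j)
        = cnj t * A x x * t + cnj t * S + cnj S * t + (\<Sum>i\<in>I. \<Sum>j\<in>I. cnj (v i) * A i j * v j)"
      proof -
        have "(\<Sum>i\<in>insert x I. \<Sum>j\<in>insert x I. cnj (w i) * A i j * w j)
          = cnj t * A x x * t + (\<Sum>j\<in>I. cnj t * A x j * w j)
            + ((\<Sum>i\<in>I. cnj (w i) * A i x * t) + (\<Sum>i\<in>I. \<Sum>j\<in>I. cnj (w i) * A i j * w j))"
          using fin insert.hyps(2) by (simp add: wx sum.distrib)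
        also have "(\<Sum>j\<in>I. cnj t * A x j * w j) = cnj t * S"
          unfolding S_def sum_distrib_left by (rule sum.cong[OF refl]) (simp add: wI)
        also have "(\<Sum>i\<in>I. cnj (w i) * A i x * t) = cnj S * t"
          unfolding S'[symmetric] sum_distrib_right by (rule sum.cong[OF refl]) (simp add: wI)
        also have "(\<Sum>i\<in>I. \<Sum>j\<in>I. cnj (w i) * A i j * w j) = (\<Sum>i\<in>I. \<Sum>j\<in>I. cnj (v i) * A i j * v j)"
          by (intro sum.cong refl) (simp add: wI)
        finally show ?thesis by (simp add: algebra_simps)
      qed
      also have "cnj t * A x x * t + cnj t * S + cnj S * t = - (S * cnj S / of_real a)"
        using apos by (simp add: t_def a(2) field_simps)
      also have "- (S * cnj S / of_real a) + (\<Sum>i\<in>I. \<Sum>j\<in>I. cnj (v i) * A i j * v j)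
        = (\<Sum>i\<in>I. \<Sum>j\<in>I. cnj (v i) * B i j * v j)"
      proof -
        have "S * cnj S = (\<Sum>i\<in>I. \<Sum>j\<in>I. cnj (v i) * A i x * (A x j * v j))"
          by (subst mult.commute, subst S'[symmetric]) (simp only: S_def sum_product)
        then have "S * cnj S / of_real a = (\<Sum>i\<in>I. \<Sum>j\<in>I. cnj (v i) * (c i * cnj (c j)) * v j)"
          by (simp add: sum_divide_distrib cc) (intro sum.cong refl, simp add: herm[of _ x])
        then show ?thesis by (simp add: B_def sum_subtractf algebra_simps)
      qed
      finally show "0 \<le> Re (\<Sum>i\<in>I. \<Sum>j\<in>I. cnj (v i) * B i j * v j)"
        using psd_on_quad[OF P, of w] by simp
    qed
    from insert.IH[OF this] obtain u where
      u: "\<forall>i\<in>I. \<forall>j\<in>I. B i j = (\<Sum>k\<in>I. u k i * cnj (u k j))" by blast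
    define u' where "u' = (\<lambda>k i. if k = x then c i else if i = x then 0 else u k i)"
    have B0: "B i j = 0" if "i \<in> insert x I" "j \<in> insert x I" "i = x \<or> j = x" for i j
    proof -
      have "B i x = 0" "B x j = 0"
        using apos herm[of j x] that by (auto simp: B_def cc a(2))
      then show ?thesis using that(3) by blast
    qed
    have "A i j = (\<Sum>k\<in>insert x I. u' k i * cnj (u' k j))"
      if ij: "i \<in> insert x I" "j \<in> insert x I" for i j
    proof -
      have "B i j = (\<Sum>k\<in>I. u' k i * cnj (u' k j))"
      proof (cases "i = x \<or> j = x")
        case True
        have "(\<Sum>k\<in>I. u' k i * cnj (u' k j)) = 0"
          using True insert.hyps(2) by (intro sum.neutral) (auto simp: u'_def)
        then show ?thesis using B0[OF ij True] by simp
      next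
        case False
        then have "B i j = (\<Sum>k\<in>I. u k i * cnj (u k j))" using u ij by auto
        also have "\<dots> = (\<Sum>k\<in>I. u' k i * cnj (u' k j))"
          using False insert.hyps(2) by (intro sum.cong) (auto simp: u'_def)
        finally show ?thesis .
      qed
      moreover have "u' x = c" by (simp add: u'_def fun_eq_iff)
      ultimately show ?thesis using fin insert.hyps(2) by (simp add: B_def algebra_simps)
    qed
    then show ?thesis by blast
  qed
qed

section \<open>Least squares over a closed convex cone\<close>

text \<open>Kernels are total functions and carry the product topology, so the coordinates outside I
  \<times> I must be pinned to a point before Tychonoff's theorem gives compactness.\<close>

lemma compact_truncated_functions:
  fixes I :: "'i set" and B :: real
  shows "compact {z :: 'i \<Rightarrow> 'i \<Rightarrow> complex. \<forall>p q. z p q \<in> (if p \<in> I \<and> q \<in> I then cball 0 B else {0})}"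
proof -
  have tych: "compact (PiE UNIV S)" if "\<And>i. compact (S i)" for S :: "'i \<Rightarrow> ('c::topological_space) set"
  proof -
    have "compactin (product_topology (\<lambda>_. euclidean) UNIV) (PiE UNIV S)"
      using that by (simp add: compactin_PiE)
    then show ?thesis by (simp add: euclidean_product_topology)
  qed
  let ?S = "\<lambda>p q. if p \<in> I \<and> q \<in> I then cball (0::complex) B else {0}"
  have "compact (PiE UNIV (\<lambda>p. PiE UNIV (?S p)))"
    by (intro tych) auto
  also have "PiE UNIV (\<lambda>p. PiE UNIV (?S p)) = {z. \<forall>p q. z p q \<in> ?S p q}"
    by (simp add: PiE_UNIV_domain Pi_def)
  finally show ?thesis .
qed

lemma continuous_on_entry [continuous_intros]:
  "continuous_on S (\<lambda>z::'i \<Rightarrow> 'j \<Rightarrow> complex. z p q)"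
  by (rule continuous_on_product_then_coordinatewise[where f="\<lambda>z. z p"],
      rule continuous_on_product_then_coordinatewise[where f="\<lambda>z. z"], rule continuous_on_id)

lemma closed_psd_on: "closed {z. psd_on I z}"
proof -
  have "{z. psd_on I z} = (\<Inter>i\<in>I. \<Inter>j\<in>I. {z. z j i = cnj (z i j)}) \<inter>
     (\<Inter>v. {z. 0 \<le> Re (\<Sum>i\<in>I. \<Sum>j\<in>I. cnj (v i) * z i j * v j)})"
    unfolding psd_on_def by blast
  also have "closed \<dots>"
    by (intro closed_Int closed_INT ballI closed_Collect_eq closed_Collect_le continuous_intros)
  finally show ?thesis .
qed

text \<open>First-order conditions at a minimiser m over a convex cone. Moving from m to m + s z
  gives nonnegativity on z. The ray through m can be followed in both directions, so the pairing of
  w with L m vanishes, and b = L m - w yields the second claim. When w does not vanish on K, the two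
  claims separate b strictly from the image of the cone.\<close>

lemma least_squares_residual:
  fixes C :: "('i \<Rightarrow> 'i \<Rightarrow> complex) set" and L :: "'k \<Rightarrow> ('i \<Rightarrow> 'i \<Rightarrow> complex) \<Rightarrow> complex"
  assumes fin: "finite K"
    and lin: "\<And>k z w s t. k \<in> K \<Longrightarrow>
        L k (\<lambda>p q. of_real s * z p q + of_real t * w p q) = of_real s * L k z + of_real t * L k w"
    and cone: "\<And>z w s t. z \<in> C \<Longrightarrow> w \<in> C \<Longrightarrow> 0 \<le> s \<Longrightarrow> 0 \<le> t \<Longrightarrow>
        (\<lambda>p q. of_real s * z p q + of_real t * w p q) \<in> C"
    and m: "m \<in> C"
    and min: "\<And>z. z \<in> C \<Longrightarrow> (\<Sum>k\<in>K. (cmod (L k m - b k))\<^sup>2) \<le> (\<Sum>k\<in>K. (cmod (L k z - b k))\<^sup>2)"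
  defines "w \<equiv> \<lambda>k. L k m - b k"
  shows "z \<in> C \<Longrightarrow> 0 \<le> Re (\<Sum>k\<in>K. cnj (w k) * L k z)"
    and "Re (\<Sum>k\<in>K. cnj (w k) * b k) = - (\<Sum>k\<in>K. (cmod (w k))\<^sup>2)"
proof -
  have expand: "(\<Sum>k\<in>K. (cmod (w k + of_real s * L k z))\<^sup>2)
    = (\<Sum>k\<in>K. (cmod (w k))\<^sup>2) + 2 * s * Re (\<Sum>k\<in>K. cnj (w k) * L k z) + s\<^sup>2 * (\<Sum>k\<in>K. (cmod (L k z))\<^sup>2)"
    for s z
  proof -
    have "(cmod (w k + of_real s * L k z))\<^sup>2 = (cmod (w k))\<^sup>2 + 2 * s * Re (cnj (w k) * L k z) + s\<^sup>2 * (cmod (L k z))\<^sup>2" for k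
      by (simp add: cmod_power2) (simp add: power2_eq_square algebra_simps)
    then show ?thesis by (simp only: sum.distrib sum_distrib_left Re_sum)
  qed
  have var: "0 \<le> 2 * s * Re (\<Sum>k\<in>K. cnj (w k) * L k z) + s\<^sup>2 * (\<Sum>k\<in>K. (cmod (L k z))\<^sup>2)"
    if "(\<lambda>p q. of_real 1 * m p q + of_real s * z p q) \<in> C" for s z
  proof -
    have "L k (\<lambda>p q. of_real 1 * m p q + of_real s * z p q) - b k = w k + of_real s * L k z" if "k \<in> K" for k
      by (subst lin[OF that]) (simp add: w_def)
    then have "(\<Sum>k\<in>K. (cmod (L k (\<lambda>p q. of_real 1 * m p q + of_real s * z p q) - b k))\<^sup>2)
      = (\<Sum>k\<in>K. (cmod (w k + of_real s * L k z))\<^sup>2)" by (intro sum.cong) auto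
    with min[OF that] have "(\<Sum>k\<in>K. (cmod (w k))\<^sup>2) \<le> (\<Sum>k\<in>K. (cmod (w k + of_real s * L k z))\<^sup>2)"
      unfolding w_def by linarith
    with expand[of s z] show ?thesis by linarith
  qed
  have small: "0 \<le> x" if h: "\<And>s::real. 0 < s \<Longrightarrow> s < 1 \<Longrightarrow> 0 \<le> 2 * s * x + s\<^sup>2 * y" and y: "0 \<le> y" for x y :: real
  proof (rule ccontr)
    assume "\<not> 0 \<le> x"
    \<comment> \<open>The second bound gives s (y + 1) \<le> -x, hence 2 x + s y < x < 0. The first
      keeps s below 1, where 1 - s is still an admissible coefficient in the cone.\<close>
    define s where "s = min (1/2) (- x / (y + 1))"
    have s: "0 < s" "s < 1" using \<open>\<not> 0 \<le> x\<close> y by (auto simp: s_def divide_neg_pos)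
    have "s \<le> - x / (y + 1)" by (simp add: s_def)
    then have s3: "s * (y + 1) \<le> - x" using pos_le_divide_eq[of "y + 1" s "- x"] y by linarith
    have "0 \<le> s * (2 * x + s * y)" using h[OF s(1,2)] by (simp add: power2_eq_square algebra_simps)
    then have "0 \<le> 2 * x + s * y" using s(1) by (simp add: zero_le_mult_iff)
    then show False using s3 s(1) \<open>\<not> 0 \<le> x\<close> by (simp add: algebra_simps)
  qed
  have ge: "0 \<le> Re (\<Sum>k\<in>K. cnj (w k) * L k z)" if "z \<in> C" for z
    by (rule small[OF var]) (use cone[OF m that, of 1] in \<open>auto intro: sum_nonneg\<close>)
  then show "z \<in> C \<Longrightarrow> 0 \<le> Re (\<Sum>k\<in>K. cnj (w k) * L k z)" .
  have "0 \<le> - Re (\<Sum>k\<in>K. cnj (w k) * L k m)"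
  proof (rule small)
    fix s :: real assume s: "0 < s" "s < 1"
    have "(\<lambda>p q. of_real 1 * m p q + of_real (-s) * m p q) = (\<lambda>p q. of_real (1 - s) * m p q + of_real 0 * m p q)"
      by (simp add: fun_eq_iff algebra_simps)
    then have "(\<lambda>p q. of_real 1 * m p q + of_real (-s) * m p q) \<in> C"
      using cone[OF m m, of "1 - s" 0] s by simp
    from var[OF this] show "0 \<le> 2 * s * - Re (\<Sum>k\<in>K. cnj (w k) * L k m) + s\<^sup>2 * (\<Sum>k\<in>K. (cmod (L k m))\<^sup>2)"
      by simp
  qed (auto intro: sum_nonneg)
  with ge[OF m] have zero: "Re (\<Sum>k\<in>K. cnj (w k) * L k m) = 0" by linarith
  have "(\<Sum>k\<in>K. cnj (w k) * b k) = (\<Sum>k\<in>K. cnj (w k) * L k m) - (\<Sum>k\<in>K. of_real ((cmod (w k))\<^sup>2))"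
    unfolding sum_subtractf[symmetric]
  proof (rule sum.cong[OF refl])
    fix k
    have "of_real ((cmod (w k))\<^sup>2) = cnj (w k) * w k" by (simp add: complex_norm_square mult.commute del: of_real_power)
    then show "cnj (w k) * b k = cnj (w k) * L k m - of_real ((cmod (w k))\<^sup>2)"
      by (simp add: w_def algebra_simps)
  qed
  then show "Re (\<Sum>k\<in>K. cnj (w k) * b k) = - (\<Sum>k\<in>K. (cmod (w k))\<^sup>2)"
    using zero by (simp del: of_real_power)
qed

text \<open>The sublevel set of \<open>f\<close> at a point of \<open>C\<close>, truncated outside \<open>I \<times> I\<close>, is compact.\<close>

lemma coercive_minimum:
  fixes C :: "('i \<Rightarrow> 'i \<Rightarrow> complex) set" and f :: "('i \<Rightarrow> 'i \<Rightarrow> complex) \<Rightarrow> real"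
  assumes cl: "closed C" and cont: "continuous_on UNIV f"
    and locC: "\<And>z w. z \<in> C \<Longrightarrow> (\<And>p q. p \<in> I \<Longrightarrow> q \<in> I \<Longrightarrow> w p q = z p q) \<Longrightarrow> w \<in> C"
    and locf: "\<And>z w. (\<And>p q. p \<in> I \<Longrightarrow> q \<in> I \<Longrightarrow> w p q = z p q) \<Longrightarrow> f w = f z"
    and z0: "z0 \<in> C"
    and bound: "\<And>z p q. z \<in> C \<Longrightarrow> f z \<le> f z0 \<Longrightarrow> p \<in> I \<Longrightarrow> q \<in> I \<Longrightarrow> cmod (z p q) \<le> B"
  obtains m where "m \<in> C" "\<And>z. z \<in> C \<Longrightarrow> f m \<le> f z"
proof -
  let ?T = "\<lambda>z p q. if p \<in> I \<and> q \<in> I then z p q else (0::complex)"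
  let ?Q = "{z. \<forall>p q. z p q \<in> (if p \<in> I \<and> q \<in> I then cball 0 B else {0})} \<inter> C"
  have T: "?T z \<in> C" "f (?T z) = f z" if "z \<in> C" for z
    using locC[OF that, of "?T z"] locf[of "?T z" z] by auto
  have TQ: "?T z \<in> ?Q" if z: "z \<in> C" "f z \<le> f z0" for z
    using T(1)[OF z(1)] bound[OF z] by (auto simp: mem_cball_0)
  have c: "compact ?Q" by (intro compact_Int_closed compact_truncated_functions cl)
  have ne: "?Q \<noteq> {}" using TQ[OF z0 order_refl] by (intro notI) (simp only: empty_iff)
  have co: "continuous_on ?Q f" using cont continuous_on_subset by blast
  obtain m where m: "m \<in> ?Q" "\<forall>z\<in>?Q. f m \<le> f z"
    using continuous_attains_inf[OF c ne co] by (elim bexE)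
  have "f m \<le> f z" if z: "z \<in> C" for z
  proof (cases "f z \<le> f z0")
    case True
    then show ?thesis using bspec[OF m(2) TQ[OF z True]] T(2)[OF z] by simp
  next
    case False
    then show ?thesis using bspec[OF m(2) TQ[OF z0 order_refl]] T(2)[OF z0] by simp
  qed
  then show ?thesis using that m(1) by blast
qed

section \<open>Averages over a unitary action\<close>

text \<open>Boundedness travels with measurability because the integrands are polynomials in matrix
  entries and their conjugates, and integrability alone is not stable under products.\<close>

definition bdd_meas :: "'g measure \<Rightarrow> ('g \<Rightarrow> complex) \<Rightarrow> bool" where
  "bdd_meas M f \<longleftrightarrow> f \<in> borel_measurable M \<and> (\<exists>B. \<forall>x\<in>space M. norm (f x) \<le> B)"

named_theorems bdd_meas_intros

lemma bdd_meas_const [bdd_meas_intros]: "bdd_meas M (\<lambda>_. c)"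
  unfolding bdd_meas_def by auto

lemma bdd_meas_cnj [bdd_meas_intros]: "bdd_meas M f \<Longrightarrow> bdd_meas M (\<lambda>x. cnj (f x))"
  unfolding bdd_meas_def by (auto simp: complex_eq_iff intro: borel_measurable_continuous_on[of cnj] continuous_intros)

lemma bdd_meas_mult [bdd_meas_intros]:
  assumes "bdd_meas M f" "bdd_meas M g"
  shows "bdd_meas M (\<lambda>x. f x * g x)"
proof -
  obtain A B where AB: "\<forall>x\<in>space M. norm (f x) \<le> A" "\<forall>x\<in>space M. norm (g x) \<le> B"
    using assms unfolding bdd_meas_def by blast
  have "\<forall>x\<in>space M. norm (f x * g x) \<le> A * B"
  proof
    fix x assume "x \<in> space M"
    then show "norm (f x * g x) \<le> A * B"
      unfolding norm_mult using AB by (intro mult_mono) (auto intro: order_trans[OF norm_ge_zero])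
  qed
  then show ?thesis using assms unfolding bdd_meas_def by auto
qed

lemma bdd_meas_add [bdd_meas_intros]:
  assumes "bdd_meas M f" "bdd_meas M g"
  shows "bdd_meas M (\<lambda>x. f x + g x)"
proof -
  obtain A B where AB: "\<forall>x\<in>space M. norm (f x) \<le> A" "\<forall>x\<in>space M. norm (g x) \<le> B"
    using assms unfolding bdd_meas_def by blast
  then have "\<forall>x\<in>space M. norm (f x + g x) \<le> A + B"
    by (meson add_mono norm_triangle_le)
  then show ?thesis using assms unfolding bdd_meas_def by auto
qed

lemma bdd_meas_sum [bdd_meas_intros]:
  "(\<And>i. i \<in> I \<Longrightarrow> bdd_meas M (f i)) \<Longrightarrow> bdd_meas M (\<lambda>x. \<Sum>i\<in>I. f i x)"
  by (induction I rule: infinite_finite_induct) (auto intro: bdd_meas_intros)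

lemma (in prob_space) integrable_bdd_meas: "bdd_meas M f \<Longrightarrow> integrable M f"
  unfolding bdd_meas_def by (auto intro: integrable_const_bound)

section \<open>Haar measure: measurability of continuous functions and translation invariance of
  integrals\<close>

lemma haar_continuous_measurable:
  fixes f :: "'g \<Rightarrow> 'c::topological_space"
  assumes "haar_prob G T \<mu>" "compact_group G T" "continuous_map T euclidean f"
  shows "f \<in> borel_measurable \<mu>"
proof (rule borel_measurableI)
  fix S :: "'c set" assume "open S"
  moreover have sp: "space \<mu> = topspace T" and st: "sets \<mu> = borel_sets_of T"
    using assms unfolding haar_prob_def compact_group_def by auto
  ultimately have "openin T {x \<in> topspace T. f x \<in> S}"
    using assms(3) by (auto simp: continuous_map_def)
  moreover have "f -` S \<inter> space \<mu> = {x \<in> topspace T. f x \<in> S}" using sp by auto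
  ultimately show "f -` S \<inter> space \<mu> \<in> sets \<mu>"
    unfolding st borel_sets_of_def by auto
qed

text \<open>\<open>haar_prob\<close> states invariance for images of measurable sets. The preimage
  of a set under right translation by h is its image under right translation by the inverse of h, so
  \<mu> equals its own pushforward. Measurability of the translation is checked on open sets, where
  it is continuity.\<close>

lemma haar_right_translation_integral:
  fixes f :: "'g \<Rightarrow> complex"
  assumes H: "haar_prob G T \<mu>" and C: "compact_group G T"
    and h: "h \<in> carrier G" and f: "f \<in> borel_measurable \<mu>"
  shows "(LINT g|\<mu>. f (g \<otimes>\<^bsub>G\<^esub> h)) = (LINT g|\<mu>. f g)"
proof -
  interpret G: group G using C unfolding compact_group_def by auto
  interpret prob_space \<mu> using H unfolding haar_prob_def by auto
  have sp: "space \<mu> = carrier G" and tp: "topspace T = carrier G" and st: "sets \<mu> = borel_sets_of T"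
    using H C unfolding haar_prob_def compact_group_def by auto
  have cont: "continuous_map T T (\<lambda>x. x \<otimes>\<^bsub>G\<^esub> h)"
  proof -
    have "continuous_map T (prod_topology T T) (\<lambda>x. (x, h))"
      using h tp by (intro continuous_map_pairedI) auto
    moreover have "continuous_map (prod_topology T T) T (\<lambda>(x,y). x \<otimes>\<^bsub>G\<^esub> y)"
      using C unfolding compact_group_def by auto
    ultimately have "continuous_map T T ((\<lambda>(x,y). x \<otimes>\<^bsub>G\<^esub> y) \<circ> (\<lambda>x. (x, h)))"
      by (rule continuous_map_compose)
    then show ?thesis by (simp add: o_def)
  qed
  have meas: "(\<lambda>x. x \<otimes>\<^bsub>G\<^esub> h) \<in> measurable \<mu> \<mu>"
  proof (rule measurable_sigma_sets[where A="{S. openin T S}" and \<Omega>="topspace T"])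
    show "sets \<mu> = sigma_sets (topspace T) {S. openin T S}" using st by (simp add: borel_sets_of_def)
    show "{S. openin T S} \<subseteq> Pow (topspace T)" using openin_subset by auto
    show "(\<lambda>x. x \<otimes>\<^bsub>G\<^esub> h) \<in> space \<mu> \<rightarrow> topspace T" using h sp tp by auto
    fix S assume "S \<in> {S. openin T S}"
    then have "openin T {x \<in> topspace T. x \<otimes>\<^bsub>G\<^esub> h \<in> S}" using cont by (auto simp: continuous_map_def)
    moreover have "(\<lambda>x. x \<otimes>\<^bsub>G\<^esub> h) -` S \<inter> space \<mu> = {x \<in> topspace T. x \<otimes>\<^bsub>G\<^esub> h \<in> S}" using sp tp by auto
    ultimately show "(\<lambda>x. x \<otimes>\<^bsub>G\<^esub> h) -` S \<inter> space \<mu> \<in> sets \<mu>"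
      unfolding st borel_sets_of_def by auto
  qed
  have "distr \<mu> \<mu> (\<lambda>x. x \<otimes>\<^bsub>G\<^esub> h) = \<mu>"
  proof (rule measure_eqI)
    fix A assume "A \<in> sets (distr \<mu> \<mu> (\<lambda>x. x \<otimes>\<^bsub>G\<^esub> h))"
    then have A: "A \<in> sets \<mu>" by simp
    then have AG: "A \<subseteq> carrier G" using sets.sets_into_space sp by metis
    have "(\<lambda>x. x \<otimes>\<^bsub>G\<^esub> h) -` A \<inter> space \<mu> = (\<lambda>x. x \<otimes>\<^bsub>G\<^esub> inv\<^bsub>G\<^esub> h) ` A"
    proof (intro equalityI subsetI)
      fix x assume x: "x \<in> (\<lambda>x. x \<otimes>\<^bsub>G\<^esub> h) -` A \<inter> space \<mu>"
      then have "x = (x \<otimes>\<^bsub>G\<^esub> h) \<otimes>\<^bsub>G\<^esub> inv\<^bsub>G\<^esub> h" using h sp by (simp add: G.m_assoc)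
      then show "x \<in> (\<lambda>x. x \<otimes>\<^bsub>G\<^esub> inv\<^bsub>G\<^esub> h) ` A" using x by blast
    next
      fix x assume "x \<in> (\<lambda>x. x \<otimes>\<^bsub>G\<^esub> inv\<^bsub>G\<^esub> h) ` A"
      then show "x \<in> (\<lambda>x. x \<otimes>\<^bsub>G\<^esub> h) -` A \<inter> space \<mu>" using AG h sp by (auto simp: G.m_assoc subset_iff)
    qed
    moreover have "measure \<mu> ((\<lambda>x. x \<otimes>\<^bsub>G\<^esub> inv\<^bsub>G\<^esub> h) ` A) = measure \<mu> A"
      using H h A unfolding haar_prob_def by auto
    ultimately show "emeasure (distr \<mu> \<mu> (\<lambda>x. x \<otimes>\<^bsub>G\<^esub> h)) A = emeasure \<mu> A"
      by (simp add: emeasure_distr[OF meas A] emeasure_eq_measure)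
  qed simp
  then show ?thesis using integral_distr[OF meas f] by simp
qed

text \<open>Collects what averaging needs without seeing the tensor structure, so that it serves
  both R \<otimes> A and R \<otimes> B.\<close>

locale unitary_action = prob_space \<mu> for \<mu> :: "'g measure" +
  fixes G :: "('g, 'b) monoid_scheme" and I :: "'i set" and V :: "'g \<Rightarrow> 'i \<Rightarrow> 'i \<Rightarrow> complex"
  assumes group: "group G" and space_eq: "space \<mu> = carrier G" and fin: "finite I"
    and right_inv: "\<And>h f. h \<in> carrier G \<Longrightarrow> bdd_meas \<mu> f \<Longrightarrow>
        (LINT g|\<mu>. f (g \<otimes>\<^bsub>G\<^esub> h)) = (LINT g|\<mu>. f g :: complex)"
    and V_bdd_meas: "\<And>p q. p \<in> I \<Longrightarrow> q \<in> I \<Longrightarrow> bdd_meas \<mu> (\<lambda>g. V g p q)"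
    and V_rows: "\<And>g p q. g \<in> carrier G \<Longrightarrow> p \<in> I \<Longrightarrow> q \<in> I \<Longrightarrow>
        (\<Sum>k\<in>I. V g p k * cnj (V g q k)) = (if p = q then 1 else 0)"
    and V_cols: "\<And>g p q. g \<in> carrier G \<Longrightarrow> p \<in> I \<Longrightarrow> q \<in> I \<Longrightarrow>
        (\<Sum>k\<in>I. V g k p * cnj (V g k q)) = (if p = q then 1 else 0)"
    and V_mult: "\<And>g h p q. g \<in> carrier G \<Longrightarrow> h \<in> carrier G \<Longrightarrow> p \<in> I \<Longrightarrow> q \<in> I \<Longrightarrow>
        V (g \<otimes>\<^bsub>G\<^esub> h) p q = (\<Sum>k\<in>I. V g p k * V h k q)"
begin

definition rot :: "'g \<Rightarrow> ('i \<Rightarrow> 'i \<Rightarrow> complex) \<Rightarrow> 'i \<Rightarrow> 'i \<Rightarrow> complex" where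
  "rot g M p q = (\<Sum>k\<in>I. \<Sum>l\<in>I. V g p k * M k l * cnj (V g q l))"

definition tw :: "('i \<Rightarrow> 'i \<Rightarrow> complex) \<Rightarrow> 'i \<Rightarrow> 'i \<Rightarrow> complex" where
  "tw M p q = (LINT g|\<mu>. rot g M p q)"

text \<open>This is the adjoint of \<open>V g\<close> applied to v. The adjoint is what turns the
  form of the rotated kernel at v into the form of the original kernel at
  \<open>orb v g\<close>.\<close>

definition orb :: "('i \<Rightarrow> complex) \<Rightarrow> 'g \<Rightarrow> 'i \<Rightarrow> complex" where
  "orb v g k = (\<Sum>p\<in>I. cnj (V g p k) * v p)"

text \<open>The average of the rank one kernels along the orbit. As the orbit runs through adjoints,
  its invariance calls for right translations of the group.\<close>

definition orb_avg :: "('i \<Rightarrow> complex) \<Rightarrow> 'i \<Rightarrow> 'i \<Rightarrow> complex" where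
  "orb_avg v k l = (LINT g|\<mu>. orb v g k * cnj (orb v g l))"

lemma rot_bdd_meas [bdd_meas_intros]: "p \<in> I \<Longrightarrow> q \<in> I \<Longrightarrow> bdd_meas \<mu> (\<lambda>g. rot g M p q)"
  unfolding rot_def by (intro bdd_meas_intros V_bdd_meas)

lemma orb_bdd_meas [bdd_meas_intros]: "k \<in> I \<Longrightarrow> bdd_meas \<mu> (\<lambda>g. orb v g k)"
  unfolding orb_def by (intro bdd_meas_intros V_bdd_meas)

lemma rot_quad:
  "(\<Sum>p\<in>I. \<Sum>q\<in>I. cnj (v p) * rot g M p q * v q) = (\<Sum>k\<in>I. \<Sum>l\<in>I. cnj (orb v g k) * M k l * orb v g l)"
proof -
  have "(\<Sum>p\<in>I. \<Sum>q\<in>I. cnj (v p) * rot g M p q * v q)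
    = (\<Sum>p\<in>I. \<Sum>q\<in>I. \<Sum>k\<in>I. \<Sum>l\<in>I. (V g p k * cnj (v p)) * M k l * (cnj (V g q l) * v q))"
    unfolding rot_def sum_distrib_left sum_distrib_right by (intro sum.cong refl) (simp add: mult_ac)
  also have "\<dots> = (\<Sum>p\<in>I. \<Sum>k\<in>I. \<Sum>q\<in>I. \<Sum>l\<in>I. (V g p k * cnj (v p)) * M k l * (cnj (V g q l) * v q))"
    by (intro sum.cong refl sum.swap)
  also have "\<dots> = (\<Sum>k\<in>I. \<Sum>p\<in>I. \<Sum>l\<in>I. \<Sum>q\<in>I. (V g p k * cnj (v p)) * M k l * (cnj (V g q l) * v q))"
    by (subst sum.swap) (intro sum.cong refl sum.swap)
  also have "\<dots> = (\<Sum>k\<in>I. \<Sum>l\<in>I. \<Sum>p\<in>I. \<Sum>q\<in>I. (V g p k * cnj (v p)) * M k l * (cnj (V g q l) * v q))"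
    by (intro sum.cong refl sum.swap)
  also have "\<dots> = (\<Sum>k\<in>I. \<Sum>l\<in>I. cnj (orb v g k) * M k l * orb v g l)"
    unfolding orb_def cnj_sum complex_cnj_mult complex_cnj_cnj
    by (simp only: sum_distrib_left[symmetric] sum_distrib_right[symmetric])
  finally show ?thesis .
qed

lemma tw_quad:
  "(\<Sum>p\<in>I. \<Sum>q\<in>I. cnj (v p) * tw M p q * v q) = (LINT g|\<mu>. (\<Sum>k\<in>I. \<Sum>l\<in>I. cnj (orb v g k) * M k l * orb v g l))"
proof -
  have int: "integrable \<mu> (\<lambda>g. rot g M p q)" if "p \<in> I" "q \<in> I" for p q
    using that by (intro integrable_bdd_meas bdd_meas_intros)
  have "(\<Sum>p\<in>I. \<Sum>q\<in>I. cnj (v p) * tw M p q * v q) = (LINT g|\<mu>. (\<Sum>p\<in>I. \<Sum>q\<in>I. cnj (v p) * rot g M p q * v q))"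
    by (simp add: tw_def int)
  then show ?thesis by (simp only: rot_quad)
qed

text \<open>Averaging is moved from the kernel to the vector: the form of \<open>tw M\<close> at v
  is the trace of M against \<open>orb_avg v\<close>. A functional that is nonnegative on all orbit
  averages therefore has a twirl with nonnegative form.\<close>

lemma tw_pairing:
  "(\<Sum>p\<in>I. \<Sum>q\<in>I. cnj (v p) * tw M p q * v q) = (\<Sum>k\<in>I. \<Sum>l\<in>I. M k l * orb_avg v l k)"
proof -
  have int: "integrable \<mu> (\<lambda>g. orb v g l * cnj (orb v g k))" if "k \<in> I" "l \<in> I" for k l
    using that by (intro integrable_bdd_meas bdd_meas_intros)
  have "(\<Sum>k\<in>I. \<Sum>l\<in>I. M k l * orb_avg v l k) = (LINT g|\<mu>. (\<Sum>k\<in>I. \<Sum>l\<in>I. M k l * (orb v g l * cnj (orb v g k))))"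
    by (simp add: orb_avg_def int)
  then show ?thesis unfolding tw_quad by (simp add: mult_ac)
qed

lemma tw_herm:
  assumes "\<And>k l. k \<in> I \<Longrightarrow> l \<in> I \<Longrightarrow> M l k = cnj (M k l)" "p \<in> I" "q \<in> I"
  shows "tw M q p = cnj (tw M p q)"
proof -
  have "rot g M q p = cnj (rot g M p q)" for g
  proof -
    have "rot g M q p = (\<Sum>k\<in>I. \<Sum>l\<in>I. V g q l * M l k * cnj (V g p k))"
      unfolding rot_def by (rule sum.swap)
    also have "\<dots> = cnj (rot g M p q)"
      unfolding rot_def cnj_sum
    proof (intro sum.cong refl)
      fix k l assume "k \<in> I" "l \<in> I"
      then show "V g q l * M l k * cnj (V g p k) = cnj (V g p k * M k l * cnj (V g q l))"
        by (simp add: assms(1)[of k l] mult_ac)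
    qed
    finally show ?thesis .
  qed
  then show ?thesis unfolding tw_def by simp
qed

lemma tw_psd: "psd_on I M \<Longrightarrow> psd_on I (tw M)"
proof (rule psd_onI)
  assume M: "psd_on I M"
  show "tw M j i = cnj (tw M i j)" if "i \<in> I" "j \<in> I" for i j
    by (rule tw_herm[of M, OF psd_on_herm[OF M] that])
  fix v
  have "integrable \<mu> (\<lambda>g. \<Sum>k\<in>I. \<Sum>l\<in>I. cnj (orb v g k) * M k l * orb v g l)"
    by (intro integrable_bdd_meas bdd_meas_intros)
  then have "Re (\<Sum>p\<in>I. \<Sum>q\<in>I. cnj (v p) * tw M p q * v q)
    = (LINT g|\<mu>. Re (\<Sum>k\<in>I. \<Sum>l\<in>I. cnj (orb v g k) * M k l * orb v g l))"
    unfolding tw_quad by (rule integral_Re[symmetric])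
  then show "0 \<le> Re (\<Sum>p\<in>I. \<Sum>q\<in>I. cnj (v p) * tw M p q * v q)"
    by (simp only:) (intro Bochner_Integration.integral_nonneg psd_on_quad[OF M])
qed

lemma orb_avg_psd: "psd_on I (orb_avg v)"
proof (rule psd_onI)
  show "orb_avg v j i = cnj (orb_avg v i j)" for i j
    unfolding orb_avg_def by (subst Bochner_Integration.integral_cnj[symmetric]) (simp add: mult.commute)
  fix x
  have int: "integrable \<mu> (\<lambda>g. orb v g k * cnj (orb v g l))" if "k \<in> I" "l \<in> I" for k l
    using that by (intro integrable_bdd_meas bdd_meas_intros)
  have int2: "integrable \<mu> (\<lambda>g. (\<Sum>k\<in>I. cnj (x k) * orb v g k) * cnj (\<Sum>k\<in>I. cnj (x k) * orb v g k))"
    by (intro integrable_bdd_meas bdd_meas_intros)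
  have "(\<Sum>k\<in>I. \<Sum>l\<in>I. cnj (x k) * orb_avg v k l * x l)
    = (LINT g|\<mu>. (\<Sum>k\<in>I. \<Sum>l\<in>I. cnj (x k) * (orb v g k * cnj (orb v g l)) * x l))"
    by (simp add: orb_avg_def int)
  also have "\<dots> = (LINT g|\<mu>. (\<Sum>k\<in>I. cnj (x k) * orb v g k) * cnj (\<Sum>k\<in>I. cnj (x k) * orb v g k))"
    unfolding cnj_sum sum_product by (simp add: mult_ac)
  finally have "Re (\<Sum>k\<in>I. \<Sum>l\<in>I. cnj (x k) * orb_avg v k l * x l)
    = (LINT g|\<mu>. Re ((\<Sum>k\<in>I. cnj (x k) * orb v g k) * cnj (\<Sum>k\<in>I. cnj (x k) * orb v g k)))"
    using integral_Re[OF int2] by simp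
  also have "\<dots> \<ge> 0"
  proof (rule Bochner_Integration.integral_nonneg)
    fix g
    have "Re (z * cnj z) \<ge> 0" for z by simp
    then show "0 \<le> Re ((\<Sum>k\<in>I. cnj (x k) * orb v g k) * cnj (\<Sum>k\<in>I. cnj (x k) * orb v g k))" .
  qed
  finally show "0 \<le> Re (\<Sum>k\<in>I. \<Sum>l\<in>I. cnj (x k) * orb_avg v k l * x l)" .
qed

text \<open>The adjoint of V(g h) = V(g) V(h) begins with the adjoint of V(h), which cancels against
  V(h) by orthonormality of the rows.\<close>

lemma orb_translate:
  assumes g: "g \<in> carrier G" and h: "h \<in> carrier G" and p: "p \<in> I"
  shows "(\<Sum>k\<in>I. V h p k * orb v (g \<otimes>\<^bsub>G\<^esub> h) k) = orb v g p"
proof -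
  have "(\<Sum>k\<in>I. V h p k * orb v (g \<otimes>\<^bsub>G\<^esub> h) k)
    = (\<Sum>k\<in>I. \<Sum>r\<in>I. \<Sum>j\<in>I. V h p k * cnj (V h j k) * (cnj (V g r j) * v r))"
    unfolding orb_def using g h by (simp add: V_mult sum_distrib_left sum_distrib_right mult_ac)
  also have "\<dots> = (\<Sum>r\<in>I. \<Sum>k\<in>I. \<Sum>j\<in>I. V h p k * cnj (V h j k) * (cnj (V g r j) * v r))"
    by (rule sum.swap)
  also have "\<dots> = (\<Sum>r\<in>I. \<Sum>j\<in>I. \<Sum>k\<in>I. V h p k * cnj (V h j k) * (cnj (V g r j) * v r))"
    by (intro sum.cong refl sum.swap)
  also have "\<dots> = (\<Sum>r\<in>I. \<Sum>j\<in>I. (if p = j then 1 else 0) * (cnj (V g r j) * v r))"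
    unfolding sum_distrib_right[symmetric] by (intro sum.cong refl) (simp add: V_rows[OF h p])
  also have "\<dots> = (\<Sum>r\<in>I. cnj (V g r p) * v r)"
    by (intro sum.cong refl) (simp add: if_distrib[where f="\<lambda>c. c * _"] fin p cong: if_cong)
  finally show ?thesis by (simp add: orb_def)
qed

text \<open>After the substitution of g h for g in the integral, \<open>orb_translate\<close>
  absorbs the outer factors \<open>V h\<close>.\<close>

lemma orb_avg_invariant:
  assumes h: "h \<in> carrier G" and p: "p \<in> I" and q: "q \<in> I"
  shows "rot h (orb_avg v) p q = orb_avg v p q"
proof -
  have int: "integrable \<mu> (\<lambda>g. orb v g k * cnj (orb v g l))" if "k \<in> I" "l \<in> I" for k l
    using that by (intro integrable_bdd_meas bdd_meas_intros)
  let ?F = "\<lambda>g. (\<Sum>k\<in>I. V h p k * orb v g k) * cnj (\<Sum>l\<in>I. V h q l * orb v g l)"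
  have "rot h (orb_avg v) p q = (LINT g|\<mu>. (\<Sum>k\<in>I. \<Sum>l\<in>I. V h p k * (orb v g k * cnj (orb v g l)) * cnj (V h q l)))"
    by (simp add: rot_def orb_avg_def int)
  also have "\<dots> = (LINT g|\<mu>. ?F g)"
    unfolding cnj_sum sum_product by (simp add: mult_ac)
  also have "\<dots> = (LINT g|\<mu>. ?F (g \<otimes>\<^bsub>G\<^esub> h))"
    by (rule right_inv[OF h, symmetric]) (intro bdd_meas_intros)
  also have "\<dots> = (LINT g|\<mu>. orb v g p * cnj (orb v g q))"
    by (intro Bochner_Integration.integral_cong refl) (simp add: space_eq orb_translate h p q)
  finally show ?thesis by (simp add: orb_avg_def)
qed

text \<open>For each g the trace is unchanged by orthonormality of the columns, and \<mu> has total
  mass one.\<close>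

lemma tw_trace: "(\<Sum>p\<in>I. tw M p p) = (\<Sum>p\<in>I. M p p)"
proof -
  have int: "integrable \<mu> (\<lambda>g. rot g M p q)" if "p \<in> I" "q \<in> I" for p q
    using that by (intro integrable_bdd_meas bdd_meas_intros)
  have "(\<Sum>p\<in>I. rot g M p p) = (\<Sum>p\<in>I. M p p)" if g: "g \<in> carrier G" for g
  proof -
    have "(\<Sum>p\<in>I. rot g M p p) = (\<Sum>p\<in>I. \<Sum>k\<in>I. \<Sum>l\<in>I. M k l * (V g p k * cnj (V g p l)))"
      unfolding rot_def by (simp add: mult_ac)
    also have "\<dots> = (\<Sum>k\<in>I. \<Sum>p\<in>I. \<Sum>l\<in>I. M k l * (V g p k * cnj (V g p l)))"
      by (rule sum.swap)
    also have "\<dots> = (\<Sum>k\<in>I. \<Sum>l\<in>I. \<Sum>p\<in>I. M k l * (V g p k * cnj (V g p l)))"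
      by (intro sum.cong refl sum.swap)
    also have "\<dots> = (\<Sum>k\<in>I. \<Sum>l\<in>I. M k l * (if k = l then 1 else 0))"
      unfolding sum_distrib_left[symmetric] by (intro sum.cong refl) (simp add: V_cols[OF g])
    also have "\<dots> = (\<Sum>k\<in>I. M k k)"
      by (intro sum.cong refl) (simp add: if_distrib[where f="\<lambda>c. _ * c"] fin cong: if_cong)
    finally show ?thesis .
  qed
  then have "(LINT g|\<mu>. (\<Sum>p\<in>I. rot g M p p)) = (LINT g|\<mu>. (\<Sum>p\<in>I. M p p))"
    by (intro Bochner_Integration.integral_cong refl) (simp add: space_eq)
  then show ?thesis by (simp add: tw_def int prob_space)
qed

lemma tw_linear:
  assumes "p \<in> I" "q \<in> I"
  shows "tw (\<lambda>k l. a * M k l + b * N k l) p q = a * tw M p q + b * tw N p q"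
proof -
  have int: "integrable \<mu> (\<lambda>g. rot g M p q)" for M
    using assms by (intro integrable_bdd_meas bdd_meas_intros)
  have "rot g (\<lambda>k l. a * M k l + b * N k l) p q = a * rot g M p q + b * rot g N p q" for g
    unfolding rot_def by (simp add: sum_distrib_left sum.distrib distrib_left distrib_right mult_ac)
  then show ?thesis by (simp add: tw_def int)
qed

end

section \<open>Matrices on a tensor product\<close>

abbreviation idx :: "nat \<Rightarrow> nat \<Rightarrow> (nat \<times> nat) set" where
  "idx d n \<equiv> {..<d} \<times> {..<n}"

text \<open>The index convention of \<open>kron\<close> and \<open>ampl\<close>: the reference is
  the slow coordinate.\<close>

definition enc :: "nat \<Rightarrow> nat \<times> nat \<Rightarrow> nat" where
  "enc n p = fst p * n + snd p"

definition blk :: "nat \<Rightarrow> complex mat \<Rightarrow> nat \<times> nat \<Rightarrow> nat \<times> nat \<Rightarrow> complex" where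
  "blk n M p q = M $$ (enc n p, enc n q)"

lemma enc_less: "p \<in> idx d n \<Longrightarrow> enc n p < d * n"
proof -
  assume "p \<in> idx d n"
  then have "Suc (fst p) \<le> d" "snd p < n" by auto
  then have "fst p * n + snd p < Suc (fst p) * n" by simp
  also have "\<dots> \<le> d * n" using \<open>Suc (fst p) \<le> d\<close> by (rule mult_le_mono1)
  finally show ?thesis by (simp add: enc_def)
qed

lemma enc_div_mod:
  assumes "p \<in> idx d n"
  shows "enc n p div n = fst p" "enc n p mod n = snd p"
  using assms by (auto simp: enc_def)

lemma bij_enc: "bij_betw (enc n) (idx d n) {..<d * n}"
proof (rule bij_betw_byWitness[where f'="\<lambda>i. (i div n, i mod n)"])
  show "\<forall>a\<in>idx d n. (enc n a div n, enc n a mod n) = a"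
    using enc_div_mod by (metis prod.collapse)
  show "\<forall>a'\<in>{..<d * n}. enc n (a' div n, a' mod n) = a'" by (simp add: enc_def)
  show "enc n ` idx d n \<subseteq> {..<d * n}" using enc_less by blast
  show "(\<lambda>i. (i div n, i mod n)) ` {..<d * n} \<subseteq> idx d n"
  proof
    fix x assume "x \<in> (\<lambda>i. (i div n, i mod n)) ` {..<d * n}"
    then obtain i where i: "i < d * n" "x = (i div n, i mod n)" by auto
    then have "0 < n" by (cases n) auto
    then show "x \<in> idx d n" using i by (simp add: less_mult_imp_div_less)
  qed
qed

lemma sum_enc: "(\<Sum>i<d * n. f i) = (\<Sum>p\<in>idx d n. f (enc n p))"
  by (rule sum.reindex_bij_betw[OF bij_enc, symmetric])

lemma sum_tensor:
  fixes f g :: "nat \<Rightarrow> complex"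
  shows "(\<Sum>k\<in>idx d n. f (fst k) * g (snd k)) = (\<Sum>r<d. f r) * (\<Sum>a<n. g a)"
  by (simp add: sum_product sum.cartesian_product case_prod_beta)

lemma sum_tensor2:
  fixes f g :: "nat \<Rightarrow> nat \<Rightarrow> complex"
  shows "(\<Sum>k\<in>idx d n. \<Sum>l\<in>idx d n. f (fst k) (fst l) * g (snd k) (snd l))
    = (\<Sum>r<d. \<Sum>s<d. f r s) * (\<Sum>a<n. \<Sum>b<n. g a b)"
proof -
  have "(\<Sum>k\<in>idx d n. \<Sum>l\<in>idx d n. f (fst k) (fst l) * g (snd k) (snd l))
    = (\<Sum>k\<in>idx d n. (\<Sum>s<d. f (fst k) s) * (\<Sum>b<n. g (snd k) b))"
    by (simp only: sum_tensor)
  then show ?thesis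
    using sum_tensor[of "\<lambda>r. \<Sum>s<d. f r s" "\<lambda>a. \<Sum>b<n. g a b"] by (rule trans)
qed

lemma psd_iff_psd_on:
  assumes "M \<in> carrier_mat n n"
  shows "psd M \<longleftrightarrow> psd_on {..<n} (\<lambda>i j. M $$ (i,j))"
proof -
  have dims: "dim_row M = n" "dim_col M = n" using assms by auto
  have quad: "(\<Sum>i<n. cnj (v $ i) * (M *\<^sub>v v) $ i) = (\<Sum>i<n. \<Sum>j<n. cnj (v $ i) * M $$ (i,j) * v $ j)"
    if "dim_vec v = n" for v
  proof (rule sum.cong[OF refl])
    fix i assume "i \<in> {..<n}"
    then have "(M *\<^sub>v v) $ i = (\<Sum>j<n. M $$ (i,j) * v $ j)"
      using dims that by (simp add: scalar_prod_def atLeast0LessThan)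
    then show "cnj (v $ i) * (M *\<^sub>v v) $ i = (\<Sum>j<n. cnj (v $ i) * M $$ (i,j) * v $ j)"
      by (simp add: sum_distrib_left mult_ac)
  qed
  have adj: "adj M = M \<longleftrightarrow> (\<forall>i\<in>{..<n}. \<forall>j\<in>{..<n}. M $$ (j,i) = cnj (M $$ (i,j)))"
  proof
    assume "adj M = M"
    then have e: "M $$ (j,i) = adj M $$ (j,i)" for i j by (simp only:)
    show "\<forall>i\<in>{..<n}. \<forall>j\<in>{..<n}. M $$ (j,i) = cnj (M $$ (i,j))"
    proof (intro ballI)
      fix i j assume "i \<in> {..<n}" "j \<in> {..<n}"
      then have "adj M $$ (j,i) = cnj (M $$ (i,j))" using dims by (simp add: adj_def)
      then show "M $$ (j,i) = cnj (M $$ (i,j))" by (rule trans[OF e])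
    qed
  next
    assume a: "\<forall>i\<in>{..<n}. \<forall>j\<in>{..<n}. M $$ (j,i) = cnj (M $$ (i,j))"
    show "adj M = M"
    proof (rule eq_matI)
      fix i j assume "i < dim_row M" "j < dim_col M"
      then show "adj M $$ (i,j) = M $$ (i,j)"
        using a[rule_format, of j i] dims by (simp add: adj_def)
    qed (use dims in \<open>auto simp: adj_def\<close>)
  qed
  have q: "(\<forall>v. dim_vec v = n \<longrightarrow> 0 \<le> Re (\<Sum>i<n. cnj (v $ i) * (M *\<^sub>v v) $ i))
     \<longleftrightarrow> (\<forall>v. 0 \<le> Re (\<Sum>i<n. \<Sum>j<n. cnj (v i) * M $$ (i,j) * v j))"
  proof (intro iffI allI impI)
    fix v :: "nat \<Rightarrow> complex"
    assume A: "\<forall>v. dim_vec v = n \<longrightarrow> 0 \<le> Re (\<Sum>i<n. cnj (v $ i) * (M *\<^sub>v v) $ i)"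
    have "0 \<le> Re (\<Sum>i<n. cnj (vec n v $ i) * (M *\<^sub>v vec n v) $ i)" by (rule A[rule_format]) simp
    then have "0 \<le> Re (\<Sum>i<n. \<Sum>j<n. cnj (vec n v $ i) * M $$ (i,j) * vec n v $ j)"
      by (simp only: quad dim_vec)
    also have "(\<Sum>i<n. \<Sum>j<n. cnj (vec n v $ i) * M $$ (i,j) * vec n v $ j)
      = (\<Sum>i<n. \<Sum>j<n. cnj (v i) * M $$ (i,j) * v j)"
      by (intro sum.cong refl) auto
    finally show "0 \<le> Re (\<Sum>i<n. \<Sum>j<n. cnj (v i) * M $$ (i,j) * v j)" .
  next
    fix v :: "complex vec"
    assume "\<forall>v. 0 \<le> Re (\<Sum>i<n. \<Sum>j<n. cnj (v i) * M $$ (i,j) * v j)" "dim_vec v = n"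
    then show "0 \<le> Re (\<Sum>i<n. cnj (v $ i) * (M *\<^sub>v v) $ i)" by (simp only: quad)
  qed
  show ?thesis unfolding psd_def psd_on_def dims adj q using assms by blast
qed

lemma psd_iff_psd_on_blk:
  assumes "M \<in> carrier_mat (d * n) (d * n)"
  shows "psd M \<longleftrightarrow> psd_on (idx d n) (blk n M)"
  unfolding psd_iff_psd_on[OF assms] psd_on_reindex[OF bij_enc] blk_def by simp

lemma kron_carrier:
  "A \<in> carrier_mat d d \<Longrightarrow> B \<in> carrier_mat n n \<Longrightarrow> kron A B \<in> carrier_mat (d * n) (d * n)"
  unfolding kron_def by auto

lemma blk_kron:
  assumes "A \<in> carrier_mat d d" "B \<in> carrier_mat n n" "p \<in> idx d n" "q \<in> idx d n"
  shows "blk n (kron A B) p q = A $$ (fst p, fst q) * B $$ (snd p, snd q)"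
  using assms enc_less[of p d n] enc_less[of q d n] enc_div_mod[of p d n] enc_div_mod[of q d n]
  by (simp add: blk_def kron_def)

lemma mult_entry:
  assumes "A \<in> carrier_mat n n" "B \<in> carrier_mat n n" "i < n" "j < n"
  shows "(A * B) $$ (i,j) = (\<Sum>k<n. A $$ (i,k) * B $$ (k,j))"
  using assms by (simp add: scalar_prod_def atLeast0LessThan)

lemma conjugation_entry:
  assumes "A \<in> carrier_mat n n" "M \<in> carrier_mat n n" "i < n" "j < n"
  shows "(A * M * adj A) $$ (i,j) = (\<Sum>k<n. \<Sum>l<n. A $$ (i,k) * M $$ (k,l) * cnj (A $$ (j,l)))"
proof -
  have "(A * M * adj A) $$ (i,j) = (\<Sum>l<n. (\<Sum>k<n. A $$ (i,k) * M $$ (k,l)) * cnj (A $$ (j,l)))"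
    using assms by (simp add: scalar_prod_def adj_def atLeast0LessThan)
  also have "\<dots> = (\<Sum>l<n. \<Sum>k<n. A $$ (i,k) * M $$ (k,l) * cnj (A $$ (j,l)))"
    by (simp add: sum_distrib_right)
  also have "\<dots> = (\<Sum>k<n. \<Sum>l<n. A $$ (i,k) * M $$ (k,l) * cnj (A $$ (j,l)))"
    by (rule sum.swap)
  finally show ?thesis .
qed

lemma unitary_mat_rows:
  assumes "unitary_mat n U" "i < n" "j < n"
  shows "(\<Sum>k<n. U $$ (i,k) * cnj (U $$ (j,k))) = (if i = j then 1 else 0)"
proof -
  have U: "U \<in> carrier_mat n n" "U * adj U = 1\<^sub>m n" using assms unfolding unitary_mat_def by auto
  have "(U * adj U) $$ (i,j) = (\<Sum>k<n. U $$ (i,k) * cnj (U $$ (j,k)))"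
    using assms U(1) by (simp add: scalar_prod_def adj_def atLeast0LessThan)
  then show ?thesis using U(2) assms by simp
qed

lemma unitary_mat_cols:
  assumes "unitary_mat n U" "i < n" "j < n"
  shows "(\<Sum>k<n. U $$ (k,i) * cnj (U $$ (k,j))) = (if i = j then 1 else 0)"
proof -
  have U: "U \<in> carrier_mat n n" "adj U * U = 1\<^sub>m n" using assms unfolding unitary_mat_def by auto
  have "(adj U * U) $$ (j,i) = (\<Sum>k<n. cnj (U $$ (k,j)) * U $$ (k,i))"
    using assms U(1) by (simp add: scalar_prod_def adj_def atLeast0LessThan)
  then show ?thesis using U(2) assms by (simp add: mult.commute eq_commute)
qed

lemma unitary_mat_entry_le:
  assumes "unitary_mat n U" "i < n" "j < n"
  shows "cmod (U $$ (i,j)) \<le> 1"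
proof -
  have "complex_of_real (\<Sum>k<n. (cmod (U $$ (i,k)))\<^sup>2) = 1"
    using unitary_mat_rows[OF assms(1,2,2)] by (simp add: complex_norm_square[symmetric] del: of_real_power)
  then have "(\<Sum>k<n. (cmod (U $$ (i,k)))\<^sup>2) = 1" by (simp only: of_real_eq_1_iff)
  moreover have "(cmod (U $$ (i,j)))\<^sup>2 \<le> (\<Sum>k<n. (cmod (U $$ (i,k)))\<^sup>2)"
    using assms(3) by (intro member_le_sum) auto
  ultimately show ?thesis by (simp add: power_le_one_iff abs_square_le_1[symmetric])
qed

lemma unitary_rep_bdd_meas:
  assumes "haar_prob G T \<mu>" "compact_group G T" "unitary_rep G T n U" "i < n" "j < n"
  shows "bdd_meas \<mu> (\<lambda>g. U g $$ (i,j))"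
proof -
  have "(\<lambda>g. U g $$ (i,j)) \<in> borel_measurable \<mu>"
    using assms unfolding unitary_rep_def by (intro haar_continuous_measurable[OF assms(1,2)]) auto
  moreover have "\<forall>g\<in>space \<mu>. cmod (U g $$ (i,j)) \<le> 1"
    using assms unitary_mat_entry_le unfolding unitary_rep_def haar_prob_def by metis
  ultimately show ?thesis unfolding bdd_meas_def by blast
qed

definition tensor_rep :: "('g \<Rightarrow> complex mat) \<Rightarrow> ('g \<Rightarrow> complex mat) \<Rightarrow> 'g \<Rightarrow> nat \<times> nat \<Rightarrow> nat \<times> nat \<Rightarrow> complex" where
  "tensor_rep UB UX g p q = cnj (UB g $$ (fst p, fst q)) * UX g $$ (snd p, snd q)"

definition tensor_op :: "complex mat \<Rightarrow> complex mat \<Rightarrow> nat \<times> nat \<Rightarrow> nat \<times> nat \<Rightarrow> complex" where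
  "tensor_op A B p q = A $$ (fst p, fst q) * B $$ (snd p, snd q)"

lemma unitary_action_tensor_rep:
  assumes H: "haar_prob G T \<mu>" and C: "compact_group G T"
    and B: "unitary_rep G T d UB" and X: "unitary_rep G T n UX"
  shows "unitary_action \<mu> G (idx d n) (tensor_rep UB UX)"
proof -
  interpret prob_space \<mu> using H unfolding haar_prob_def by auto
  have uB: "unitary_mat d (UB g)" and uX: "unitary_mat n (UX g)" if "g \<in> carrier G" for g
    using B X that unfolding unitary_rep_def by auto
  show ?thesis
  proof (intro unitary_action.intro unitary_action_axioms.intro)
    show "prob_space \<mu>" by unfold_locales
    show "group G" using C unfolding compact_group_def by auto
    show "space \<mu> = carrier G" using H unfolding haar_prob_def by auto
    show "finite (idx d n)" by simp
    show "(LINT g|\<mu>. f (g \<otimes>\<^bsub>G\<^esub> h)) = (LINT g|\<mu>. f g :: complex)"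
      if "h \<in> carrier G" "bdd_meas \<mu> f" for h f
      using haar_right_translation_integral[OF H C that(1)] that(2) unfolding bdd_meas_def by blast
    fix p q assume p: "p \<in> idx d n" and q: "q \<in> idx d n"
    then have pq: "fst p < d" "snd p < n" "fst q < d" "snd q < n" by auto
    show "bdd_meas \<mu> (\<lambda>g. tensor_rep UB UX g p q)"
      unfolding tensor_rep_def using pq
      by (intro bdd_meas_intros unitary_rep_bdd_meas[OF H C B] unitary_rep_bdd_meas[OF H C X])
    fix g assume g: "g \<in> carrier G"
    have "(\<Sum>k\<in>idx d n. tensor_rep UB UX g p k * cnj (tensor_rep UB UX g q k))
      = (\<Sum>k\<in>idx d n. (cnj (UB g $$ (fst p, fst k) * cnj (UB g $$ (fst q, fst k)))) *
          (UX g $$ (snd p, snd k) * cnj (UX g $$ (snd q, snd k))))"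
      unfolding tensor_rep_def by (simp add: mult_ac)
    also have "\<dots> = cnj (\<Sum>r<d. UB g $$ (fst p, r) * cnj (UB g $$ (fst q, r))) *
          (\<Sum>a<n. UX g $$ (snd p, a) * cnj (UX g $$ (snd q, a)))"
      by (subst sum_tensor) simp
    finally show "(\<Sum>k\<in>idx d n. tensor_rep UB UX g p k * cnj (tensor_rep UB UX g q k)) = (if p = q then 1 else 0)"
      using pq by (simp add: unitary_mat_rows[OF uB[OF g]] unitary_mat_rows[OF uX[OF g]] prod_eq_iff)
    have "(\<Sum>k\<in>idx d n. tensor_rep UB UX g k p * cnj (tensor_rep UB UX g k q))
      = (\<Sum>k\<in>idx d n. (cnj (UB g $$ (fst k, fst p) * cnj (UB g $$ (fst k, fst q)))) *
          (UX g $$ (snd k, snd p) * cnj (UX g $$ (snd k, snd q))))"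
      unfolding tensor_rep_def by (simp add: mult_ac)
    also have "\<dots> = cnj (\<Sum>r<d. UB g $$ (r, fst p) * cnj (UB g $$ (r, fst q))) *
          (\<Sum>a<n. UX g $$ (a, snd p) * cnj (UX g $$ (a, snd q)))"
      by (subst sum_tensor) simp
    finally show "(\<Sum>k\<in>idx d n. tensor_rep UB UX g k p * cnj (tensor_rep UB UX g k q)) = (if p = q then 1 else 0)"
      using pq by (simp add: unitary_mat_cols[OF uB[OF g]] unitary_mat_cols[OF uX[OF g]] prod_eq_iff)
    fix h assume h: "h \<in> carrier G"
    have eB: "UB (g \<otimes>\<^bsub>G\<^esub> h) $$ (fst p, fst q) = (\<Sum>k<d. UB g $$ (fst p, k) * UB h $$ (k, fst q))"
    proof -
      have "UB (g \<otimes>\<^bsub>G\<^esub> h) = UB g * UB h" using B g h unfolding unitary_rep_def by blast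
      moreover have "UB g \<in> carrier_mat d d" "UB h \<in> carrier_mat d d"
        using uB[OF g] uB[OF h] unfolding unitary_mat_def by auto
      ultimately show ?thesis by (simp only: mult_entry[where n=d] pq)
    qed
    have eX: "UX (g \<otimes>\<^bsub>G\<^esub> h) $$ (snd p, snd q) = (\<Sum>k<n. UX g $$ (snd p, k) * UX h $$ (k, snd q))"
    proof -
      have "UX (g \<otimes>\<^bsub>G\<^esub> h) = UX g * UX h" using X g h unfolding unitary_rep_def by blast
      moreover have "UX g \<in> carrier_mat n n" "UX h \<in> carrier_mat n n"
        using uX[OF g] uX[OF h] unfolding unitary_mat_def by auto
      ultimately show ?thesis by (simp only: mult_entry[where n=n] pq)
    qed
    have "(\<Sum>k\<in>idx d n. tensor_rep UB UX g p k * tensor_rep UB UX h k q)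
      = (\<Sum>k\<in>idx d n. cnj (UB g $$ (fst p, fst k) * UB h $$ (fst k, fst q)) *
          (UX g $$ (snd p, snd k) * UX h $$ (snd k, snd q)))"
      unfolding tensor_rep_def by (simp add: mult_ac)
    also have "\<dots> = tensor_rep UB UX (g \<otimes>\<^bsub>G\<^esub> h) p q"
      by (subst sum_tensor) (simp add: tensor_rep_def eB eX)
    finally show "tensor_rep UB UX (g \<otimes>\<^bsub>G\<^esub> h) p q = (\<Sum>k\<in>idx d n. tensor_rep UB UX g p k * tensor_rep UB UX h k q)" ..
  qed
qed

section \<open>The min-entropy program in index form\<close>

definition id_tensor :: "(nat \<Rightarrow> nat \<Rightarrow> complex) \<Rightarrow> nat \<times> nat \<Rightarrow> nat \<times> nat \<Rightarrow> complex" where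
  "id_tensor y p q = (if fst p = fst q then y (snd p) (snd q) else 0)"

definition dominating_traces :: "nat \<Rightarrow> nat \<Rightarrow> (nat \<times> nat \<Rightarrow> nat \<times> nat \<Rightarrow> complex) \<Rightarrow> real set" where
  "dominating_traces d n W = {Re (\<Sum>a<n. y a a) | y.
     psd_on {..<n} y \<and> psd_on (idx d n) (\<lambda>p q. id_tensor y p q - W p q)}"

lemma Hmin_eq:
  assumes W: "W \<in> carrier_mat (d * n) (d * n)"
  shows "Hmin d n W = - log 2 (Inf (dominating_traces d n (blk n W)))"
proof -
  have blk: "psd (kron (1\<^sub>m d) Y - W) \<longleftrightarrow> psd_on (idx d n) (\<lambda>p q. id_tensor (\<lambda>a b. Y $$ (a,b)) p q - blk n W p q)"
    if Y: "Y \<in> carrier_mat n n" for Y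
  proof -
    have k: "kron (1\<^sub>m d) Y \<in> carrier_mat (d * n) (d * n)" by (rule kron_carrier[OF one_carrier_mat Y])
    have e: "blk n (kron (1\<^sub>m d) Y - W) p q = id_tensor (\<lambda>a b. Y $$ (a,b)) p q - blk n W p q"
      if "p \<in> idx d n" "q \<in> idx d n" for p q
      using blk_kron[OF one_carrier_mat Y that] enc_less[OF that(1)] enc_less[OF that(2)] k W that
      by (auto simp: blk_def id_tensor_def)
    have "psd (kron (1\<^sub>m d) Y - W) \<longleftrightarrow> psd_on (idx d n) (blk n (kron (1\<^sub>m d) Y - W))"
      by (rule psd_iff_psd_on_blk[OF minus_carrier_mat[OF W]])
    also have "\<dots> \<longleftrightarrow> psd_on (idx d n) (\<lambda>p q. id_tensor (\<lambda>a b. Y $$ (a,b)) p q - blk n W p q)"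
      by (rule psd_on_cong[OF e])
    finally show ?thesis .
  qed
  have "{Re (mtrace Y) | Y. Y \<in> carrier_mat n n \<and> psd Y \<and> psd (kron (1\<^sub>m d) Y - W)} = dominating_traces d n (blk n W)"
    (is "?L = ?R")
  proof (intro equalityI subsetI)
    fix t assume "t \<in> ?L"
    then obtain Y where Y: "Y \<in> carrier_mat n n" "psd Y" "psd (kron (1\<^sub>m d) Y - W)" "t = Re (mtrace Y)" by blast
    have "psd_on {..<n} (\<lambda>a b. Y $$ (a,b))" using Y psd_iff_psd_on by blast
    moreover have "psd_on (idx d n) (\<lambda>p q. id_tensor (\<lambda>a b. Y $$ (a,b)) p q - blk n W p q)"
      using Y blk by blast
    moreover have "t = Re (\<Sum>a<n. Y $$ (a,a))" using Y by (simp add: mtrace_def)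
    ultimately show "t \<in> ?R"
      unfolding dominating_traces_def by (intro CollectI exI[of _ "\<lambda>a b. Y $$ (a,b)"]) blast
  next
    fix t assume "t \<in> ?R"
    then obtain y where y: "psd_on {..<n} y" "psd_on (idx d n) (\<lambda>p q. id_tensor y p q - blk n W p q)"
      "t = Re (\<Sum>a<n. y a a)" unfolding dominating_traces_def by blast
    define Y where "Y = mat n n (\<lambda>(a,b). y a b)"
    have Y: "Y \<in> carrier_mat n n" by (simp add: Y_def)
    have "psd Y" unfolding psd_iff_psd_on[OF Y]
      using y(1) by (rule iffD1[OF psd_on_cong, rotated]) (simp add: Y_def)
    moreover have "psd (kron (1\<^sub>m d) Y - W)" unfolding blk[OF Y]
      using y(2) by (rule iffD1[OF psd_on_cong, rotated]) (auto simp: Y_def id_tensor_def)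
    moreover have "t = Re (mtrace Y)" using y(3) by (simp add: Y_def mtrace_def)
    ultimately show "t \<in> ?L" using Y by blast
  qed
  then show ?thesis unfolding Hmin_def by simp
qed

section \<open>Dominating operators and the twirl\<close>

lemma dominating_traces_cong:
  assumes "\<And>p q. p \<in> idx d n \<Longrightarrow> q \<in> idx d n \<Longrightarrow> W p q = W' p q"
  shows "dominating_traces d n W = dominating_traces d n W'"
proof -
  have "psd_on (idx d n) (\<lambda>p q. id_tensor y p q - W p q) \<longleftrightarrow> psd_on (idx d n) (\<lambda>p q. id_tensor y p q - W' p q)" for y
    by (rule psd_on_cong) (simp add: assms)
  then show ?thesis unfolding dominating_traces_def by simp
qed

lemma sum_delta_pair:
  fixes f :: "nat \<Rightarrow> nat \<Rightarrow> complex"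
  shows "(\<Sum>r<d. \<Sum>s<d. (if r = s then 1 else 0) * f r s) = (\<Sum>r<d. f r r)"
    and "(\<Sum>r<d. \<Sum>s<d. f r s * (if r = s then 1 else 0)) = (\<Sum>r<d. f r r)"
  by (simp_all add: if_distrib[where f="\<lambda>c. c * _"] if_distrib[where f="\<lambda>c. _ * c"] cong: if_cong)

lemma trace_id_tensor: "(\<Sum>p\<in>idx d n. id_tensor y p p) = of_nat d * (\<Sum>a<n. y a a)"
  using sum_tensor[of "\<lambda>_. 1" "\<lambda>a. y a a"] by (simp add: id_tensor_def)

lemma trace_tensor_op:
  "A \<in> carrier_mat d d \<Longrightarrow> B \<in> carrier_mat n n \<Longrightarrow> (\<Sum>p\<in>idx d n. tensor_op A B p p) = mtrace A * mtrace B"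
  using sum_tensor[of "\<lambda>r. A $$ (r,r)" "\<lambda>a. B $$ (a,a)"] by (simp add: tensor_op_def mtrace_def)

lemma psd_on_id_tensor_imp:
  assumes "psd_on (idx d n) (id_tensor y)" "0 < d"
  shows "psd_on {..<n} y"
proof -
  have "psd_on ({0} \<times> {..<n}) (id_tensor y)"
    using assms by (intro psd_on_subset[OF assms(1)]) auto
  moreover have "bij_betw (\<lambda>a. (0, a)) {..<n} ({0::nat} \<times> {..<n})"
    by (auto simp: bij_betw_def inj_on_def)
  ultimately show ?thesis using psd_on_reindex by (fastforce simp: id_tensor_def)
qed

text \<open>Positivity of y comes from domination: 1 \<otimes> y lies above the positive W, hence is
  positive, and y is one of its diagonal blocks. Such a block exists because d > 0.\<close>

lemma dominating_tracesI:
  assumes W: "psd_on (idx d n) W" and y: "psd_on (idx d n) (\<lambda>p q. id_tensor y p q - W p q)" and d: "0 < d"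
  shows "Re (\<Sum>a<n. y a a) \<in> dominating_traces d n W"
proof -
  have "psd_on (idx d n) (\<lambda>p q. (id_tensor y p q - W p q) + W p q)"
    by (rule psd_on_add[OF y W])
  then have "psd_on {..<n} y" using psd_on_id_tensor_imp[OF _ d] by simp
  then show ?thesis using y unfolding dominating_traces_def by blast
qed

text \<open>The trace of the dominating inequality. It bounds the set from below, and for W of trace
  one it keeps the infimum at least 1/d.\<close>

lemma dominating_traces_ge:
  assumes "t \<in> dominating_traces d n W"
  shows "Re (\<Sum>p\<in>idx d n. W p p) \<le> real d * t"
proof -
  obtain y where y: "psd_on (idx d n) (\<lambda>p q. id_tensor y p q - W p q)" "t = Re (\<Sum>a<n. y a a)"
    using assms unfolding dominating_traces_def by blast
  have "0 \<le> (\<Sum>p\<in>idx d n. Re (id_tensor y p p - W p p))"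
    by (rule sum_nonneg) (rule psd_on_diag(1)[OF y(1)], auto)
  also have "\<dots> = Re (\<Sum>p\<in>idx d n. id_tensor y p p) - Re (\<Sum>p\<in>idx d n. W p p)"
    by (simp add: sum_subtractf)
  also have "Re (\<Sum>p\<in>idx d n. id_tensor y p p) = real d * t"
    unfolding trace_id_tensor y(2) by simp
  finally show ?thesis by simp
qed

lemma dominating_traces_nonempty:
  assumes W: "psd_on (idx d n) W" and d: "0 < d"
  shows "dominating_traces d n W \<noteq> {}"
proof -
  define M where "M = (\<Sum>p\<in>idx d n. Re (W p p))"
  \<comment> \<open>The trace M bounds all entries by \<open>psd_on_entry_bound\<close>, and
    \<open>quad_le_entry_bound\<close> then bounds the form of W by c |v|^2; so c times the identity
    dominates W.\<close>
  define c where "c = M * real (card (idx d n))"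
  define y where "y = (\<lambda>a b :: nat. if a = b then complex_of_real c else (0::complex))"
  have "psd_on (idx d n) (\<lambda>p q. id_tensor y p q - W p q)"
  proof (rule psd_onI)
    fix p q assume "p \<in> idx d n" "q \<in> idx d n"
    then show "id_tensor y q p - W q p = cnj (id_tensor y p q - W p q)"
      using psd_on_herm[OF W, of p q] by (auto simp: id_tensor_def y_def)
  next
    fix v
    have "(\<Sum>p\<in>idx d n. \<Sum>q\<in>idx d n. cnj (v p) * id_tensor y p q * v q)
      = (\<Sum>p\<in>idx d n. \<Sum>q\<in>idx d n. if q = p then of_real c * (v p * cnj (v p)) else 0)"
      by (intro sum.cong refl) (auto simp: id_tensor_def y_def prod_eq_iff)
    also have "\<dots> = (\<Sum>p\<in>idx d n. of_real (c * (cmod (v p))\<^sup>2))"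
      by (intro sum.cong refl) (simp add: complex_norm_square del: of_real_power)
    finally have 1: "Re (\<Sum>p\<in>idx d n. \<Sum>q\<in>idx d n. cnj (v p) * id_tensor y p q * v q)
      = c * (\<Sum>p\<in>idx d n. (cmod (v p))\<^sup>2)"
      by (simp add: sum_distrib_left del: of_real_power of_real_mult)
    have 2: "Re (\<Sum>p\<in>idx d n. \<Sum>q\<in>idx d n. cnj (v p) * W p q * v q) \<le> c * (\<Sum>p\<in>idx d n. (cmod (v p))\<^sup>2)"
      unfolding c_def by (rule quad_le_entry_bound) (auto intro: psd_on_entry_bound[OF W] simp: M_def)
    have "(\<Sum>p\<in>idx d n. \<Sum>q\<in>idx d n. cnj (v p) * (id_tensor y p q - W p q) * v q)
      = (\<Sum>p\<in>idx d n. \<Sum>q\<in>idx d n. cnj (v p) * id_tensor y p q * v q) - (\<Sum>p\<in>idx d n. \<Sum>q\<in>idx d n. cnj (v p) * W p q * v q)"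
      by (simp only: right_diff_distrib left_diff_distrib sum_subtractf)
    then show "0 \<le> Re (\<Sum>p\<in>idx d n. \<Sum>q\<in>idx d n. cnj (v p) * (id_tensor y p q - W p q) * v q)"
      using 1 2 by simp
  qed
  from dominating_tracesI[OF W this d] show ?thesis by blast
qed

text \<open>A Gram decomposition of A turns the form into a sum over k of forms of B, each at the
  vector obtained by contracting v with the k-th factor in the first coordinate.\<close>

lemma psd_on_tensor:
  assumes "finite I" "psd_on I A" "psd_on J B"
  shows "psd_on (I \<times> J) (\<lambda>p q. A (fst p) (fst q) * B (snd p) (snd q))"
proof (rule psd_onI)
  fix p q assume "p \<in> I \<times> J" "q \<in> I \<times> J"
  then show "A (fst q) (fst p) * B (snd q) (snd p) = cnj (A (fst p) (fst q) * B (snd p) (snd q))"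
    using psd_on_herm[OF assms(2), of "fst p" "fst q"] psd_on_herm[OF assms(3), of "snd p" "snd q"] by auto
next
  fix v :: "'a \<times> 'b \<Rightarrow> complex"
  obtain u where u: "\<forall>i\<in>I. \<forall>j\<in>I. A i j = (\<Sum>k\<in>I. u k i * cnj (u k j))"
    using psd_on_gram[OF assms(1,2)] by blast
  define x where "x = (\<lambda>k b. \<Sum>s\<in>I. cnj (u k s) * v (s, b))"
  have "(\<Sum>p\<in>I\<times>J. \<Sum>q\<in>I\<times>J. cnj (v p) * (A (fst p) (fst q) * B (snd p) (snd q)) * v q)
    = (\<Sum>r\<in>I. \<Sum>a\<in>J. \<Sum>s\<in>I. \<Sum>b\<in>J. \<Sum>k\<in>I. cnj (v (r,a)) * u k r * B a b * (cnj (u k s) * v (s,b)))"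
    by (simp add: sum.cartesian_product' u sum_distrib_left sum_distrib_right mult_ac)
  also have "\<dots> = (\<Sum>r\<in>I. \<Sum>a\<in>J. \<Sum>s\<in>I. \<Sum>k\<in>I. \<Sum>b\<in>J. cnj (v (r,a)) * u k r * B a b * (cnj (u k s) * v (s,b)))"
    by (intro sum.cong refl sum.swap)
  also have "\<dots> = (\<Sum>r\<in>I. \<Sum>a\<in>J. \<Sum>k\<in>I. \<Sum>s\<in>I. \<Sum>b\<in>J. cnj (v (r,a)) * u k r * B a b * (cnj (u k s) * v (s,b)))"
    by (intro sum.cong refl sum.swap)
  also have "\<dots> = (\<Sum>r\<in>I. \<Sum>k\<in>I. \<Sum>a\<in>J. \<Sum>s\<in>I. \<Sum>b\<in>J. cnj (v (r,a)) * u k r * B a b * (cnj (u k s) * v (s,b)))"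
    by (intro sum.cong refl sum.swap)
  also have "\<dots> = (\<Sum>k\<in>I. \<Sum>r\<in>I. \<Sum>a\<in>J. \<Sum>s\<in>I. \<Sum>b\<in>J. cnj (v (r,a)) * u k r * B a b * (cnj (u k s) * v (s,b)))"
    by (rule sum.swap)
  also have "\<dots> = (\<Sum>k\<in>I. \<Sum>a\<in>J. \<Sum>r\<in>I. \<Sum>b\<in>J. \<Sum>s\<in>I. cnj (v (r,a)) * u k r * B a b * (cnj (u k s) * v (s,b)))"
    by (subst sum.swap[of _ I J]) (intro sum.cong refl sum.swap)
  also have "\<dots> = (\<Sum>k\<in>I. \<Sum>a\<in>J. \<Sum>b\<in>J. \<Sum>r\<in>I. \<Sum>s\<in>I. cnj (v (r,a)) * u k r * B a b * (cnj (u k s) * v (s,b)))"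
    by (intro sum.cong refl sum.swap)
  also have "\<dots> = (\<Sum>k\<in>I. \<Sum>a\<in>J. \<Sum>b\<in>J. cnj (x k a) * B a b * x k b)"
    unfolding x_def by (simp add: sum_distrib_left sum_distrib_right mult_ac)
  finally show "0 \<le> Re (\<Sum>p\<in>I\<times>J. \<Sum>q\<in>I\<times>J. cnj (v p) * (A (fst p) (fst q) * B (snd p) (snd q)) * v q)"
    using psd_on_quad[OF assms(3)] by (simp only: Re_sum[of _ I]) (intro sum_nonneg, simp)
qed

lemma psd_on_tensor_op:
  assumes "is_state d \<eta>" "is_state n \<tau>"
  shows "psd_on (idx d n) (tensor_op \<eta> \<tau>)"
proof -
  have "psd_on {..<d} (\<lambda>i j. \<eta> $$ (i,j))" "psd_on {..<n} (\<lambda>i j. \<tau> $$ (i,j))"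
    using assms psd_iff_psd_on unfolding is_state_def by blast+
  from psd_on_tensor[OF finite_lessThan this] show ?thesis by (simp add: tensor_op_def[abs_def])
qed

section \<open>Twirls on the reference tensored with a system X\<close>

locale covariance_setting =
  fixes G :: "('g, 'b) monoid_scheme" and T :: "'g topology" and \<mu> :: "'g measure"
    and d n :: nat and UB UX :: "'g \<Rightarrow> complex mat"
  assumes compact: "compact_group G T" and haar: "haar_prob G T \<mu>"
    and repB: "unitary_rep G T d UB" and repX: "unitary_rep G T n UX"
begin

sublocale unitary_action \<mu> G "idx d n" "tensor_rep UB UX"
  by (rule unitary_action_tensor_rep[OF haar compact repB repX])

lemma unitaryB: "g \<in> carrier G \<Longrightarrow> unitary_mat d (UB g)"
  and unitaryX: "g \<in> carrier G \<Longrightarrow> unitary_mat n (UX g)"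
  using repB repX unfolding unitary_rep_def by auto

lemma rep_carrier:
  assumes "g \<in> carrier G" shows "UB g \<in> carrier_mat d d" "UX g \<in> carrier_mat n n"
  using unitaryB[OF assms] unitaryX[OF assms] unfolding unitary_mat_def by auto

lemma tw_cong:
  assumes "\<And>k l. k \<in> idx d n \<Longrightarrow> l \<in> idx d n \<Longrightarrow> M k l = N k l"
  shows "tw M p q = tw N p q"
proof -
  have "rot g M p q = rot g N p q" for g
    unfolding rot_def by (intro sum.cong refl) (simp add: assms)
  then show ?thesis unfolding tw_def by simp
qed

lemma blk_twirl:
  assumes M: "M \<in> carrier_mat (d * n) (d * n)" and p: "p \<in> idx d n" and q: "q \<in> idx d n"
  shows "blk n (twirl \<mu> (\<lambda>g. kron (conjm (UB g)) (UX g)) M) p q = tw (blk n M) p q"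
proof -
  have "blk n (twirl \<mu> (\<lambda>g. kron (conjm (UB g)) (UX g)) M) p q
    = (LINT g|\<mu>. (kron (conjm (UB g)) (UX g) * M * adj (kron (conjm (UB g)) (UX g))) $$ (enc n p, enc n q))"
    using M enc_less[OF p] enc_less[OF q] by (simp add: blk_def twirl_def)
  also have "\<dots> = (LINT g|\<mu>. rot g (blk n M) p q)"
  proof (rule Bochner_Integration.integral_cong[OF refl])
    fix g assume "g \<in> space \<mu>"
    then have g: "g \<in> carrier G" by (simp add: space_eq)
    have c: "conjm (UB g) \<in> carrier_mat d d" using rep_carrier[OF g] by (simp add: conjm_def)
    have k: "kron (conjm (UB g)) (UX g) \<in> carrier_mat (d * n) (d * n)"
      by (rule kron_carrier[OF c rep_carrier(2)[OF g]])
    have b: "kron (conjm (UB g)) (UX g) $$ (enc n p, enc n q) = tensor_rep UB UX g p q"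
      if "p \<in> idx d n" "q \<in> idx d n" for p q
      using blk_kron[OF c rep_carrier(2)[OF g] that] rep_carrier[OF g] that
      by (auto simp: blk_def tensor_rep_def conjm_def)
    show "(kron (conjm (UB g)) (UX g) * M * adj (kron (conjm (UB g)) (UX g))) $$ (enc n p, enc n q) = rot g (blk n M) p q"
      unfolding conjugation_entry[OF k M enc_less[OF p] enc_less[OF q]] sum_enc rot_def
      by (intro sum.cong refl) (simp add: b p q blk_def)
  qed
  finally show ?thesis by (simp add: tw_def)
qed

lemma H_eta_eq:
  assumes "\<eta> \<in> carrier_mat d d" "\<tau> \<in> carrier_mat n n"
  shows "H_eta \<mu> d UB n UX \<eta> \<tau> = - log 2 (Inf (dominating_traces d n (tw (tensor_op \<eta> \<tau>))))"
proof -
  have k: "kron \<eta> \<tau> \<in> carrier_mat (d * n) (d * n)" by (rule kron_carrier[OF assms])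
  then have t: "twirl \<mu> (\<lambda>g. kron (conjm (UB g)) (UX g)) (kron \<eta> \<tau>) \<in> carrier_mat (d * n) (d * n)"
    by (auto simp: twirl_def)
  have "blk n (twirl \<mu> (\<lambda>g. kron (conjm (UB g)) (UX g)) (kron \<eta> \<tau>)) p q = tw (tensor_op \<eta> \<tau>) p q"
    if "p \<in> idx d n" "q \<in> idx d n" for p q
    unfolding blk_twirl[OF k that] by (rule tw_cong) (simp add: blk_kron[OF assms] tensor_op_def)
  from dominating_traces_cong[OF this] show ?thesis
    unfolding H_eta_def Hmin_eq[OF t] by simp
qed

lemma rot_tensor:
  "rot g (\<lambda>p q. f (fst p) (fst q) * h (snd p) (snd q)) p q =
    (\<Sum>r<d. \<Sum>s<d. cnj (UB g $$ (fst p, r)) * f r s * UB g $$ (fst q, s)) *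
    (\<Sum>a<n. \<Sum>b<n. UX g $$ (snd p, a) * h a b * cnj (UX g $$ (snd q, b)))"
  unfolding rot_def tensor_rep_def by (subst sum_tensor2[symmetric]) (simp add: mult_ac)

text \<open>Keeping the second factor as a conjugated matrix exposes the argument on which
  covariance of a channel acts; the reference factor becomes a scalar.\<close>

lemma rot_tensor_op:
  assumes g: "g \<in> carrier G" and \<tau>: "\<tau> \<in> carrier_mat n n" and "p \<in> idx d n" "q \<in> idx d n"
  shows "rot g (tensor_op \<eta> \<tau>) p q =
    (\<Sum>r<d. \<Sum>s<d. cnj (UB g $$ (fst p, r)) * \<eta> $$ (r, s) * UB g $$ (fst q, s)) *
    (UX g * \<tau> * adj (UX g)) $$ (snd p, snd q)"
  unfolding tensor_op_def[abs_def] rot_tensor[where f="\<lambda>r s. \<eta> $$ (r,s)" and h="\<lambda>r s. \<tau> $$ (r,s)"]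
  using assms by (subst conjugation_entry[OF rep_carrier(2)[OF g] \<tau>]) auto

definition avg :: "(nat \<Rightarrow> nat \<Rightarrow> complex) \<Rightarrow> nat \<Rightarrow> nat \<Rightarrow> complex" where
  "avg y a b = (LINT g|\<mu>. (\<Sum>a'<n. \<Sum>b'<n. UX g $$ (a, a') * y a' b' * cnj (UX g $$ (b, b'))))"

text \<open>Conjugation by a unitary on the reference fixes the identity, so the twirl only averages
  y. Dominating operators thus keep the shape 1 \<otimes> y, and the twirl of 1 \<otimes> \<rho> has
  this shape as well.\<close>

lemma tw_id_tensor:
  assumes "p \<in> idx d n" "q \<in> idx d n"
  shows "tw (id_tensor y) p q = id_tensor (avg y) p q"
proof -
  have e: "id_tensor y = (\<lambda>p q. (if fst p = fst q then 1 else 0) * y (snd p) (snd q))"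
    by (auto simp: id_tensor_def fun_eq_iff)
  have "tw (id_tensor y) p q = (LINT g|\<mu>. (if fst p = fst q then 1 else 0) *
      (\<Sum>a'<n. \<Sum>b'<n. UX g $$ (snd p, a') * y a' b' * cnj (UX g $$ (snd q, b'))))"
    unfolding tw_def
  proof (rule Bochner_Integration.integral_cong[OF refl])
    fix g assume "g \<in> space \<mu>"
    then have g: "g \<in> carrier G" by (simp add: space_eq)
    have "(\<Sum>r<d. \<Sum>s<d. cnj (UB g $$ (fst p, r)) * (if r = s then 1 else 0) * UB g $$ (fst q, s))
      = (\<Sum>r<d. UB g $$ (fst q, r) * cnj (UB g $$ (fst p, r)))"
      using sum_delta_pair(1)[of "\<lambda>r s. UB g $$ (fst q, s) * cnj (UB g $$ (fst p, r))" d] by (simp add: mult_ac)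
    also have "\<dots> = (if fst p = fst q then 1 else 0)"
      using assms by (subst unitary_mat_rows[OF unitaryB[OF g]]) auto
    finally show "rot g (id_tensor y) p q = (if fst p = fst q then 1 else 0) *
      (\<Sum>a'<n. \<Sum>b'<n. UX g $$ (snd p, a') * y a' b' * cnj (UX g $$ (snd q, b')))"
      unfolding e rot_tensor[where f="\<lambda>r s. if r = s then 1 else 0" and h=y] by simp
  qed
  then show ?thesis by (simp add: id_tensor_def avg_def)
qed

text \<open>Read off from the trace of the twirl of 1 \<otimes> y, which carries a factor d to be
  cancelled.\<close>

lemma trace_avg: "0 < d \<Longrightarrow> (\<Sum>a<n. avg y a a) = (\<Sum>a<n. y a a)"
  using tw_trace[of "id_tensor y"] by (simp add: tw_id_tensor trace_id_tensor)

end

section \<open>Channels and their Choi operators\<close>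

lemma blk_ampl:
  assumes "p \<in> idx k m" "q \<in> idx k m"
  shows "blk m (ampl k n m E M) p q
    = E (mat n n (\<lambda>(a,b). blk n M (fst p, a) (fst q, b))) $$ (snd p, snd q)"
  using assms enc_less[of p k m] enc_less[of q k m] enc_div_mod[of p k m] enc_div_mod[of q k m]
  by (simp add: blk_def[of m] ampl_def) (simp add: blk_def enc_def)

lemma ampl_carrier: "ampl k n m E M \<in> carrier_mat (k * m) (k * m)"
  by (simp add: ampl_def)

definition munit :: "nat \<Rightarrow> nat \<Rightarrow> nat \<Rightarrow> complex mat" where
  "munit n a b = mat n n (\<lambda>(i,j). if i = a \<and> j = b then 1 else 0)"

text \<open>Linearity is assumed only on matrices of the right size, so the expansion in matrix
  units is built by inserting the positions of X one at a time; \<open>R S\<close> is X with the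
  entries outside S set to zero.\<close>

lemma channel_entry:
  assumes E: "channel n m E" and X: "X \<in> carrier_mat n n" and s: "s < m" "t < m"
  shows "E X $$ (s,t) = (\<Sum>a<n. \<Sum>b<n. X $$ (a,b) * E (munit n a b) $$ (s,t))"
proof -
  have car: "E Y \<in> carrier_mat m m" if "Y \<in> carrier_mat n n" for Y
    using E that unfolding channel_def by blast
  have add: "E (Y + Z) = E Y + E Z" if "Y \<in> carrier_mat n n" "Z \<in> carrier_mat n n" for Y Z
    using E that unfolding channel_def by blast
  have smult: "E (c \<cdot>\<^sub>m Y) = c \<cdot>\<^sub>m E Y" if "Y \<in> carrier_mat n n" for Y c
    using E that unfolding channel_def by blast
  have un: "munit n a b \<in> carrier_mat n n" for a b by (simp add: munit_def)
  define R where "R = (\<lambda>S. mat n n (\<lambda>ij. if ij \<in> S then X $$ ij else 0))"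
  have Rc: "R S \<in> carrier_mat n n" for S by (simp add: R_def)
  have "E (R S) $$ (s,t) = (\<Sum>(a,b)\<in>S. X $$ (a,b) * E (munit n a b) $$ (s,t))"
    if "finite S" "S \<subseteq> idx n n" for S
    using that
  proof (induction S rule: finite_induct)
    case empty
    \<comment> \<open>The zero matrix goes to zero by homogeneity with the scalar 0.\<close>
    have "R {} = 0 \<cdot>\<^sub>m R {}" by (intro eq_matI) (auto simp: R_def)
    then have "E (R {}) = 0 \<cdot>\<^sub>m E (R {})" using smult[OF Rc] by metis
    then have "E (R {}) $$ (s,t) = (0 \<cdot>\<^sub>m E (R {})) $$ (s,t)" by (rule arg_cong)
    also have "\<dots> = 0" using car[OF Rc, of "{}"] s by auto
    finally show ?case by simp
  next
    case (insert x S)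
    obtain a b where x: "x = (a,b)" "a < n" "b < n" using insert.prems by auto
    have "R (insert x S) = R S + X $$ (a,b) \<cdot>\<^sub>m munit n a b"
      using insert.hyps(2) x by (intro eq_matI) (auto simp: R_def munit_def)
    then have "E (R (insert x S)) = E (R S) + X $$ (a,b) \<cdot>\<^sub>m E (munit n a b)"
      using add[OF Rc smult_carrier_mat[OF un]] smult[OF un] by simp
    moreover have "(E (R S) + X $$ (a,b) \<cdot>\<^sub>m E (munit n a b)) $$ (s,t)
      = E (R S) $$ (s,t) + X $$ (a,b) * E (munit n a b) $$ (s,t)"
      using car[OF Rc, of S] car[OF un, of a b] s by auto
    ultimately show ?case using insert x by simp
  qed
  moreover have "R (idx n n) = X"
    using X by (intro eq_matI) (auto simp: R_def)
  ultimately have "E X $$ (s,t) = (\<Sum>(a,b)\<in>idx n n. X $$ (a,b) * E (munit n a b) $$ (s,t))" by fastforce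
  then show ?thesis by (simp add: sum.cartesian_product)
qed

text \<open>Complete positivity in kernel form: the expression is the entry of (id \<otimes> E)(M)
  once each block of M is expanded in matrix units.\<close>

lemma channel_amplified_psd:
  assumes E: "channel n m E" and M: "psd_on (idx k n) M"
  shows "psd_on (idx k m) (\<lambda>p q. \<Sum>a<n. \<Sum>b<n. M (fst p, a) (fst q, b) * E (munit n a b) $$ (snd p, snd q))"
proof -
  define N where "N = mat (k * n) (k * n) (\<lambda>(i,j). M (i div n, i mod n) (j div n, j mod n))"
  have N: "N \<in> carrier_mat (k * n) (k * n)" by (simp add: N_def)
  have bN: "blk n N p q = M p q" if "p \<in> idx k n" "q \<in> idx k n" for p q
    using enc_less[OF that(1)] enc_less[OF that(2)] enc_div_mod[OF that(1)] enc_div_mod[OF that(2)]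
    by (simp add: blk_def N_def)
  have "psd N" unfolding psd_iff_psd_on_blk[OF N] by (rule iffD2[OF psd_on_cong[OF bN] M])
  then have "psd (ampl k n m E N)" using E N unfolding channel_def by blast
  then have "psd_on (idx k m) (blk m (ampl k n m E N))" by (simp only: psd_iff_psd_on_blk[OF ampl_carrier])
  moreover have "blk m (ampl k n m E N) p q
     = (\<Sum>a<n. \<Sum>b<n. M (fst p, a) (fst q, b) * E (munit n a b) $$ (snd p, snd q))"
    if "p \<in> idx k m" "q \<in> idx k m" for p q
  proof -
    have "blk m (ampl k n m E N) p q
      = (\<Sum>a<n. \<Sum>b<n. mat n n (\<lambda>(a,b). blk n N (fst p, a) (fst q, b)) $$ (a,b) * E (munit n a b) $$ (snd p, snd q))"
      unfolding blk_ampl[OF that] using that by (intro channel_entry[OF E]) auto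
    also have "\<dots> = (\<Sum>a<n. \<Sum>b<n. M (fst p, a) (fst q, b) * E (munit n a b) $$ (snd p, snd q))"
    proof (intro sum.cong refl)
      fix a b assume "a \<in> {..<n}" "b \<in> {..<n}"
      then have "blk n N (fst p, a) (fst q, b) = M (fst p, a) (fst q, b)" using that by (intro bN) auto
      then show "mat n n (\<lambda>(a,b). blk n N (fst p, a) (fst q, b)) $$ (a,b) * E (munit n a b) $$ (snd p, snd q)
        = M (fst p, a) (fst q, b) * E (munit n a b) $$ (snd p, snd q)"
        using \<open>a \<in> {..<n}\<close> \<open>b \<in> {..<n}\<close> by simp
    qed
    finally show ?thesis .
  qed
  ultimately show ?thesis using psd_on_cong by (metis (no_types, lifting))
qed

text \<open>\<open>Z\<close> is the transpose of the Choi matrix, which is what makes the reference transform under the dual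
  representation.\<close>

definition choi_map :: "nat \<Rightarrow> nat \<Rightarrow> (nat \<times> nat \<Rightarrow> nat \<times> nat \<Rightarrow> complex) \<Rightarrow> complex mat \<Rightarrow> complex mat" where
  "choi_map d n Z X = mat d d (\<lambda>(s,r). \<Sum>a<n. \<Sum>b<n. Z (r,a) (s,b) * X $$ (b,a))"

text \<open>Sufficiency in Choi's criterion. A Gram decomposition of M reduces the form of the
  output to a sum of forms of Z at the vectors \<open>x c\<close>, which arise by contracting v with
  the c-th factor over the ancilla index.\<close>

lemma psd_on_choi_amplified:
  assumes Z: "psd_on (idx d n) Z" and M: "psd_on (idx k n) M"
  shows "psd_on (idx k d) (\<lambda>p q. \<Sum>a<n. \<Sum>b<n. Z (snd q, a) (snd p, b) * M (fst p, b) (fst q, a))"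
proof (rule psd_onI)
  fix p q assume pq: "p \<in> idx k d" "q \<in> idx k d"
  have "(\<Sum>a<n. \<Sum>b<n. Z (snd p, a) (snd q, b) * M (fst q, b) (fst p, a))
    = (\<Sum>b<n. \<Sum>a<n. Z (snd p, a) (snd q, b) * M (fst q, b) (fst p, a))"
    by (rule sum.swap)
  also have "\<dots> = cnj (\<Sum>a<n. \<Sum>b<n. Z (snd q, a) (snd p, b) * M (fst p, b) (fst q, a))"
    unfolding cnj_sum
  proof (intro sum.cong refl)
    fix a b assume "a \<in> {..<n}" "b \<in> {..<n}"
    then show "Z (snd p, b) (snd q, a) * M (fst q, a) (fst p, b) = cnj (Z (snd q, a) (snd p, b) * M (fst p, b) (fst q, a))"
      using psd_on_herm[OF Z, of "(snd q, a)" "(snd p, b)"] psd_on_herm[OF M, of "(fst p, b)" "(fst q, a)"] pq by auto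
  qed
  finally show "(\<Sum>a<n. \<Sum>b<n. Z (snd p, a) (snd q, b) * M (fst q, b) (fst p, a))
    = cnj (\<Sum>a<n. \<Sum>b<n. Z (snd q, a) (snd p, b) * M (fst p, b) (fst q, a))" .
next
  fix v :: "nat \<times> nat \<Rightarrow> complex"
  let ?K = "idx k n"
  obtain u where u: "\<forall>i\<in>?K. \<forall>j\<in>?K. M i j = (\<Sum>c\<in>?K. u c i * cnj (u c j))"
    using psd_on_gram[OF _ M] by blast
  define x where "x = (\<lambda>c s b. \<Sum>i<k. cnj (v (i,s)) * u c (i,b))"
  let ?F = "\<lambda>i s j r a b c. (v (j,r) * cnj (u c (j,a))) * Z (r,a) (s,b) * (cnj (v (i,s)) * u c (i,b))"
  have "(\<Sum>p\<in>idx k d. \<Sum>q\<in>idx k d. cnj (v p) * (\<Sum>a<n. \<Sum>b<n. Z (snd q, a) (snd p, b) * M (fst p, b) (fst q, a)) * v q)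
    = (\<Sum>i<k. \<Sum>s<d. \<Sum>j<k. \<Sum>r<d. \<Sum>a<n. \<Sum>b<n. \<Sum>c\<in>?K. ?F i s j r a b c)"
    by (simp add: sum.cartesian_product' u sum_distrib_left sum_distrib_right mult_ac)
  also have "\<dots> = (\<Sum>(i,s,j,r,a,b,c)\<in>{..<k}\<times>{..<d}\<times>{..<k}\<times>{..<d}\<times>{..<n}\<times>{..<n}\<times>?K. ?F i s j r a b c)"
    by (simp only: sum.cartesian_product)
  \<comment> \<open>The Gram index c goes outermost and the ancilla indices j and i innermost, so
    that their sums collapse to \<open>x c\<close> and its conjugate.\<close>
  also have "\<dots> = (\<Sum>(c,r,a,s,b,j,i)\<in>?K\<times>{..<d}\<times>{..<n}\<times>{..<d}\<times>{..<n}\<times>{..<k}\<times>{..<k}. ?F i s j r a b c)"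
    by (rule sum.reindex_bij_witness[where i="\<lambda>(c,r,a,s,b,j,i). (i,s,j,r,a,b,c)" and j="\<lambda>(i,s,j,r,a,b,c). (c,r,a,s,b,j,i)"]) auto
  also have "\<dots> = (\<Sum>c\<in>?K. \<Sum>r<d. \<Sum>a<n. \<Sum>s<d. \<Sum>b<n. \<Sum>j<k. \<Sum>i<k. ?F i s j r a b c)"
    by (simp only: sum.cartesian_product)
  also have "\<dots> = (\<Sum>c\<in>?K. \<Sum>r<d. \<Sum>a<n. \<Sum>s<d. \<Sum>b<n. cnj (x c r a) * Z (r,a) (s,b) * x c s b)"
    unfolding x_def cnj_sum complex_cnj_mult complex_cnj_cnj
    by (simp only: sum_distrib_left[symmetric] sum_distrib_right[symmetric])
  also have "\<dots> = (\<Sum>c\<in>?K. \<Sum>p\<in>idx d n. \<Sum>q\<in>idx d n. cnj (case_prod (x c) p) * Z p q * case_prod (x c) q)"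
    by (simp add: sum.cartesian_product')
  finally show "0 \<le> Re (\<Sum>p\<in>idx k d. \<Sum>q\<in>idx k d.
      cnj (v p) * (\<Sum>a<n. \<Sum>b<n. Z (snd q, a) (snd p, b) * M (fst p, b) (fst q, a)) * v q)"
    using psd_on_quad[OF Z] by (simp only: Re_sum[of _ ?K]) (intro sum_nonneg, simp)
qed

lemma channel_choi_map:
  assumes Z: "psd_on (idx d n) Z"
    and tr: "\<And>a b. a < n \<Longrightarrow> b < n \<Longrightarrow> (\<Sum>r<d. Z (r,a) (r,b)) = (if a = b then 1 else 0)"
  shows "channel n d (choi_map d n Z)"
  unfolding channel_def
proof (intro conjI ballI allI impI)
  show "choi_map d n Z X \<in> carrier_mat d d" for X by (simp add: choi_map_def)
  show "choi_map d n Z (X + Y) = choi_map d n Z X + choi_map d n Z Y"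
    if "X \<in> carrier_mat n n" "Y \<in> carrier_mat n n" for X Y
    using that by (intro eq_matI) (simp_all add: choi_map_def sum.distrib[symmetric] distrib_left)
  show "choi_map d n Z (c \<cdot>\<^sub>m X) = c \<cdot>\<^sub>m choi_map d n Z X" if "X \<in> carrier_mat n n" for X c
    using that by (intro eq_matI) (simp_all add: choi_map_def sum_distrib_left mult_ac)
  show "mtrace (choi_map d n Z X) = mtrace X" if X: "X \<in> carrier_mat n n" for X
  proof -
    have "mtrace (choi_map d n Z X) = (\<Sum>r<d. \<Sum>a<n. \<Sum>b<n. Z (r,a) (r,b) * X $$ (b,a))"
      by (simp add: mtrace_def choi_map_def)
    also have "\<dots> = (\<Sum>a<n. \<Sum>r<d. \<Sum>b<n. Z (r,a) (r,b) * X $$ (b,a))"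
      by (rule sum.swap)
    also have "\<dots> = (\<Sum>a<n. \<Sum>b<n. \<Sum>r<d. Z (r,a) (r,b) * X $$ (b,a))"
      by (intro sum.cong refl sum.swap)
    also have "\<dots> = (\<Sum>a<n. \<Sum>b<n. (if a = b then 1 else 0) * X $$ (b,a))"
      unfolding sum_distrib_right[symmetric] by (intro sum.cong refl) (simp add: tr)
    also have "\<dots> = mtrace X" unfolding sum_delta_pair(1) using X by (simp add: mtrace_def)
    finally show ?thesis .
  qed
  fix k M assume M: "M \<in> carrier_mat (k * n) (k * n)" and "psd M"
  then have "psd_on (idx k n) (blk n M)" by (simp add: psd_iff_psd_on_blk)
  from psd_on_choi_amplified[OF Z this]
  show "psd (ampl k n d (choi_map d n Z) M)"
    unfolding psd_iff_psd_on_blk[OF ampl_carrier]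
    by (rule iffD2[OF psd_on_cong, rotated]) (auto simp: blk_ampl choi_map_def)
qed

text \<open>Conjugation by the adjoint undoes conjugation by the unitary; the entries are arranged
  as they occur when an invariant Z is rotated inside \<open>choi_map\<close>.\<close>

lemma (in covariance_setting) unitary_conjugation_inverse:
  assumes g: "g \<in> carrier G" and X: "X \<in> carrier_mat n n" and kl: "k < n" "l < n"
  shows "(\<Sum>a<n. \<Sum>b<n. UX g $$ (a,k) * cnj (UX g $$ (b,l)) * (UX g * X * adj (UX g)) $$ (b,a)) = X $$ (l,k)"
proof -
  let ?U = "UX g"
  have U: "?U \<in> carrier_mat n n" "adj ?U * ?U = 1\<^sub>m n"
    using unitaryX[OF g] unfolding unitary_mat_def by auto
  have aU: "adj ?U \<in> carrier_mat n n" using U by (simp add: adj_def)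
  have aa: "adj (adj ?U) = ?U" by (intro eq_matI) (auto simp: adj_def)
  let ?Y = "?U * X * adj ?U"
  have Y: "?Y \<in> carrier_mat n n" using U aU X by auto
  have "adj ?U * ?Y * adj (adj ?U) = (adj ?U * ?U) * X * (adj ?U * ?U)"
    unfolding aa using U(1) aU X by (simp add: assoc_mult_mat[of _ n n _ n _ n])
  then have "X $$ (l,k) = (adj ?U * ?Y * adj (adj ?U)) $$ (l,k)" using U X by simp
  also have "\<dots> = (\<Sum>b<n. \<Sum>a<n. adj ?U $$ (l,b) * ?Y $$ (b,a) * cnj (adj ?U $$ (k,a)))"
    by (rule conjugation_entry[OF aU Y kl(2,1)])
  also have "\<dots> = (\<Sum>b<n. \<Sum>a<n. ?U $$ (a,k) * cnj (?U $$ (b,l)) * ?Y $$ (b,a))"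
  proof (intro sum.cong refl)
    fix a b assume "a \<in> {..<n}" "b \<in> {..<n}"
    then have "adj ?U $$ (l,b) = cnj (?U $$ (b,l))" "adj ?U $$ (k,a) = cnj (?U $$ (a,k))"
      using U(1) kl by (auto simp: adj_def)
    then show "adj ?U $$ (l,b) * ?Y $$ (b,a) * cnj (adj ?U $$ (k,a)) = ?U $$ (a,k) * cnj (?U $$ (b,l)) * ?Y $$ (b,a)"
      by (simp only: complex_cnj_cnj mult_ac)
  qed
  also have "\<dots> = (\<Sum>a<n. \<Sum>b<n. ?U $$ (a,k) * cnj (?U $$ (b,l)) * ?Y $$ (b,a))"
    by (rule sum.swap)
  finally show ?thesis ..
qed

text \<open>Z is replaced by its rotation exactly where the argument is the rotated X. The unitaries
  on A then cancel, and those left on R conjugate the output by \<open>UB g\<close>; the complex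
  conjugation in the dual representation puts each of them on the correct side.\<close>

lemma (in covariance_setting) covariant_choi_map:
  assumes inv: "\<And>g p q. g \<in> carrier G \<Longrightarrow> p \<in> idx d n \<Longrightarrow> q \<in> idx d n \<Longrightarrow> rot g Z p q = Z p q"
  shows "covariant G n UX UB (choi_map d n Z)"
  unfolding covariant_def
proof (intro ballI)
  fix g and X :: "complex mat" assume g: "g \<in> carrier G" and X: "X \<in> carrier_mat n n"
  note Bc = rep_carrier(1)[OF g]
  have Ec: "choi_map d n Z X \<in> carrier_mat d d" by (simp add: choi_map_def)
  let ?Y = "UX g * X * adj (UX g)"
  let ?U = "UX g" and ?W = "UB g"
  show "choi_map d n Z ?Y = UB g * choi_map d n Z X * adj (UB g)"
  proof (rule eq_matI)
    fix s r assume "s < dim_row (UB g * choi_map d n Z X * adj (UB g))" "r < dim_col (UB g * choi_map d n Z X * adj (UB g))"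
    then have sr: "s < d" "r < d" using Bc by (auto simp: adj_def)
    have "choi_map d n Z ?Y $$ (s,r) = (\<Sum>a<n. \<Sum>b<n. rot g Z (r,a) (s,b) * ?Y $$ (b,a))"
      using sr g by (simp add: choi_map_def inv)
    also have "\<dots> = (\<Sum>a<n. \<Sum>b<n. \<Sum>k\<in>idx d n. \<Sum>l\<in>idx d n.
       (cnj (?W $$ (r, fst k)) * ?W $$ (s, fst l) * Z k l) * (?U $$ (a, snd k) * cnj (?U $$ (b, snd l)) * ?Y $$ (b,a)))"
      unfolding rot_def tensor_rep_def sum_distrib_right by (simp add: mult_ac)
    also have "\<dots> = (\<Sum>a<n. \<Sum>k\<in>idx d n. \<Sum>b<n. \<Sum>l\<in>idx d n.
       (cnj (?W $$ (r, fst k)) * ?W $$ (s, fst l) * Z k l) * (?U $$ (a, snd k) * cnj (?U $$ (b, snd l)) * ?Y $$ (b,a)))"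
      by (intro sum.cong refl sum.swap)
    also have "\<dots> = (\<Sum>k\<in>idx d n. \<Sum>a<n. \<Sum>l\<in>idx d n. \<Sum>b<n.
       (cnj (?W $$ (r, fst k)) * ?W $$ (s, fst l) * Z k l) * (?U $$ (a, snd k) * cnj (?U $$ (b, snd l)) * ?Y $$ (b,a)))"
      by (subst sum.swap) (intro sum.cong refl sum.swap)
    also have "\<dots> = (\<Sum>k\<in>idx d n. \<Sum>l\<in>idx d n. \<Sum>a<n. \<Sum>b<n.
       (cnj (?W $$ (r, fst k)) * ?W $$ (s, fst l) * Z k l) * (?U $$ (a, snd k) * cnj (?U $$ (b, snd l)) * ?Y $$ (b,a)))"
      by (intro sum.cong refl sum.swap)
    also have "\<dots> = (\<Sum>k\<in>idx d n. \<Sum>l\<in>idx d n. (cnj (?W $$ (r, fst k)) * ?W $$ (s, fst l) * Z k l) * X $$ (snd l, snd k))"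
      unfolding sum_distrib_left[symmetric]
      by (intro sum.cong refl) (auto simp: unitary_conjugation_inverse[OF g X])
    also have "\<dots> = (\<Sum>k1<d. \<Sum>a<n. \<Sum>l1<d. \<Sum>b<n. ?W $$ (s,l1) * (Z (k1,a) (l1,b) * X $$ (b,a)) * cnj (?W $$ (r,k1)))"
      by (simp add: sum.cartesian_product' mult_ac)
    also have "\<dots> = (\<Sum>k1<d. \<Sum>l1<d. \<Sum>a<n. \<Sum>b<n. ?W $$ (s,l1) * (Z (k1,a) (l1,b) * X $$ (b,a)) * cnj (?W $$ (r,k1)))"
      by (intro sum.cong refl sum.swap)
    also have "\<dots> = (\<Sum>l1<d. \<Sum>k1<d. \<Sum>a<n. \<Sum>b<n. ?W $$ (s,l1) * (Z (k1,a) (l1,b) * X $$ (b,a)) * cnj (?W $$ (r,k1)))"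
      by (rule sum.swap)
    also have "\<dots> = (\<Sum>l1<d. \<Sum>k1<d. ?W $$ (s,l1) * choi_map d n Z X $$ (l1,k1) * cnj (?W $$ (r,k1)))"
      by (intro sum.cong refl) (simp add: choi_map_def sum_distrib_left sum_distrib_right)
    also have "\<dots> = (UB g * choi_map d n Z X * adj (UB g)) $$ (s,r)"
      by (rule conjugation_entry[OF Bc Ec sr, symmetric])
    finally show "choi_map d n Z ?Y $$ (s,r) = (UB g * choi_map d n Z X * adj (UB g)) $$ (s,r)" .
  qed (use Bc in \<open>auto simp: choi_map_def adj_def\<close>)
qed

section \<open>The relative boundary of a set of states\<close>

lemma adj_eq_entry:
  assumes "adj X = X" "X \<in> carrier_mat n n" "i < n" "j < n"
  shows "X $$ (j,i) = cnj (X $$ (i,j))"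
proof -
  have "X $$ (j,i) = adj X $$ (j,i)" by (simp only: assms(1))
  also have "\<dots> = cnj (X $$ (i,j))" using assms(2-4) by (simp add: adj_def)
  finally show ?thesis .
qed

lemma adj_eqI:
  assumes "X \<in> carrier_mat n n" "\<And>i j. i < n \<Longrightarrow> j < n \<Longrightarrow> X $$ (j,i) = cnj (X $$ (i,j))"
  shows "adj X = X"
proof (rule eq_matI)
  fix i j assume "i < dim_row X" "j < dim_col X"
  then show "adj X $$ (i,j) = X $$ (i,j)"
    using assms(1) assms(2)[of j i] by (simp add: adj_def)
qed (use assms(1) in \<open>auto simp: adj_def\<close>)

lemma hs_dist_entry_le:
  assumes "X \<in> carrier_mat n n" "i < n" "j < n"
  shows "cmod (X $$ (i,j) - Y $$ (i,j)) \<le> hs_dist X Y"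
proof -
  have "(cmod (X $$ (i,j) - Y $$ (i,j)))\<^sup>2 \<le> (\<Sum>j<n. (cmod (X $$ (i,j) - Y $$ (i,j)))\<^sup>2)"
    using assms by (intro member_le_sum[of j "{..<n}" "\<lambda>j. (cmod (X $$ (i,j) - Y $$ (i,j)))\<^sup>2"]) auto
  also have "\<dots> \<le> (\<Sum>i<n. \<Sum>j<n. (cmod (X $$ (i,j) - Y $$ (i,j)))\<^sup>2)"
    using assms by (intro member_le_sum[of i "{..<n}" "\<lambda>i. \<Sum>j<n. (cmod (X $$ (i,j) - Y $$ (i,j)))\<^sup>2"])
      (auto intro: sum_nonneg)
  finally show ?thesis
    using assms unfolding hs_dist_def by (intro real_le_rsqrt) auto
qed

text \<open>A boundary point of D may lie outside D, but it is a limit of states; positivity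
  survives the limit because each value of the form depends continuously on the entries.\<close>

lemma herm1_state_closure:
  assumes X: "X \<in> herm1 n" and cl: "\<And>e. 0 < e \<Longrightarrow> \<exists>Y. is_state n Y \<and> hs_dist X Y < e"
  shows "is_state n X"
proof -
  have Xc: "X \<in> carrier_mat n n" and Xa: "adj X = X" and Xt: "mtrace X = 1"
    using X unfolding herm1_def by auto
  have "psd_on {..<n} (\<lambda>i j. X $$ (i,j))"
  proof (rule psd_onI)
    fix i j assume "i \<in> {..<n}" "j \<in> {..<n}"
    then show "X $$ (j,i) = cnj (X $$ (i,j))" by (intro adj_eq_entry[OF Xa Xc]) auto
  next
    fix v :: "nat \<Rightarrow> complex"
    define c where "c = (\<Sum>i<n. \<Sum>j<n. cmod (v i) * cmod (v j))"
    have c0: "0 \<le> c" unfolding c_def by (intro sum_nonneg) auto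
    let ?q = "\<lambda>X. \<Sum>i<n. \<Sum>j<n. cnj (v i) * X $$ (i,j) * v j"
    show "0 \<le> Re (?q X)"
    proof (rule ccontr)
      assume neg: "\<not> 0 \<le> Re (?q X)"
      \<comment> \<open>c bounds the change of the form at v per unit of distance, so a state within
        distance e would still have a negative value. The 1 in the denominator covers c = 0 and
        makes the estimate strict.\<close>
      define e where "e = - Re (?q X) / (c + 1)"
      have e: "0 < e" using neg c0 by (simp add: e_def divide_neg_pos)
      obtain Y where Y: "is_state n Y" "hs_dist X Y < e" using cl[OF e] by blast
      have "psd_on {..<n} (\<lambda>i j. Y $$ (i,j))"
        using Y(1) psd_iff_psd_on unfolding is_state_def by blast
      then have Y0: "0 \<le> Re (?q Y)" by (rule psd_on_quad)
      have "Re (?q Y) - Re (?q X) \<le> cmod (?q Y - ?q X)"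
        using complex_Re_le_cmod[of "?q Y - ?q X"] by simp
      also have "?q Y - ?q X = (\<Sum>i<n. \<Sum>j<n. cnj (v i) * (Y $$ (i,j) - X $$ (i,j)) * v j)"
        by (simp only: right_diff_distrib left_diff_distrib sum_subtractf)
      also have "cmod \<dots> \<le> (\<Sum>i<n. \<Sum>j<n. e * (cmod (v i) * cmod (v j)))"
      proof (intro sum_norm_le)
        fix i j assume ij: "i \<in> {..<n}" "j \<in> {..<n}"
        have "cmod (Y $$ (i,j) - X $$ (i,j)) \<le> e"
          using hs_dist_entry_le[OF Xc, of i j Y] ij Y(2) by (simp add: norm_minus_commute)
        then have "cmod (Y $$ (i,j) - X $$ (i,j)) * (cmod (v i) * cmod (v j)) \<le> e * (cmod (v i) * cmod (v j))"
          by (rule mult_right_mono) simp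
        then show "cmod (cnj (v i) * (Y $$ (i,j) - X $$ (i,j)) * v j) \<le> e * (cmod (v i) * cmod (v j))"
          by (simp add: norm_mult mult_ac)
      qed
      also have "\<dots> = e * c" by (simp add: c_def sum_distrib_left)
      also have "\<dots> < e * (c + 1)" using e by simp
      also have "\<dots> = - Re (?q X)" using c0 by (simp add: e_def)
      finally show False using Y0 by simp
    qed
  qed
  then show ?thesis unfolding is_state_def using Xc Xt psd_iff_psd_on by blast
qed

lemma rel_bdry_states:
  assumes "D \<subseteq> {\<eta>. is_state n \<eta>}" "X \<in> rel_bdry n D"
  shows "is_state n X"
proof (rule herm1_state_closure)
  show "X \<in> herm1 n" using assms(2) unfolding rel_bdry_def by blast
  fix e :: real assume "0 < e"
  then show "\<exists>Y. is_state n Y \<and> hs_dist X Y < e" using assms unfolding rel_bdry_def by blast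
qed

lemma state_entry_le:
  assumes "is_state n X" "i < n" "j < n"
  shows "cmod (X $$ (i,j)) \<le> 1"
proof -
  have Xc: "X \<in> carrier_mat n n" and p: "psd_on {..<n} (\<lambda>i j. X $$ (i,j))"
    using assms psd_iff_psd_on unfolding is_state_def by blast+
  have "cmod (X $$ (i,j)) \<le> (\<Sum>k<n. Re (X $$ (k,k)))"
    using psd_on_entry_bound[OF p] assms by simp
  also have "\<dots> = Re (mtrace X)" using Xc by (simp add: mtrace_def)
  finally show ?thesis using assms unfolding is_state_def by simp
qed

text \<open>The boundary point is the last exit, the supremum of the parameters at which the ray is
  in D. D may be neither convex nor closed, but it is met arbitrarily close to the supremum and
  never beyond. The supremum is finite because entries of states have modulus at most 1 while X has
  a nonzero entry, and positive because a ball around the maximally mixed state lies in D.\<close>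

lemma exists_rel_bdry_on_ray:
  assumes D: "D \<subseteq> {\<eta>. is_state n \<eta>}" and mm: "max_mixed n \<in> rel_int n D"
    and X: "X \<in> carrier_mat n n" "adj X = X" "mtrace X = 0"
    and nz: "i0 < n" "j0 < n" "X $$ (i0,j0) \<noteq> 0"
  shows "\<exists>t>0. max_mixed n + complex_of_real t \<cdot>\<^sub>m X \<in> rel_bdry n D"
proof -
  define f where "f = (\<lambda>t. max_mixed n + complex_of_real t \<cdot>\<^sub>m X)"
  have mc: "max_mixed n \<in> carrier_mat n n" by (simp add: max_mixed_def)
  have fc: "f t \<in> carrier_mat n n" for t using X(1) mc by (simp add: f_def)
  have fe: "f t $$ (i,j) = max_mixed n $$ (i,j) + of_real t * X $$ (i,j)" if "i < n" "j < n" for t i j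
    using that X(1) mc by (simp add: f_def)
  have mh: "max_mixed n \<in> herm1 n" using mm unfolding rel_int_def by blast
  have fh: "f t \<in> herm1 n" for t
  proof -
    have "adj (f t) = f t"
    proof (rule adj_eqI[OF fc])
      fix i j assume ij: "i < n" "j < n"
      have "max_mixed n $$ (j,i) = cnj (max_mixed n $$ (i,j))"
        using mh ij by (intro adj_eq_entry) (auto simp: herm1_def)
      then show "f t $$ (j,i) = cnj (f t $$ (i,j))"
        using ij adj_eq_entry[OF X(2,1) ij] by (simp add: fe)
    qed
    moreover have "mtrace (f t) = mtrace (max_mixed n) + of_real t * mtrace X"
      using fc[of t] mc X(1) by (simp add: mtrace_def fe sum.distrib sum_distrib_left)
    ultimately show ?thesis using fc X(3) mh unfolding herm1_def by simp
  qed
  \<comment> \<open>The ray has constant Hilbert-Schmidt speed N, so distances along it are N times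
    differences of parameters.\<close>
  define N where "N = sqrt (\<Sum>i<n. \<Sum>j<n. (cmod (X $$ (i,j)))\<^sup>2)"
  have dist: "hs_dist (f s) (f t) = \<bar>s - t\<bar> * N" for s t
  proof -
    have "(\<Sum>i<n. \<Sum>j<n. (cmod (f s $$ (i,j) - f t $$ (i,j)))\<^sup>2)
      = (\<Sum>i<n. \<Sum>j<n. (s - t)\<^sup>2 * (cmod (X $$ (i,j)))\<^sup>2)"
    proof (intro sum.cong refl)
      fix i j assume "i \<in> {..<n}" "j \<in> {..<n}"
      then have "f s $$ (i,j) - f t $$ (i,j) = of_real (s - t) * X $$ (i,j)"
        by (simp add: fe algebra_simps)
      then show "(cmod (f s $$ (i,j) - f t $$ (i,j)))\<^sup>2 = (s - t)\<^sup>2 * (cmod (X $$ (i,j)))\<^sup>2"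
        by (simp only: norm_mult norm_of_real power_mult_distrib power2_abs)
    qed
    then show ?thesis
      using fc[of s] unfolding hs_dist_def N_def
      by (simp add: sum_distrib_left[symmetric] real_sqrt_mult)
  qed
  have "(cmod (X $$ (i0,j0)))\<^sup>2 \<le> (\<Sum>i<n. \<Sum>j<n. (cmod (X $$ (i,j)))\<^sup>2)"
  proof -
    have "(cmod (X $$ (i0,j0)))\<^sup>2 \<le> (\<Sum>j<n. (cmod (X $$ (i0,j)))\<^sup>2)"
      using nz by (intro member_le_sum) auto
    also have "\<dots> \<le> (\<Sum>i<n. \<Sum>j<n. (cmod (X $$ (i,j)))\<^sup>2)"
      using nz by (intro member_le_sum[of i0 "{..<n}" "\<lambda>i. \<Sum>j<n. (cmod (X $$ (i,j)))\<^sup>2"]) (auto intro: sum_nonneg)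
    finally show ?thesis .
  qed
  then have N: "0 < N"
    using nz unfolding N_def by (intro real_sqrt_gt_zero) (auto intro: less_le_trans[rotated])
  define S where "S = {t. 0 \<le> t \<and> f t \<in> D}"
  have f0: "f 0 = max_mixed n" using mc X(1) by (intro eq_matI) (auto simp: f_def)
  obtain e where e: "0 < e" "\<And>Y. Y \<in> herm1 n \<Longrightarrow> hs_dist (max_mixed n) Y < e \<Longrightarrow> Y \<in> D"
    using mm unfolding rel_int_def by blast
  have near: "f t \<in> D" if "\<bar>t\<bar> * N < e" for t
    using e(2)[OF fh, of t] dist[of 0 t] that by (simp add: f0)
  have S1: "e / (2 * N) \<in> S"
    using near[of "e / (2 * N)"] e(1) N by (simp add: S_def field_simps)
  have bdd: "bdd_above S"
  proof (rule bdd_aboveI)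
    fix t assume "t \<in> S"
    then have t: "0 \<le> t" "is_state n (f t)" using D by (auto simp: S_def)
    have "is_state n (f 0)" using near[of 0] e(1) D by auto
    then have "cmod (f t $$ (i0,j0) - f 0 $$ (i0,j0)) \<le> 1 + 1"
      using state_entry_le[OF t(2) nz(1,2)] state_entry_le[of n "f 0", OF _ nz(1,2)]
      by (intro order_trans[OF norm_triangle_ineq4] add_mono)
    then have "t * cmod (X $$ (i0,j0)) \<le> 2"
      using t(1) nz by (simp add: fe norm_mult)
    then show "t \<le> 2 / cmod (X $$ (i0,j0))" using nz by (simp add: field_simps)
  qed
  define u where "u = Sup S"
  have u0: "0 < u"
  proof -
    have "0 < e / (2 * N)" using e(1) N by simp
    also have "\<dots> \<le> u" unfolding u_def by (rule cSup_upper[OF S1 bdd])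
    finally show ?thesis .
  qed
  have "f u \<in> rel_bdry n D"
    unfolding rel_bdry_def
  proof (intro CollectI conjI fh allI impI)
    fix r :: real assume r: "0 < r"
    define \<delta> where "\<delta> = r / (2 * N)"
    have \<delta>: "0 < \<delta>" "\<delta> * N < r" using r N by (auto simp: \<delta>_def)
    have "u - \<delta> < Sup S" using \<delta> by (simp add: u_def)
    then obtain s where s: "s \<in> S" "u - \<delta> < s"
      using less_cSup_iff[OF _ bdd] S1 by blast
    have "s \<le> u" unfolding u_def by (rule cSup_upper[OF s(1) bdd])
    then have "\<bar>u - s\<bar> * N \<le> \<delta> * N" using s(2) N by (intro mult_right_mono) auto
    then have "hs_dist (f u) (f s) < r" using \<delta> by (simp add: dist)
    then show "\<exists>Y\<in>herm1 n \<inter> D. hs_dist (f u) Y < r" using fh s(1) unfolding S_def by blast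
    have "u + \<delta> \<notin> S" using cSup_upper[OF _ bdd, of "u + \<delta>"] \<delta>(1) by (auto simp: u_def)
    \<comment> \<open>The parameter is nonnegative, so only membership in D can have failed.\<close>
    then have "f (u + \<delta>) \<notin> D" using u0 \<delta>(1) by (auto simp: S_def)
    moreover have "hs_dist (f u) (f (u + \<delta>)) < r" using \<delta> by (simp add: dist)
    ultimately show "\<exists>Y\<in>herm1 n - D. hs_dist (f u) Y < r" using fh by blast
  qed
  then show ?thesis using u0 unfolding f_def by blast
qed

section \<open>Covariant channels versus separating functionals\<close>

text \<open>The two interpretations share the group and the reference representation and differ in
  the second system: the input A and the output B.\<close>

locale channel_setting =
  A: covariance_setting G T \<mu> d n UB UA + B: covariance_setting G T \<mu> d d UB UB
  for G :: "('g, 'b) monoid_scheme" and T :: "'g topology" and \<mu> :: "'g measure"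
    and d n :: nat and UA UB :: "'g \<Rightarrow> complex mat"
begin

text \<open>The right-hand side is id \<otimes> E applied to the twirl of \<eta> \<otimes> \<rho>,
  expanded in matrix units. Finite sums pass through the integral, and for each g covariance turns E
  of the rotated \<rho> into the rotated \<sigma>.\<close>

lemma covariant_channel_tw:
  assumes E: "channel n d E" and cov: "covariant G n UA UB E" and E\<rho>: "E \<rho> = \<sigma>"
    and \<rho>: "\<rho> \<in> carrier_mat n n" and \<sigma>: "\<sigma> \<in> carrier_mat d d"
    and p: "p \<in> idx d d" and q: "q \<in> idx d d"
  shows "B.tw (tensor_op \<eta> \<sigma>) p q
    = (\<Sum>a<n. \<Sum>b<n. A.tw (tensor_op \<eta> \<rho>) (fst p, a) (fst q, b) * E (munit n a b) $$ (snd p, snd q))"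
proof -
  let ?J = "\<lambda>a b. E (munit n a b) $$ (snd p, snd q)"
  have pq: "fst p < d" "snd p < d" "fst q < d" "snd q < d" using p q by auto
  have int: "integrable \<mu> (\<lambda>g. A.rot g (tensor_op \<eta> \<rho>) (fst p, a) (fst q, b))" if "a < n" "b < n" for a b
    using that pq by (intro A.integrable_bdd_meas A.rot_bdd_meas) auto
  let ?F = "\<lambda>a b g. A.rot g (tensor_op \<eta> \<rho>) (fst p, a) (fst q, b) * ?J a b"
  have int': "integrable \<mu> (?F a b)" if "a \<in> {..<n}" "b \<in> {..<n}" for a b
    using int that by (intro integrable_mult_left) auto
  have "(\<Sum>a<n. \<Sum>b<n. A.tw (tensor_op \<eta> \<rho>) (fst p, a) (fst q, b) * ?J a b)
    = (\<Sum>a<n. \<Sum>b<n. LINT g|\<mu>. ?F a b g)"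
    by (simp add: A.tw_def)
  also have "\<dots> = (\<Sum>a<n. LINT g|\<mu>. (\<Sum>b<n. ?F a b g))"
    by (intro sum.cong refl Bochner_Integration.integral_sum[symmetric] int')
  also have "\<dots> = (LINT g|\<mu>. (\<Sum>a<n. \<Sum>b<n. ?F a b g))"
    by (intro Bochner_Integration.integral_sum[symmetric] Bochner_Integration.integrable_sum int')
  also have "\<dots> = (LINT g|\<mu>. B.rot g (tensor_op \<eta> \<sigma>) p q)"
  proof (rule Bochner_Integration.integral_cong[OF refl])
    fix g assume "g \<in> space \<mu>"
    then have g: "g \<in> carrier G" by (simp add: A.space_eq)
    let ?c = "\<Sum>r<d. \<Sum>s<d. cnj (UB g $$ (fst p, r)) * \<eta> $$ (r, s) * UB g $$ (fst q, s)"
    let ?R = "UA g * \<rho> * adj (UA g)"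
    have R: "?R \<in> carrier_mat n n" using A.rep_carrier(2)[OF g] \<rho> by (auto simp: adj_def)
    have "(\<Sum>a<n. \<Sum>b<n. A.rot g (tensor_op \<eta> \<rho>) (fst p, a) (fst q, b) * ?J a b)
      = (\<Sum>a<n. \<Sum>b<n. ?c * (?R $$ (a,b) * ?J a b))"
    proof (intro sum.cong refl)
      fix a b assume "a \<in> {..<n}" "b \<in> {..<n}"
      then have "A.rot g (tensor_op \<eta> \<rho>) (fst p, a) (fst q, b) = ?c * ?R $$ (a,b)"
        using pq by (subst A.rot_tensor_op[OF g \<rho>]) auto
      then show "A.rot g (tensor_op \<eta> \<rho>) (fst p, a) (fst q, b) * ?J a b = ?c * (?R $$ (a,b) * ?J a b)"
        by simp
    qed
    also have "\<dots> = ?c * E ?R $$ (snd p, snd q)"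
      unfolding sum_distrib_left[symmetric] channel_entry[OF E R pq(2,4)] ..
    also have "E ?R = UB g * \<sigma> * adj (UB g)"
      using cov g \<rho> E\<rho> unfolding covariant_def by blast
    also have "?c * (UB g * \<sigma> * adj (UB g)) $$ (snd p, snd q) = B.rot g (tensor_op \<eta> \<sigma>) p q"
      by (rule B.rot_tensor_op[OF g \<sigma> p q, symmetric])
    finally show "(\<Sum>a<n. \<Sum>b<n. A.rot g (tensor_op \<eta> \<rho>) (fst p, a) (fst q, b) * ?J a b) = B.rot g (tensor_op \<eta> \<sigma>) p q" .
  qed
  finally show ?thesis by (simp add: B.tw_def)
qed

lemma covariant_channel_dominating_traces:
  assumes E: "channel n d E" and cov: "covariant G n UA UB E" and E\<rho>: "E \<rho> = \<sigma>"
    and \<eta>: "is_state d \<eta>" and \<rho>: "is_state n \<rho>" and \<sigma>: "is_state d \<sigma>" and d: "0 < d"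
  shows "dominating_traces d n (A.tw (tensor_op \<eta> \<rho>)) \<subseteq> dominating_traces d d (B.tw (tensor_op \<eta> \<sigma>))"
proof
  have c: "\<rho> \<in> carrier_mat n n" "\<sigma> \<in> carrier_mat d d" using \<rho> \<sigma> unfolding is_state_def by auto
  fix t assume "t \<in> dominating_traces d n (A.tw (tensor_op \<eta> \<rho>))"
  then obtain y where y: "psd_on (idx d n) (\<lambda>p q. id_tensor y p q - A.tw (tensor_op \<eta> \<rho>) p q)" "t = Re (\<Sum>a<n. y a a)"
    unfolding dominating_traces_def by blast
  \<comment> \<open>This is E applied to y, expanded in matrix units; trace preservation keeps the
    value t.\<close>
  define y' where "y' = (\<lambda>s r. \<Sum>a<n. \<Sum>b<n. y a b * E (munit n a b) $$ (s, r))"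
  have "psd_on (idx d d) (\<lambda>p q. id_tensor y' p q - B.tw (tensor_op \<eta> \<sigma>) p q)"
  proof (rule iffD1[OF psd_on_cong channel_amplified_psd[OF E y(1)]])
    fix p q assume pq: "p \<in> idx d d" "q \<in> idx d d"
    show "(\<Sum>a<n. \<Sum>b<n. (id_tensor y (fst p, a) (fst q, b) - A.tw (tensor_op \<eta> \<rho>) (fst p, a) (fst q, b))
        * E (munit n a b) $$ (snd p, snd q)) = id_tensor y' p q - B.tw (tensor_op \<eta> \<sigma>) p q"
      unfolding covariant_channel_tw[OF E cov E\<rho> c pq] left_diff_distrib sum_subtractf
      by (auto simp: id_tensor_def y'_def)
  qed
  moreover have "psd_on (idx d d) (B.tw (tensor_op \<eta> \<sigma>))"
    by (rule B.tw_psd[OF psd_on_tensor_op[OF \<eta> \<sigma>]])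
  ultimately have "Re (\<Sum>a<d. y' a a) \<in> dominating_traces d d (B.tw (tensor_op \<eta> \<sigma>))"
    using dominating_tracesI d by blast
  moreover have "(\<Sum>a<d. y' a a) = (\<Sum>a<n. y a a)"
  proof -
    define Y where "Y = mat n n (\<lambda>(a,b). y a b)"
    have Y: "Y \<in> carrier_mat n n" by (simp add: Y_def)
    have EY: "E Y \<in> carrier_mat d d" "mtrace (E Y) = mtrace Y" using E Y unfolding channel_def by blast+
    have "y' s s = E Y $$ (s,s)" if "s < d" for s
      unfolding channel_entry[OF E Y that that] y'_def by (simp add: Y_def)
    then show ?thesis using EY by (simp add: mtrace_def Y_def)
  qed
  ultimately show "t \<in> dominating_traces d d (B.tw (tensor_op \<eta> \<sigma>))" using y(2) by simp
qed

text \<open>Testing against the vector \<open>\<Sum>r. |r r\<rangle>\<close>, which is fixed by every \<open>cnj (UB g) \<otimes> UB g\<close>.\<close>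

lemma dominating_traces_overlap_le:
  assumes "t \<in> dominating_traces d d (B.tw (tensor_op \<eta> \<sigma>))"
  shows "Re (\<Sum>r<d. \<Sum>s<d. \<eta> $$ (r,s) * \<sigma> $$ (r,s)) \<le> t"
proof -
  \<comment> \<open>The vector stays unnormalised: the form of 1 \<otimes> y at it is then exactly
    tr y, and that of \<eta> \<otimes> \<sigma> is the trace of the transpose of \<eta> times
    \<sigma>.\<close>
  let ?\<phi> = "\<lambda>p::nat\<times>nat. if fst p = snd p then 1 else (0::complex)"
  obtain y where y: "psd_on (idx d d) (\<lambda>p q. id_tensor y p q - B.tw (tensor_op \<eta> \<sigma>) p q)" "t = Re (\<Sum>a<d. y a a)"
    using assms unfolding dominating_traces_def by blast
  have quad: "(\<Sum>p\<in>idx d d. \<Sum>q\<in>idx d d. cnj (?\<phi> p) * M p q * ?\<phi> q) = (\<Sum>r<d. \<Sum>s<d. M (r,r) (s,s))" for M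
  proof -
    have "(\<Sum>p\<in>idx d d. \<Sum>q\<in>idx d d. cnj (?\<phi> p) * M p q * ?\<phi> q)
      = (\<Sum>r<d. \<Sum>a<d. \<Sum>s<d. \<Sum>b<d. if a = r then (if b = s then M (r,a) (s,b) else 0) else 0)"
      unfolding sum.cartesian_product' by (intro sum.cong refl) auto
    also have "\<dots> = (\<Sum>r<d. \<Sum>a<d. if a = r then (\<Sum>s<d. \<Sum>b<d. if b = s then M (r,a) (s,b) else 0) else 0)"
      by (intro sum.cong refl) auto
    finally show ?thesis by simp
  qed
  \<comment> \<open>The two representation matrices contract over a common row index, and
    orthonormality of the columns of \<open>UB g\<close> returns the Kronecker delta.\<close>
  have orb: "B.orb ?\<phi> g k = ?\<phi> k" if g: "g \<in> carrier G" and k: "k \<in> idx d d" for g k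
  proof -
    have "B.orb ?\<phi> g k = (\<Sum>r<d. \<Sum>a<d. if a = r then UB g $$ (r, fst k) * cnj (UB g $$ (a, snd k)) else 0)"
      unfolding B.orb_def sum.cartesian_product' tensor_rep_def by (intro sum.cong refl) auto
    also have "\<dots> = (\<Sum>r<d. UB g $$ (r, fst k) * cnj (UB g $$ (r, snd k)))" by simp
    also have "\<dots> = ?\<phi> k" using k by (subst unitary_mat_cols[OF B.unitaryB[OF g]]) auto
    finally show ?thesis .
  qed
  have "(\<Sum>p\<in>idx d d. \<Sum>q\<in>idx d d. cnj (?\<phi> p) * B.tw (tensor_op \<eta> \<sigma>) p q * ?\<phi> q)
    = (LINT g|\<mu>. (\<Sum>k\<in>idx d d. \<Sum>l\<in>idx d d. cnj (?\<phi> k) * tensor_op \<eta> \<sigma> k l * ?\<phi> l))"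
    unfolding B.tw_quad
    by (rule Bochner_Integration.integral_cong[OF refl], intro sum.cong refl) (simp only: orb B.space_eq)
  also have "\<dots> = (\<Sum>r<d. \<Sum>s<d. \<eta> $$ (r,s) * \<sigma> $$ (r,s))"
    unfolding quad by (simp add: tensor_op_def A.prob_space)
  finally have tw: "(\<Sum>p\<in>idx d d. \<Sum>q\<in>idx d d. cnj (?\<phi> p) * B.tw (tensor_op \<eta> \<sigma>) p q * ?\<phi> q)
    = (\<Sum>r<d. \<Sum>s<d. \<eta> $$ (r,s) * \<sigma> $$ (r,s))" .
  have id: "(\<Sum>p\<in>idx d d. \<Sum>q\<in>idx d d. cnj (?\<phi> p) * id_tensor y p q * ?\<phi> q) = (\<Sum>a<d. y a a)"
    unfolding quad by (simp add: id_tensor_def)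
  have "0 \<le> Re (\<Sum>p\<in>idx d d. \<Sum>q\<in>idx d d. cnj (?\<phi> p) * (id_tensor y p q - B.tw (tensor_op \<eta> \<sigma>) p q) * ?\<phi> q)"
    by (rule psd_on_quad[OF y(1)])
  also have "(\<Sum>p\<in>idx d d. \<Sum>q\<in>idx d d. cnj (?\<phi> p) * (id_tensor y p q - B.tw (tensor_op \<eta> \<sigma>) p q) * ?\<phi> q)
    = (\<Sum>a<d. y a a) - (\<Sum>r<d. \<Sum>s<d. \<eta> $$ (r,s) * \<sigma> $$ (r,s))"
    unfolding tw[symmetric] id[symmetric] by (simp only: right_diff_distrib left_diff_distrib sum_subtractf)
  finally show ?thesis using y(2) by simp
qed

section \<open>Invariant positive kernels and the least squares problem\<close>

definition invariant_cone :: "(nat \<times> nat \<Rightarrow> nat \<times> nat \<Rightarrow> complex) set" where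
  "invariant_cone = {z. psd_on (idx d n) z \<and>
     (\<forall>g\<in>carrier G. \<forall>p\<in>idx d n. \<forall>q\<in>idx d n. A.rot g z p q = z p q)}"

lemma closed_invariant_cone: "closed invariant_cone"
proof -
  have "invariant_cone = {z. psd_on (idx d n) z} \<inter>
     (\<Inter>g\<in>carrier G. \<Inter>p\<in>idx d n. \<Inter>q\<in>idx d n. {z. A.rot g z p q = z p q})"
    unfolding invariant_cone_def by blast
  also have "closed \<dots>"
    unfolding A.rot_def
    by (intro closed_Int closed_psd_on closed_INT ballI closed_Collect_eq continuous_intros)
  finally show ?thesis .
qed

lemma invariant_cone_combination:
  assumes "z \<in> invariant_cone" "w \<in> invariant_cone" "0 \<le> s" "0 \<le> t"
  shows "(\<lambda>p q. of_real s * z p q + of_real t * w p q) \<in> invariant_cone"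
proof -
  have "A.rot g (\<lambda>p q. of_real s * z p q + of_real t * w p q) p q = of_real s * A.rot g z p q + of_real t * A.rot g w p q" for g p q
    unfolding A.rot_def by (simp add: sum_distrib_left sum.distrib distrib_left distrib_right mult_ac)
  then show ?thesis using assms psd_on_add_scaled unfolding invariant_cone_def by auto
qed

text \<open>Entries outside the index set are free, which lets \<open>coercive_minimum\<close>
  replace a kernel by its truncation.\<close>

lemma invariant_cone_local:
  assumes "z \<in> invariant_cone" "\<And>p q. p \<in> idx d n \<Longrightarrow> q \<in> idx d n \<Longrightarrow> w p q = z p q"
  shows "w \<in> invariant_cone"
proof -
  have "psd_on (idx d n) w" using assms psd_on_cong[of "idx d n" w z] unfolding invariant_cone_def by blast
  moreover have "A.rot g w p q = A.rot g z p q" for g p q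
    unfolding A.rot_def by (intro sum.cong refl) (simp add: assms(2))
  ultimately show ?thesis using assms unfolding invariant_cone_def by auto
qed

text \<open>Orbit averages are the elements of the cone on which the residual gets tested; v = 0
  also supplies the starting point of the minimisation.\<close>

lemma orb_avg_in_invariant_cone: "A.orb_avg v \<in> invariant_cone"
  unfolding invariant_cone_def using A.orb_avg_psd A.orb_avg_invariant by blast

text \<open>The two summands of the index type are the two blocks of the residual, tr_R z and the
  output at \<rho>. \<open>Inr (r,s)\<close> is the entry (s,r) of
  \<open>choi_map d n z \<rho>\<close>, whence the transposed index in
  \<open>target\<close>.\<close>

definition constraint :: "complex mat \<Rightarrow> nat \<times> nat + nat \<times> nat \<Rightarrow> (nat \<times> nat \<Rightarrow> nat \<times> nat \<Rightarrow> complex) \<Rightarrow> complex" where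
  "constraint \<rho> k z = (case k of
      Inl (a,b) \<Rightarrow> \<Sum>r<d. z (r,a) (r,b)
    | Inr (r,s) \<Rightarrow> \<Sum>a<n. \<Sum>b<n. z (r,a) (s,b) * \<rho> $$ (b,a))"

definition target :: "complex mat \<Rightarrow> nat \<times> nat + nat \<times> nat \<Rightarrow> complex" where
  "target \<sigma> k = (case k of Inl (a,b) \<Rightarrow> if a = b then 1 else 0 | Inr (r,s) \<Rightarrow> \<sigma> $$ (s,r))"

definition constraints :: "(nat \<times> nat + nat \<times> nat) set" where
  "constraints = idx n n <+> idx d d"

lemma sum_constraints:
  "(\<Sum>k\<in>constraints. f k) = (\<Sum>a<n. \<Sum>b<n. f (Inl (a,b))) + (\<Sum>r<d. \<Sum>s<d. f (Inr (r,s)))"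
  unfolding constraints_def by (subst sum.Plus) (simp_all add: sum.cartesian_product')

text \<open>Coercivity rests on the first block of constraints: a bounded residual bounds the
  diagonal of tr_R z, hence the trace of z, hence by positivity every entry.\<close>

lemma least_squares_minimum:
  obtains m where "m \<in> invariant_cone"
    "\<And>z. z \<in> invariant_cone \<Longrightarrow> (\<Sum>k\<in>constraints. (cmod (constraint \<rho> k m - target \<sigma> k))\<^sup>2)
       \<le> (\<Sum>k\<in>constraints. (cmod (constraint \<rho> k z - target \<sigma> k))\<^sup>2)"
proof -
  define f where "f = (\<lambda>z. \<Sum>k\<in>constraints. (cmod (constraint \<rho> k z - target \<sigma> k))\<^sup>2)"
  \<comment> \<open>The comparison point is the zero kernel, written as the orbit average of the
    zero vector because this form is known to lie in the cone. Below its level each diagonal entry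
    of tr_R z is within \<open>sqrt F\<close> of 1, and b sums these bounds.\<close>
  define F where "F = f (A.orb_avg (\<lambda>_. 0))"
  define b where "b = (\<Sum>a<n. 1 + sqrt F)"
  have cont: "continuous_on UNIV f"
  proof -
    have "continuous_on UNIV (constraint \<rho> k)" for k
      by (cases k) (auto simp: constraint_def[abs_def] split: prod.split intro!: continuous_intros)
    then show ?thesis unfolding f_def by (intro continuous_intros)
  qed
  have loc: "f w = f z" if "\<And>p q. p \<in> idx d n \<Longrightarrow> q \<in> idx d n \<Longrightarrow> w p q = z p q" for z w
    unfolding f_def sum_constraints by (simp add: constraint_def that)
  have bound: "cmod (z p q) \<le> b"
    if z: "z \<in> invariant_cone" "f z \<le> f (A.orb_avg (\<lambda>_. 0))" and pq: "p \<in> idx d n" "q \<in> idx d n" for z p q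
  proof -
    have le: "Re (\<Sum>r<d. z (r,a) (r,a)) \<le> 1 + sqrt F" if "a < n" for a
    proof -
      have "(cmod (constraint \<rho> (Inl (a,a)) z - target \<sigma> (Inl (a,a))))\<^sup>2 \<le> f z"
        unfolding f_def using that
        by (intro member_le_sum) (auto simp: constraints_def)
      also have "\<dots> \<le> F" using z(2) by (simp add: F_def)
      finally have "cmod (constraint \<rho> (Inl (a,a)) z - target \<sigma> (Inl (a,a))) \<le> sqrt F"
        by (rule real_le_rsqrt)
      then have "cmod ((\<Sum>r<d. z (r,a) (r,a)) - 1) \<le> sqrt F" by (simp add: constraint_def target_def)
      then show ?thesis using complex_Re_le_cmod[of "(\<Sum>r<d. z (r,a) (r,a)) - 1"] by simp
    qed
    have "cmod (z p q) \<le> (\<Sum>p\<in>idx d n. Re (z p p))"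
      using z(1) pq by (intro psd_on_entry_bound) (auto simp: invariant_cone_def)
    also have "\<dots> = (\<Sum>a<n. Re (\<Sum>r<d. z (r,a) (r,a)))"
      unfolding sum.cartesian_product' Re_sum by (rule sum.swap)
    also have "\<dots> \<le> b" unfolding b_def by (intro sum_mono le) auto
    finally show ?thesis .
  qed
  obtain m where "m \<in> invariant_cone" "\<And>z. z \<in> invariant_cone \<Longrightarrow> f m \<le> f z"
  proof (rule coercive_minimum[where C=invariant_cone and f=f and I="idx d n" and B=b])
    show "A.orb_avg (\<lambda>_. 0) \<in> invariant_cone" by (rule orb_avg_in_invariant_cone)
    show "closed invariant_cone" by (rule closed_invariant_cone)
    show "continuous_on UNIV f" by (rule cont)
    show "w \<in> invariant_cone"
      if "z \<in> invariant_cone" "\<And>p q. p \<in> idx d n \<Longrightarrow> q \<in> idx d n \<Longrightarrow> w p q = z p q" for z w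
      using that by (rule invariant_cone_local)
    show "f w = f z" if "\<And>p q. p \<in> idx d n \<Longrightarrow> q \<in> idx d n \<Longrightarrow> w p q = z p q" for z w
      using that by (rule loc)
    show "cmod (z p q) \<le> b"
      if "z \<in> invariant_cone" "f z \<le> f (A.orb_avg (\<lambda>_. 0))" "p \<in> idx d n" "q \<in> idx d n" for z p q
      using that by (rule bound)
  qed blast
  then show ?thesis using that unfolding f_def by blast
qed

text \<open>A nonzero residual at the least squares solution is a separating functional \<open>(y, - \<eta>)\<close>.\<close>

lemma choi_operator_or_witness:
  assumes \<rho>: "is_state n \<rho>" and \<sigma>: "is_state d \<sigma>"
  obtains (choi) Z where "Z \<in> invariant_cone"
      "\<And>a b. a < n \<Longrightarrow> b < n \<Longrightarrow> (\<Sum>r<d. Z (r,a) (r,b)) = (if a = b then 1 else 0)"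
      "choi_map d n Z \<rho> = \<sigma>"
  | (witness) y \<eta> where "\<eta> \<in> carrier_mat d d" "adj \<eta> = \<eta>"
      "psd_on (idx d n) (\<lambda>p q. id_tensor (A.avg y) p q - A.tw (tensor_op \<eta> \<rho>) p q)"
      "Re (\<Sum>a<n. y a a) < Re (\<Sum>r<d. \<Sum>s<d. \<eta> $$ (r,s) * \<sigma> $$ (r,s))"
proof -
  have \<rho>c: "\<rho> \<in> carrier_mat n n" "adj \<rho> = \<rho>" and \<sigma>c: "\<sigma> \<in> carrier_mat d d" "adj \<sigma> = \<sigma>"
    using \<rho> \<sigma> unfolding is_state_def psd_def by auto
  obtain m where m: "m \<in> invariant_cone"
    and min: "\<And>z. z \<in> invariant_cone \<Longrightarrow> (\<Sum>k\<in>constraints. (cmod (constraint \<rho> k m - target \<sigma> k))\<^sup>2)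
       \<le> (\<Sum>k\<in>constraints. (cmod (constraint \<rho> k z - target \<sigma> k))\<^sup>2)"
    using least_squares_minimum[of \<rho> \<sigma>] by blast
  define w where "w = (\<lambda>k. constraint \<rho> k m - target \<sigma> k)"
  have fin: "finite constraints" by (simp add: constraints_def)
  have lin: "constraint \<rho> k (\<lambda>p q. of_real s * z p q + of_real t * v p q)
      = of_real s * constraint \<rho> k z + of_real t * constraint \<rho> k v" for k z v s t
    by (cases k) (auto simp: constraint_def sum_distrib_left sum.distrib distrib_left distrib_right mult_ac split: prod.split)
  have res: "0 \<le> Re (\<Sum>k\<in>constraints. cnj (w k) * constraint \<rho> k z)" if z: "z \<in> invariant_cone" for z
    unfolding w_def
    by (rule least_squares_residual(1)[where C=invariant_cone and L="constraint \<rho>"])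
      (rule fin lin m z | rule invariant_cone_combination min, assumption+)+
  have res2: "Re (\<Sum>k\<in>constraints. cnj (w k) * target \<sigma> k) = - (\<Sum>k\<in>constraints. (cmod (w k))\<^sup>2)"
    unfolding w_def
    by (rule least_squares_residual(2)[where C=invariant_cone and L="constraint \<rho>"])
      (rule fin lin m | rule invariant_cone_combination min, assumption+)+
  show thesis
  proof (cases "\<forall>k\<in>constraints. w k = 0")
    case True
    have "(\<Sum>r<d. m (r,a) (r,b)) = (if a = b then 1 else 0)" if "a < n" "b < n" for a b
    proof -
      have "w (Inl (a,b)) = 0" using True that by (auto simp: constraints_def)
      then show ?thesis by (simp add: w_def constraint_def target_def)
    qed
    moreover have "choi_map d n m \<rho> = \<sigma>"
    proof (rule eq_matI)
      fix s r assume "s < dim_row \<sigma>" "r < dim_col \<sigma>"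
      then have sr: "s < d" "r < d" using \<sigma>c by auto
      then have "w (Inr (r,s)) = 0" using True by (auto simp: constraints_def)
      then show "choi_map d n m \<rho> $$ (s,r) = \<sigma> $$ (s,r)"
        using sr by (simp add: w_def constraint_def target_def choi_map_def)
    qed (use \<sigma>c in \<open>auto simp: choi_map_def\<close>)
    ultimately show thesis using choi[of m] m by blast
  next
    case False
    define y where "y = (\<lambda>a b. w (Inl (a,b)))"
    \<comment> \<open>The minus sign gives the functional the shape 1 \<otimes> y - \<eta> \<otimes>
      \<rho>. As \<open>Inr (s,r)\<close> refers to the output entry (r,s), \<eta> is the transpose
      of \<sigma> minus the output at m, and this transpose is the one in the overlap with
      \<sigma>.\<close>
    define \<eta> where "\<eta> = mat d d (\<lambda>(s,r). - w (Inr (s,r)))"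
    have pm: "psd_on (idx d n) m" using m unfolding invariant_cone_def by blast
    have yh: "y b a = cnj (y a b)" if "a < n" "b < n" for a b
    proof -
      have "(\<Sum>r<d. m (r,b) (r,a)) = cnj (\<Sum>r<d. m (r,a) (r,b))"
        unfolding cnj_sum using that by (intro sum.cong refl psd_on_herm[OF pm]) auto
      then show ?thesis by (simp add: y_def w_def constraint_def target_def)
    qed
    have wh: "w (Inr (s,r)) = cnj (w (Inr (r,s)))" if "r < d" "s < d" for r s
    proof -
      have "(\<Sum>a<n. \<Sum>b<n. m (s,a) (r,b) * \<rho> $$ (b,a)) = (\<Sum>b<n. \<Sum>a<n. m (s,a) (r,b) * \<rho> $$ (b,a))"
        by (rule sum.swap)
      also have "\<dots> = cnj (\<Sum>a<n. \<Sum>b<n. m (r,a) (s,b) * \<rho> $$ (b,a))"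
        unfolding cnj_sum
      proof (intro sum.cong refl)
        fix a b assume "a \<in> {..<n}" "b \<in> {..<n}"
        then show "m (s,b) (r,a) * \<rho> $$ (a,b) = cnj (m (r,a) (s,b) * \<rho> $$ (b,a))"
          using psd_on_herm[OF pm, of "(r,a)" "(s,b)"] adj_eq_entry[OF \<rho>c(2,1), of b a] that by simp
      qed
      finally show ?thesis
        using adj_eq_entry[OF \<sigma>c(2,1), of s r] that by (simp add: w_def constraint_def target_def)
    qed
    have \<eta>c: "\<eta> \<in> carrier_mat d d" by (simp add: \<eta>_def)
    have \<eta>h: "adj \<eta> = \<eta>"
    proof (rule adj_eqI[OF \<eta>c])
      fix i j assume "i < d" "j < d"
      then show "\<eta> $$ (j,i) = cnj (\<eta> $$ (i,j))" using wh[of i j] by (simp add: \<eta>_def)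
    qed
    let ?M = "\<lambda>p q. id_tensor y p q - tensor_op \<eta> \<rho> p q"
    have Mtw: "A.tw ?M p q = id_tensor (A.avg y) p q - A.tw (tensor_op \<eta> \<rho>) p q"
      if "p \<in> idx d n" "q \<in> idx d n" for p q
      using A.tw_linear[OF that, of 1 "id_tensor y" "- 1" "tensor_op \<eta> \<rho>"] A.tw_id_tensor[OF that] by simp
    have tw_psd: "psd_on (idx d n) (A.tw ?M)"
    proof (rule psd_onI)
      fix p q assume pq: "p \<in> idx d n" "q \<in> idx d n"
      show "A.tw ?M q p = cnj (A.tw ?M p q)"
      proof (rule A.tw_herm[OF _ pq])
        fix k l assume kl: "k \<in> idx d n" "l \<in> idx d n"
        have "id_tensor y l k = cnj (id_tensor y k l)"
          using kl yh[of "snd k" "snd l"] by (auto simp: id_tensor_def)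
        moreover have "tensor_op \<eta> \<rho> l k = cnj (tensor_op \<eta> \<rho> k l)"
          using kl adj_eq_entry[OF \<eta>h \<eta>c, of "fst k" "fst l"] adj_eq_entry[OF \<rho>c(2,1), of "snd k" "snd l"]
          by (auto simp: tensor_op_def)
        ultimately show "?M l k = cnj (?M k l)" by simp
      qed
    next
      fix v
      \<comment> \<open>By \<open>tw_pairing\<close> the twirled form at v is the functional
        evaluated at \<open>orb_avg v\<close>. This kernel lies in the cone, where the residual
        pairs nonnegatively.\<close>
      let ?z = "A.orb_avg v"
      have "(\<Sum>p\<in>idx d n. \<Sum>q\<in>idx d n. cnj (v p) * A.tw ?M p q * v q)
        = (\<Sum>k\<in>idx d n. \<Sum>l\<in>idx d n. id_tensor y k l * ?z l k) - (\<Sum>k\<in>idx d n. \<Sum>l\<in>idx d n. tensor_op \<eta> \<rho> k l * ?z l k)"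
        unfolding A.tw_pairing by (simp only: left_diff_distrib sum_subtractf)
      also have "(\<Sum>k\<in>idx d n. \<Sum>l\<in>idx d n. id_tensor y k l * ?z l k)
        = (\<Sum>a<n. \<Sum>b<n. cnj (w (Inl (a,b))) * constraint \<rho> (Inl (a,b)) ?z)"
      proof -
        have "(\<Sum>k\<in>idx d n. \<Sum>l\<in>idx d n. id_tensor y k l * ?z l k)
          = (\<Sum>s<d. \<Sum>b<n. \<Sum>r<d. if r = s then (\<Sum>a<n. y b a * ?z (r,a) (s,b)) else 0)"
          unfolding sum.cartesian_product' by (intro sum.cong refl) (auto simp: id_tensor_def)
        also have "\<dots> = (\<Sum>s<d. \<Sum>b<n. \<Sum>a<n. y b a * ?z (s,a) (s,b))" by simp
        also have "\<dots> = (\<Sum>b<n. \<Sum>s<d. \<Sum>a<n. y b a * ?z (s,a) (s,b))" by (rule sum.swap)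
        also have "\<dots> = (\<Sum>b<n. \<Sum>a<n. \<Sum>s<d. y b a * ?z (s,a) (s,b))" by (intro sum.cong refl sum.swap)
        also have "\<dots> = (\<Sum>a<n. \<Sum>b<n. \<Sum>s<d. y b a * ?z (s,a) (s,b))" by (rule sum.swap)
        also have "\<dots> = (\<Sum>a<n. \<Sum>b<n. cnj (w (Inl (a,b))) * constraint \<rho> (Inl (a,b)) ?z)"
        proof (intro sum.cong refl)
          fix a b assume "a \<in> {..<n}" "b \<in> {..<n}"
          then have "y b a = cnj (w (Inl (a,b)))" using yh[of a b] by (simp add: y_def)
          then show "(\<Sum>s<d. y b a * ?z (s,a) (s,b)) = cnj (w (Inl (a,b))) * constraint \<rho> (Inl (a,b)) ?z"
            by (simp add: constraint_def sum_distrib_left)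
        qed
        finally show ?thesis .
      qed
      also have "(\<Sum>k\<in>idx d n. \<Sum>l\<in>idx d n. tensor_op \<eta> \<rho> k l * ?z l k)
        = - (\<Sum>r<d. \<Sum>s<d. cnj (w (Inr (r,s))) * constraint \<rho> (Inr (r,s)) ?z)"
      proof -
        have "(\<Sum>k\<in>idx d n. \<Sum>l\<in>idx d n. tensor_op \<eta> \<rho> k l * ?z l k)
          = (\<Sum>l\<in>idx d n. \<Sum>k\<in>idx d n. tensor_op \<eta> \<rho> k l * ?z l k)" by (rule sum.swap)
        also have "\<dots> = (\<Sum>r<d. \<Sum>a<n. \<Sum>s<d. \<Sum>b<n. \<eta> $$ (s,r) * (?z (r,a) (s,b) * \<rho> $$ (b,a)))"
          unfolding sum.cartesian_product' by (intro sum.cong refl) (simp add: tensor_op_def mult_ac)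
        also have "\<dots> = (\<Sum>r<d. \<Sum>s<d. \<Sum>a<n. \<Sum>b<n. \<eta> $$ (s,r) * (?z (r,a) (s,b) * \<rho> $$ (b,a)))"
          by (intro sum.cong refl sum.swap)
        also have "\<dots> = (\<Sum>r<d. \<Sum>s<d. - (cnj (w (Inr (r,s))) * constraint \<rho> (Inr (r,s)) ?z))"
        proof (intro sum.cong refl)
          fix r s assume "r \<in> {..<d}" "s \<in> {..<d}"
          then have "\<eta> $$ (s,r) = - cnj (w (Inr (r,s)))" using wh[of r s] by (simp add: \<eta>_def)
          then show "(\<Sum>a<n. \<Sum>b<n. \<eta> $$ (s,r) * (?z (r,a) (s,b) * \<rho> $$ (b,a)))
            = - (cnj (w (Inr (r,s))) * constraint \<rho> (Inr (r,s)) ?z)"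
            by (simp add: constraint_def sum_distrib_left sum_negf)
        qed
        finally show ?thesis by (simp only: sum_negf)
      qed
      finally have "(\<Sum>p\<in>idx d n. \<Sum>q\<in>idx d n. cnj (v p) * A.tw ?M p q * v q)
        = (\<Sum>k\<in>constraints. cnj (w k) * constraint \<rho> k ?z)"
        unfolding sum_constraints by simp
      then show "0 \<le> Re (\<Sum>p\<in>idx d n. \<Sum>q\<in>idx d n. cnj (v p) * A.tw ?M p q * v q)"
        using res[OF orb_avg_in_invariant_cone] by simp
    qed
    have "psd_on (idx d n) (A.tw ?M) \<longleftrightarrow>
        psd_on (idx d n) (\<lambda>p q. id_tensor (A.avg y) p q - A.tw (tensor_op \<eta> \<rho>) p q)"
      by (rule psd_on_cong) (rule Mtw)
    with tw_psd have psd: "psd_on (idx d n) (\<lambda>p q. id_tensor (A.avg y) p q - A.tw (tensor_op \<eta> \<rho>) p q)"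
      by blast
    \<comment> \<open>One nonzero component makes the squared norm of the residual positive, so its
      pairing with the target is strictly negative. Expanded over the two blocks, the real part of
      this pairing is tr y minus the overlap.\<close>
    obtain k0 where k0: "k0 \<in> constraints" "w k0 \<noteq> 0" using False by blast
    have "0 < (\<Sum>k\<in>constraints. (cmod (w k))\<^sup>2)"
      by (rule sum_pos2[OF fin k0(1)]) (use k0(2) in auto)
    then have neg: "Re (\<Sum>k\<in>constraints. cnj (w k) * target \<sigma> k) < 0"
      using res2 by simp
    have "(\<Sum>a<n. \<Sum>b<n. cnj (w (Inl (a,b))) * target \<sigma> (Inl (a,b))) = (\<Sum>a<n. cnj (y a a))"
      using sum_delta_pair(2)[of "\<lambda>a b. cnj (w (Inl (a,b)))" n] by (simp add: target_def y_def)
    moreover have "(\<Sum>r<d. \<Sum>s<d. cnj (w (Inr (r,s))) * target \<sigma> (Inr (r,s))) = - (\<Sum>r<d. \<Sum>s<d. \<eta> $$ (r,s) * \<sigma> $$ (r,s))"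
    proof -
      have "(\<Sum>r<d. \<Sum>s<d. cnj (w (Inr (r,s))) * target \<sigma> (Inr (r,s))) = (\<Sum>r<d. \<Sum>s<d. - (\<eta> $$ (s,r) * \<sigma> $$ (s,r)))"
      proof (intro sum.cong refl)
        fix r s assume "r \<in> {..<d}" "s \<in> {..<d}"
        then have "\<eta> $$ (s,r) = - cnj (w (Inr (r,s)))" using wh[of r s] by (simp add: \<eta>_def)
        then show "cnj (w (Inr (r,s))) * target \<sigma> (Inr (r,s)) = - (\<eta> $$ (s,r) * \<sigma> $$ (s,r))"
          by (simp add: target_def)
      qed
      also have "\<dots> = (\<Sum>s<d. \<Sum>r<d. - (\<eta> $$ (s,r) * \<sigma> $$ (s,r)))" by (rule sum.swap)
      finally show ?thesis by (simp only: sum_negf)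
    qed
    ultimately have "Re (\<Sum>a<n. y a a) < Re (\<Sum>r<d. \<Sum>s<d. \<eta> $$ (r,s) * \<sigma> $$ (r,s))"
      using neg unfolding sum_constraints by simp
    then show thesis using witness[OF \<eta>c \<eta>h psd] by blast
  qed
qed

end

text \<open>Each entropy is minus the logarithm of an infimum, so comparing entropies amounts to
  comparing infima once these are positive. Twirling keeps the trace at one, and then every
  dominating trace is at least 1/d.\<close>

lemma Delta_H_nonneg_iff:
  assumes "channel_setting G T \<mu> d n UA UB" and \<eta>: "is_state d \<eta>"
    and \<rho>: "is_state n \<rho>" and \<sigma>: "is_state d \<sigma>" and d: "0 < d"
  shows "0 \<le> Delta_H \<mu> n UA d UB \<eta> \<rho> \<sigma> \<longleftrightarrow>
    Inf (dominating_traces d d (unitary_action.tw \<mu> (idx d d) (tensor_rep UB UB) (tensor_op \<eta> \<sigma>)))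
      \<le> Inf (dominating_traces d n (unitary_action.tw \<mu> (idx d n) (tensor_rep UB UA) (tensor_op \<eta> \<rho>)))"
proof -
  interpret channel_setting G T \<mu> d n UA UB by (rule assms(1))
  have c: "\<eta> \<in> carrier_mat d d" "\<rho> \<in> carrier_mat n n" "\<sigma> \<in> carrier_mat d d"
    and tr: "mtrace \<eta> = 1" "mtrace \<rho> = 1" "mtrace \<sigma> = 1"
    using \<eta> \<rho> \<sigma> unfolding is_state_def by auto
  have pos: "0 < Inf (dominating_traces d m W)"
    if W: "psd_on (idx d m) W" and t: "(\<Sum>p\<in>idx d m. W p p) = 1" for W m
  proof -
    have "1 / real d \<le> Inf (dominating_traces d m W)"
    proof (rule cInf_greatest[OF dominating_traces_nonempty[OF W d]])
      fix x assume "x \<in> dominating_traces d m W"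
      from dominating_traces_ge[OF this] show "1 / real d \<le> x" using d by (simp add: t field_simps)
    qed
    moreover have "0 < 1 / real d" using d by simp
    ultimately show ?thesis by linarith
  qed
  have "0 < Inf (dominating_traces d n (A.tw (tensor_op \<eta> \<rho>)))"
    by (rule pos[OF A.tw_psd[OF psd_on_tensor_op[OF \<eta> \<rho>]]])
      (simp add: A.tw_trace trace_tensor_op[OF c(1,2)] tr)
  moreover have "0 < Inf (dominating_traces d d (B.tw (tensor_op \<eta> \<sigma>)))"
    by (rule pos[OF B.tw_psd[OF psd_on_tensor_op[OF \<eta> \<sigma>]]])
      (simp add: B.tw_trace trace_tensor_op[OF c(1,3)] tr)
  ultimately show ?thesis
    unfolding Delta_H_def A.H_eta_eq[OF c(1,2)] B.H_eta_eq[OF c(1,3)] by simp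
qed

text \<open>Moving \<open>\<eta>\<close> along the line through the identity changes both sides of the strict inequality by the
  same affine map, so a separating functional can be normalised to a reference state on the boundary.\<close>

lemma (in channel_setting) witness_on_boundary:
  assumes D: "D \<subseteq> {\<eta>. is_state d \<eta>}" and mm: "max_mixed d \<in> rel_int d D"
    and \<rho>: "is_state n \<rho>" and \<sigma>: "is_state d \<sigma>" and d: "0 < d"
    and \<eta>: "\<eta> \<in> carrier_mat d d" "adj \<eta> = \<eta>"
    and psd: "psd_on (idx d n) (\<lambda>p q. id_tensor (A.avg y) p q - A.tw (tensor_op \<eta> \<rho>) p q)"
    and less: "Re (\<Sum>a<n. y a a) < Re (\<Sum>r<d. \<Sum>s<d. \<eta> $$ (r,s) * \<sigma> $$ (r,s))"
  obtains \<eta>' where "\<eta>' \<in> rel_bdry d D"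
    "Inf (dominating_traces d n (A.tw (tensor_op \<eta>' \<rho>))) < Inf (dominating_traces d d (B.tw (tensor_op \<eta>' \<sigma>)))"
proof -
  have \<rho>c: "\<rho> \<in> carrier_mat n n" "mtrace \<rho> = 1" and \<sigma>c: "\<sigma> \<in> carrier_mat d d" "mtrace \<sigma> = 1"
    using \<rho> \<sigma> unfolding is_state_def by auto
  let ?\<rho> = "\<lambda>a b. \<rho> $$ (a,b)"
  have tr\<rho>: "(\<Sum>a<n. ?\<rho> a a) = 1" and tr\<sigma>: "(\<Sum>r<d. \<sigma> $$ (r,r)) = 1"
    using \<rho>c \<sigma>c by (auto simp: mtrace_def)
  define c where "c = Re (mtrace \<eta>) / real d"
  have "mtrace \<eta> \<in> \<real>"
  proof -
    have "cnj (\<eta> $$ (r,r)) = \<eta> $$ (r,r)" if "r < d" for r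
      using adj_eq_entry[OF \<eta>(2,1) that that] by (rule sym)
    then have "cnj (mtrace \<eta>) = mtrace \<eta>" using \<eta>(1) by (simp add: mtrace_def)
    then show ?thesis by (simp add: Reals_cnj_iff)
  qed
  then have trc: "mtrace \<eta> = of_nat d * of_real c" using d by (auto simp: c_def elim: Reals_cases)
  \<comment> \<open>The traceless part of \<eta>, which is the direction in which the ray leaves the
    maximally mixed state.\<close>
  define X where "X = mat d d (\<lambda>(r,s). \<eta> $$ (r,s) - (if r = s then of_real c else 0))"
  have X: "X \<in> carrier_mat d d" by (simp add: X_def)
  have Xa: "adj X = X"
  proof (rule adj_eqI[OF X])
    fix i j assume ij: "i < d" "j < d"
    show "X $$ (j,i) = cnj (X $$ (i,j))"
      using adj_eq_entry[OF \<eta>(2,1) ij] ij by (simp add: X_def)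
  qed
  have Xt: "mtrace X = 0"
    using \<eta>(1) trc by (simp add: mtrace_def X_def sum_subtractf)
  have overlap: "(\<Sum>r<d. \<Sum>s<d. (of_real t * \<eta> $$ (r,s) + of_real x * (if r = s then 1 else 0)) * \<sigma> $$ (r,s))
    = of_real t * (\<Sum>r<d. \<Sum>s<d. \<eta> $$ (r,s) * \<sigma> $$ (r,s)) + of_real x" for t x
  proof -
    have "(\<Sum>r<d. \<Sum>s<d. (of_real t * \<eta> $$ (r,s) + of_real x * (if r = s then 1 else 0)) * \<sigma> $$ (r,s))
      = of_real t * (\<Sum>r<d. \<Sum>s<d. \<eta> $$ (r,s) * \<sigma> $$ (r,s))
        + of_real x * (\<Sum>r<d. \<Sum>s<d. (if r = s then 1 else 0) * \<sigma> $$ (r,s))"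
      by (simp only: distrib_right sum.distrib sum_distrib_left mult.assoc)
    then show ?thesis unfolding sum_delta_pair(1) by (simp add: tr\<sigma>)
  qed
  \<comment> \<open>If \<eta> were c times the identity, the overlap would be c, while the trace of
    the dominating inequality gives tr y \<ge> c; this contradicts the strict inequality.\<close>
  have "\<exists>i0<d. \<exists>j0<d. X $$ (i0,j0) \<noteq> 0"
  proof (rule ccontr)
    assume "\<not> ?thesis"
    then have \<eta>e: "\<eta> $$ (r,s) = of_real 0 * \<eta> $$ (r,s) + of_real c * (if r = s then 1 else 0)" if "r < d" "s < d" for r s
      using that by (auto simp: X_def split: if_splits)
    have "(\<Sum>r<d. \<Sum>s<d. \<eta> $$ (r,s) * \<sigma> $$ (r,s))
      = (\<Sum>r<d. \<Sum>s<d. (of_real 0 * \<eta> $$ (r,s) + of_real c * (if r = s then 1 else 0)) * \<sigma> $$ (r,s))"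
    proof (intro sum.cong refl)
      fix r s assume "r \<in> {..<d}" "s \<in> {..<d}"
      then show "\<eta> $$ (r,s) * \<sigma> $$ (r,s) = (of_real 0 * \<eta> $$ (r,s) + of_real c * (if r = s then 1 else 0)) * \<sigma> $$ (r,s)"
        by (intro arg_cong[where f="\<lambda>x. x * _"] \<eta>e) auto
    qed
    then have ov: "(\<Sum>r<d. \<Sum>s<d. \<eta> $$ (r,s) * \<sigma> $$ (r,s)) = of_real c" unfolding overlap by simp
    have "0 \<le> (\<Sum>p\<in>idx d n. Re (id_tensor (A.avg y) p p - A.tw (tensor_op \<eta> \<rho>) p p))"
      by (rule sum_nonneg) (rule psd_on_diag(1)[OF psd], auto)
    also have "\<dots> = Re (of_nat d * (\<Sum>a<n. y a a)) - Re (mtrace \<eta>)"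
      using A.tw_trace[of "tensor_op \<eta> \<rho>"] trace_id_tensor[where d=d and n=n and y="A.avg y"] A.trace_avg[OF d, of y]
      by (simp add: sum_subtractf trace_tensor_op[OF \<eta>(1) \<rho>c(1)] \<rho>c(2) flip: Re_sum)
    also have "\<dots> = real d * (Re (\<Sum>a<n. y a a) - c)" by (simp add: trc algebra_simps)
    finally show False using less d unfolding ov by (simp add: zero_le_mult_iff)
  qed
  then obtain t where t: "0 < t" "max_mixed d + complex_of_real t \<cdot>\<^sub>m X \<in> rel_bdry d D"
    using exists_rel_bdry_on_ray[OF D mm X Xa Xt] by blast
  define \<eta>' where "\<eta>' = max_mixed d + complex_of_real t \<cdot>\<^sub>m X"
  have bd: "\<eta>' \<in> rel_bdry d D" using t(2) by (simp add: \<eta>'_def)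
  have st: "is_state d \<eta>'" by (rule rel_bdry_states[OF D bd])
  \<comment> \<open>The coefficient of the identity when 1/d + t (\<eta> - c) is expanded in \<eta>
    and 1.\<close>
  define x where "x = 1 / real d - t * c"
  have \<eta>'e: "\<eta>' $$ (r,s) = of_real t * \<eta> $$ (r,s) + of_real x * (if r = s then 1 else 0)" if "r < d" "s < d" for r s
    using that X by (simp add: \<eta>'_def max_mixed_def X_def x_def algebra_simps)
  have tw': "A.tw (tensor_op \<eta>' \<rho>) p q = of_real t * A.tw (tensor_op \<eta> \<rho>) p q + of_real x * id_tensor (A.avg ?\<rho>) p q"
    if pq: "p \<in> idx d n" "q \<in> idx d n" for p q
  proof -
    have "A.tw (tensor_op \<eta>' \<rho>) p q = A.tw (\<lambda>k l. of_real t * tensor_op \<eta> \<rho> k l + of_real x * id_tensor ?\<rho> k l) p q"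
      by (rule A.tw_cong) (auto simp: tensor_op_def id_tensor_def \<eta>'e algebra_simps)
    then show ?thesis using A.tw_linear[OF pq] A.tw_id_tensor[OF pq] by simp
  qed
  \<comment> \<open>The first term scales the old dominating operator. The second reproduces exactly
    the twirl of x times 1 \<otimes> \<rho>, so it cancels in the difference and x may have either
    sign.\<close>
  define y' where "y' = (\<lambda>a b. of_real t * A.avg y a b + of_real x * A.avg ?\<rho> a b)"
  have "psd_on (idx d n) (\<lambda>p q. of_real t * (id_tensor (A.avg y) p q - A.tw (tensor_op \<eta> \<rho>) p q)
      + of_real 0 * (id_tensor (A.avg y) p q - A.tw (tensor_op \<eta> \<rho>) p q))"
    using t(1) by (intro psd_on_add_scaled psd) auto
  moreover have "of_real t * (id_tensor (A.avg y) p q - A.tw (tensor_op \<eta> \<rho>) p q)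
      + of_real 0 * (id_tensor (A.avg y) p q - A.tw (tensor_op \<eta> \<rho>) p q)
    = id_tensor y' p q - A.tw (tensor_op \<eta>' \<rho>) p q" if "p \<in> idx d n" "q \<in> idx d n" for p q
    using tw'[OF that] by (simp add: y'_def id_tensor_def algebra_simps)
  ultimately have psd': "psd_on (idx d n) (\<lambda>p q. id_tensor y' p q - A.tw (tensor_op \<eta>' \<rho>) p q)"
    using psd_on_cong by (metis (no_types, lifting))
  have psdA: "psd_on (idx d n) (A.tw (tensor_op \<eta>' \<rho>))"
    by (rule A.tw_psd[OF psd_on_tensor_op[OF st \<rho>]])
  have psdB: "psd_on (idx d d) (B.tw (tensor_op \<eta>' \<sigma>))"
    by (rule B.tw_psd[OF psd_on_tensor_op[OF st \<sigma>]])
  have "bdd_below (dominating_traces d n (A.tw (tensor_op \<eta>' \<rho>)))"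
  proof (rule bdd_belowI)
    fix z assume "z \<in> dominating_traces d n (A.tw (tensor_op \<eta>' \<rho>))"
    from dominating_traces_ge[OF this]
    show "Re (\<Sum>p\<in>idx d n. A.tw (tensor_op \<eta>' \<rho>) p p) / real d \<le> z" using d by (simp add: field_simps)
  qed
  then have "Inf (dominating_traces d n (A.tw (tensor_op \<eta>' \<rho>))) \<le> Re (\<Sum>a<n. y' a a)"
    by (rule cInf_lower[OF dominating_tracesI[OF psdA psd' d]])
  also have "(\<Sum>a<n. y' a a) = of_real t * (\<Sum>a<n. y a a) + of_real x"
    using A.trace_avg[OF d, of y] A.trace_avg[OF d, of ?\<rho>] tr\<rho>
    by (simp add: y'_def sum.distrib flip: sum_distrib_left)
  also have "Re \<dots> < Re (of_real t * (\<Sum>r<d. \<Sum>s<d. \<eta> $$ (r,s) * \<sigma> $$ (r,s)) + of_real x)"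
    using less t(1) by simp
  also have "of_real t * (\<Sum>r<d. \<Sum>s<d. \<eta> $$ (r,s) * \<sigma> $$ (r,s)) + of_real x
    = (\<Sum>r<d. \<Sum>s<d. \<eta>' $$ (r,s) * \<sigma> $$ (r,s))"
    unfolding overlap[symmetric] by (intro sum.cong refl) (simp add: \<eta>'e)
  also have "Re \<dots> \<le> Inf (dominating_traces d d (B.tw (tensor_op \<eta>' \<sigma>)))"
    by (rule cInf_greatest[OF dominating_traces_nonempty[OF psdB d] dominating_traces_overlap_le])
  finally show thesis using that[OF bd] by blast
qed

theorem theorem2:
  fixes G :: "('g, 'b) monoid_scheme" and T :: "'g topology" and \<mu> :: "'g measure"
    and dA dB :: nat and UA UB :: "'g \<Rightarrow> complex mat"
    and \<rho> \<sigma> :: "complex mat" and D :: "complex mat set"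
  assumes "compact_group G T"
    and "haar_prob G T \<mu>"
    and "unitary_rep G T dA UA"
    and "unitary_rep G T dB UB"
    and "is_state dA \<rho>"
    and "is_state dB \<sigma>"
    and "D \<subseteq> {\<eta>. is_state dB \<eta>}"
    and "max_mixed dB \<in> rel_int dB D"
  shows "(\<exists>E. channel dA dB E \<and> covariant G dA UA UB E \<and> E \<rho> = \<sigma>)
         \<longleftrightarrow> (\<forall>\<eta> \<in> rel_bdry dB D. Delta_H \<mu> dA UA dB UB \<eta> \<rho> \<sigma> \<ge> 0)"
proof -
  interpret S: channel_setting G T \<mu> dB dA UA UB
    using assms by (intro channel_setting.intro covariance_setting.intro)
  note setting = S.channel_setting_axioms
  \<comment> \<open>In dimension 0 the trace is an empty sum and cannot be 1.\<close>
  have d: "0 < dB" using assms(6) by (intro gr0I) (auto simp: is_state_def mtrace_def)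
  have Delta: "0 \<le> Delta_H \<mu> dA UA dB UB \<eta> \<rho> \<sigma> \<longleftrightarrow>
      Inf (dominating_traces dB dB (S.B.tw (tensor_op \<eta> \<sigma>))) \<le> Inf (dominating_traces dB dA (S.A.tw (tensor_op \<eta> \<rho>)))"
    if "\<eta> \<in> rel_bdry dB D" for \<eta>
    by (rule Delta_H_nonneg_iff[OF setting rel_bdry_states[OF assms(7) that] assms(5,6) d])
  show ?thesis
  proof
    assume "\<exists>E. channel dA dB E \<and> covariant G dA UA UB E \<and> E \<rho> = \<sigma>"
    then obtain E where E: "channel dA dB E" "covariant G dA UA UB E" "E \<rho> = \<sigma>" by blast
    show "\<forall>\<eta> \<in> rel_bdry dB D. Delta_H \<mu> dA UA dB UB \<eta> \<rho> \<sigma> \<ge> 0"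
    proof
      fix \<eta> assume \<eta>: "\<eta> \<in> rel_bdry dB D"
      note st = rel_bdry_states[OF assms(7) \<eta>]
      \<comment> \<open>More dominating operators mean a smaller infimum, provided that the larger
        set is bounded below; the overlap is such a bound.\<close>
      have "bdd_below (dominating_traces dB dB (S.B.tw (tensor_op \<eta> \<sigma>)))"
        using S.dominating_traces_overlap_le by (rule bdd_belowI)
      then have "Inf (dominating_traces dB dB (S.B.tw (tensor_op \<eta> \<sigma>)))
          \<le> Inf (dominating_traces dB dA (S.A.tw (tensor_op \<eta> \<rho>)))"
        using dominating_traces_nonempty[OF S.A.tw_psd[OF psd_on_tensor_op[OF st assms(5)]] d]
          S.covariant_channel_dominating_traces[OF E st assms(5,6) d]
        by (intro cInf_superset_mono)
      then show "0 \<le> Delta_H \<mu> dA UA dB UB \<eta> \<rho> \<sigma>" unfolding Delta[OF \<eta>] .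
    qed
  next
    assume ge: "\<forall>\<eta> \<in> rel_bdry dB D. Delta_H \<mu> dA UA dB UB \<eta> \<rho> \<sigma> \<ge> 0"
    show "\<exists>E. channel dA dB E \<and> covariant G dA UA UB E \<and> E \<rho> = \<sigma>"
    proof (rule S.choi_operator_or_witness[OF assms(5,6)])
      fix Z assume Z: "Z \<in> S.invariant_cone"
        "\<And>a b. a < dA \<Longrightarrow> b < dA \<Longrightarrow> (\<Sum>r<dB. Z (r,a) (r,b)) = (if a = b then 1 else 0)"
        "choi_map dB dA Z \<rho> = \<sigma>"
      have "channel dA dB (choi_map dB dA Z)"
        using Z(1,2) by (intro channel_choi_map) (auto simp: S.invariant_cone_def)
      moreover have "covariant G dA UA UB (choi_map dB dA Z)"
        using Z(1) by (intro S.A.covariant_choi_map) (auto simp: S.invariant_cone_def)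
      ultimately show ?thesis using Z(3) by blast
    next
      fix y \<eta> assume w: "\<eta> \<in> carrier_mat dB dB" "adj \<eta> = \<eta>"
        "psd_on (idx dB dA) (\<lambda>p q. id_tensor (S.A.avg y) p q - S.A.tw (tensor_op \<eta> \<rho>) p q)"
        "Re (\<Sum>a<dA. y a a) < Re (\<Sum>r<dB. \<Sum>s<dB. \<eta> $$ (r,s) * \<sigma> $$ (r,s))"
      obtain \<eta>' where "\<eta>' \<in> rel_bdry dB D"
        "Inf (dominating_traces dB dA (S.A.tw (tensor_op \<eta>' \<rho>))) < Inf (dominating_traces dB dB (S.B.tw (tensor_op \<eta>' \<sigma>)))"
        by (rule S.witness_on_boundary[OF assms(7,8,5,6) d w])
      with ge Delta show ?thesis by (meson leD)
    qed
  qed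
qed

end
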